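(* Let $\Lambda$ and $\Gamma$ be Morita equivalent $\mathsf{k}$-algebras. If $\Lambda$ is quasicommutative, then $\Gamma$ is quasicommutative. That is, quasicommutativity is a Morita invariant.
   Context: $\mathsf{k}$ is an arbitrary field. All modules are left modules. For a $\mathsf{k}$-algebra $\Gamma$, $\operatorname{cfs}\Gamma$ denotes the set of maximal two-sided ideals $\mathfrak{m}$ of $\Gamma$ such that $\Gamma/\mathfrak{m}$ is finite dimensional over $\mathsf{k}$. For $\mathfrak{m}\in\operatorname{cfs}\Gamma$, $\mathsf{S}_{\mathfrak{m}}$ denotes the unique (up to isomorphism) simple $\Gamma/\mathfrak{m}$-module, regarded as a $\Gamma$-module. $\Gamma$ is called quasicommutative if $\operatorname{Ext}^1_\Gamma(\mathsf{S}_{\mathfrak{m}},\mathsf{S}_{\mathfrak{n}})=0$ for all distinct $\mathfrak{m},\mathfrak{n}\in\operatorname{cfs}\Gamma$. *)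

theory Defs
  imports
    "Jordan_Normal_Form.Missing_VectorSpace"
    "HOL-Algebra.QuotRing"
    "HOL-Library.Equipollence"
begin

section \<open>Algebras and left modules\<close>

text \<open>
  The locale \<open>algebra\<close> of HOL-Algebra is restricted to commutative algebras, and its locale
  \<open>module\<close> to modules over commutative rings; the two locales below drop commutativity of the
  algebra, respectively of the base ring.  The zero algebra is allowed.  In records of type
  \<^typ>\<open>('a, 'm) module\<close> that serve as left modules, the fields \<^term>\<open>mult\<close> and \<^term>\<open>one\<close>
  carry no meaning.
\<close>

locale k_algebra = vectorspace K A + A?: ring A
  for K :: "('k, 'x) ring_scheme" and A :: "('k, 'a, 'y) module_scheme" +
  assumes smult_mult_left:
      "\<lbrakk>c \<in> carrier K; x \<in> carrier A; y \<in> carrier A\<rbrakk> \<Longrightarrow>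
        (c \<odot>\<^bsub>A\<^esub> x) \<otimes>\<^bsub>A\<^esub> y = c \<odot>\<^bsub>A\<^esub> (x \<otimes>\<^bsub>A\<^esub> y)"
    and smult_mult_right:
      "\<lbrakk>c \<in> carrier K; x \<in> carrier A; y \<in> carrier A\<rbrakk> \<Longrightarrow>
        x \<otimes>\<^bsub>A\<^esub> (c \<odot>\<^bsub>A\<^esub> y) = c \<odot>\<^bsub>A\<^esub> (x \<otimes>\<^bsub>A\<^esub> y)"

locale lmodule = R?: ring R + M?: abelian_group M
  for R :: "('a, 'x) ring_scheme" and M :: "('a, 'm, 'y) module_scheme" +
  assumes smult_closed:
      "\<lbrakk>a \<in> carrier R; x \<in> carrier M\<rbrakk> \<Longrightarrow> a \<odot>\<^bsub>M\<^esub> x \<in> carrier M"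
    and smult_l_distr:
      "\<lbrakk>a \<in> carrier R; b \<in> carrier R; x \<in> carrier M\<rbrakk> \<Longrightarrow>
        (a \<oplus>\<^bsub>R\<^esub> b) \<odot>\<^bsub>M\<^esub> x = a \<odot>\<^bsub>M\<^esub> x \<oplus>\<^bsub>M\<^esub> b \<odot>\<^bsub>M\<^esub> x"
    and smult_r_distr:
      "\<lbrakk>a \<in> carrier R; x \<in> carrier M; y \<in> carrier M\<rbrakk> \<Longrightarrow>
        a \<odot>\<^bsub>M\<^esub> (x \<oplus>\<^bsub>M\<^esub> y) = a \<odot>\<^bsub>M\<^esub> x \<oplus>\<^bsub>M\<^esub> a \<odot>\<^bsub>M\<^esub> y"
    and smult_assoc:
      "\<lbrakk>a \<in> carrier R; b \<in> carrier R; x \<in> carrier M\<rbrakk> \<Longrightarrow>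
        (a \<otimes>\<^bsub>R\<^esub> b) \<odot>\<^bsub>M\<^esub> x = a \<odot>\<^bsub>M\<^esub> (b \<odot>\<^bsub>M\<^esub> x)"
    and smult_one:
      "x \<in> carrier M \<Longrightarrow> \<one>\<^bsub>R\<^esub> \<odot>\<^bsub>M\<^esub> x = x"

text \<open>
  \<^const>\<open>Module.submodule\<close> is the HOL-Algebra locale; the locale of the same name in
  VectorSpace demands a commutative base ring.
\<close>

definition simple_lmodule :: "('a, 'x) ring_scheme \<Rightarrow> ('a, 'm) module \<Rightarrow> bool" where
  "simple_lmodule R M \<longleftrightarrow>
     lmodule R M \<and> carrier M \<noteq> {\<zero>\<^bsub>M\<^esub>} \<and>
     (\<forall>N. Module.submodule N R M \<longrightarrow> N = {\<zero>\<^bsub>M\<^esub>} \<or> N = carrier M)"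

text \<open>
  Homomorphisms are required to be extensional, so that two of them are equal in HOL iff they
  agree on the carrier of the source.
\<close>

definition Hom ::
    "('a, 'x) ring_scheme \<Rightarrow> ('a, 'm) module \<Rightarrow> ('a, 'n) module \<Rightarrow> ('m \<Rightarrow> 'n) set" where
  "Hom R M N = module_hom R M N \<inter> extensional (carrier M)"

definition hom_add :: "('a, 'm) module \<Rightarrow> ('a, 'n) module \<Rightarrow> ('m \<Rightarrow> 'n) \<Rightarrow> ('m \<Rightarrow> 'n) \<Rightarrow> 'm \<Rightarrow> 'n" where
  "hom_add M N f g = (\<lambda>x\<in>carrier M. f x \<oplus>\<^bsub>N\<^esub> g x)"

definition hom_zero :: "('a, 'm) module \<Rightarrow> ('a, 'n) module \<Rightarrow> 'm \<Rightarrow> 'n" where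
  "hom_zero M N = (\<lambda>x\<in>carrier M. \<zero>\<^bsub>N\<^esub>)"

definition hom_group ::
    "('a, 'x) ring_scheme \<Rightarrow> ('a, 'm) module \<Rightarrow> ('a, 'n) module \<Rightarrow> ('m \<Rightarrow> 'n) monoid" where
  "hom_group R M N = \<lparr>carrier = Hom R M N, mult = hom_add M N, one = hom_zero M N\<rparr>"

text \<open>
  A module \<open>N\<close> over a \<open>k\<close>-algebra \<open>A\<close> is a vector space via \<open>c x = (c 1\<^sub>A) x\<close>; this gives the
  vector space structure on \<open>Hom A M N\<close>.
\<close>

definition hom_scale ::
    "('k, 'a) module \<Rightarrow> ('a, 'm) module \<Rightarrow> ('a, 'n) module \<Rightarrow> 'k \<Rightarrow> ('m \<Rightarrow> 'n) \<Rightarrow> 'm \<Rightarrow> 'n" where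
  "hom_scale A M N c f = (\<lambda>x\<in>carrier M. (c \<odot>\<^bsub>A\<^esub> \<one>\<^bsub>A\<^esub>) \<odot>\<^bsub>N\<^esub> f x)"


section \<open>The group \<open>Ext\<^sup>1\<close>\<close>

text \<open>
  \<open>Ext\<^sup>1(S, T)\<close> is the first cohomology of \<open>Hom(P\<^sub>\<bullet>, T)\<close> for the canonical free resolution
  \<open>P\<^sub>2 \<rightarrow> P\<^sub>1 \<rightarrow> P\<^sub>0 \<rightarrow> S \<rightarrow> 0\<close> of \<open>S\<close>: \<open>P\<^sub>0\<close> is free on the set of elements of \<open>S\<close>, and
  \<open>P\<^sub>i\<^sub>+\<^sub>1\<close> is free on the set of elements of the kernel of the preceding map.
\<close>

definition free_lmodule :: "('a, 'x) ring_scheme \<Rightarrow> 'z set \<Rightarrow> ('a, 'z \<Rightarrow> 'a) module" where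
  "free_lmodule R Z =
     (ring.func_space R Z)\<lparr>carrier := {f \<in> Z \<rightarrow>\<^sub>E carrier R. finite {z \<in> Z. f z \<noteq> \<zero>\<^bsub>R\<^esub>}}\<rparr>"

definition free_map ::
    "('a, 'x) ring_scheme \<Rightarrow> ('a, 'z) module \<Rightarrow> 'z set \<Rightarrow> ('z \<Rightarrow> 'a) \<Rightarrow> 'z" where
  "free_map R M Z =
     (\<lambda>f\<in>carrier (free_lmodule R Z). \<Oplus>\<^bsub>M\<^esub> z\<in>{z \<in> Z. f z \<noteq> \<zero>\<^bsub>R\<^esub>}. f z \<odot>\<^bsub>M\<^esub> z)"

definition Ext1 ::
    "('a, 'x) ring_scheme \<Rightarrow> ('a, 's) module \<Rightarrow> ('a, 't) module \<Rightarrow>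
      ((('s \<Rightarrow> 'a) \<Rightarrow> 'a) \<Rightarrow> 't) set monoid" where
  "Ext1 R S T =
     (let P0 = free_lmodule R (carrier S);
          d0 = free_map R S (carrier S);
          Z0 = a_kernel P0 S d0;
          P1 = free_lmodule R Z0;
          d1 = free_map R P0 Z0;
          Z1 = a_kernel P1 P0 d1;
          P2 = free_lmodule R Z1;
          d2 = free_map R P1 Z1;
          cocycles = {f \<in> Hom R P1 T. compose (carrier P2) f d2 = hom_zero P2 T};
          coboundaries = (\<lambda>g. compose (carrier P1) g d1) ` Hom R P0 T
      in (hom_group R P1 T)\<lparr>carrier := cocycles\<rparr> Mod coboundaries)"


section \<open>Quasicommutative algebras\<close>

definition quot_algebra :: "('k, 'a) module \<Rightarrow> 'a set \<Rightarrow> ('k, 'a set) module" where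
  "quot_algebra A I =
     \<lparr>carrier = carrier (A Quot I), mult = mult (A Quot I), one = one (A Quot I),
      zero = zero (A Quot I), add = add (A Quot I),
      smult = (\<lambda>c X. \<Union>x\<in>X. I +>\<^bsub>A\<^esub> (c \<odot>\<^bsub>A\<^esub> x))\<rparr>"

definition cfs :: "('k, 'x) ring_scheme \<Rightarrow> ('k, 'a) module \<Rightarrow> 'a set set" where
  "cfs K A = {I. maximalideal I A \<and> vectorspace.fin_dim K (quot_algebra A I)}"

definition restrict_scalars :: "('a \<Rightarrow> 'b) \<Rightarrow> ('b, 'm) module \<Rightarrow> ('a, 'm) module" where
  "restrict_scalars \<phi> M =
     \<lparr>carrier = carrier M, mult = mult M, one = one M, zero = zero M, add = add M,
      smult = (\<lambda>a x. \<phi> a \<odot>\<^bsub>M\<^esub> x)\<rparr>"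

text \<open>
  For \<open>I \<in> cfs K A\<close> the choice below is from a nonempty set: \<open>A / I\<close> is nonzero and finite
  dimensional, hence has a minimal left ideal, and this is a simple module whose elements are
  elements of \<open>A / I\<close>, that is, of type \<^typ>\<open>'a set\<close>.
\<close>

definition simple_at :: "('k, 'a) module \<Rightarrow> 'a set \<Rightarrow> ('a, 'a set) module" where
  "simple_at A I =
     restrict_scalars (\<lambda>a. I +>\<^bsub>A\<^esub> a)
       (SOME M :: ('a set, 'a set) module. simple_lmodule (A Quot I) M)"

definition quasicommutative :: "('k, 'x) ring_scheme \<Rightarrow> ('k, 'a) module \<Rightarrow> bool" where
  "quasicommutative K A \<longleftrightarrow>
     (\<forall>I\<in>cfs K A. \<forall>J\<in>cfs K A. I \<noteq> J \<longrightarrow>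
        carrier (Ext1 A (simple_at A I) (simple_at A J))
          = {\<one>\<^bsub>Ext1 A (simple_at A I) (simple_at A J)\<^esub>})"


section \<open>Morita equivalence\<close>

text \<open>
  HOL cannot quantify over all types, so the category of left \<open>A\<close>-modules is taken relative to a
  type \<open>'u\<close> playing the role of a universe: its objects are the \<open>A\<close>-modules whose carrier is a
  set of elements of \<open>'u\<close>, its morphisms are given by \<^const>\<open>Hom\<close>.  A functor is given by an
  object map \<open>Fo\<close> and, for each pair of objects, a map \<open>Fm\<close> on morphisms.
\<close>

locale linear_functor =
  fixes K :: "('k, 'x) ring_scheme"
    and A :: "('k, 'a) module" and B :: "('k, 'b) module"
    and Fo :: "('a, 'u) module \<Rightarrow> ('b, 'u) module"
    and Fm :: "('a, 'u) module \<Rightarrow> ('a, 'u) module \<Rightarrow> ('u \<Rightarrow> 'u) \<Rightarrow> 'u \<Rightarrow> 'u"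
  assumes obj: "lmodule A M \<Longrightarrow> lmodule B (Fo M)"
    and mor: "\<lbrakk>lmodule A M; lmodule A N; f \<in> Hom A M N\<rbrakk> \<Longrightarrow> Fm M N f \<in> Hom B (Fo M) (Fo N)"
    and ident: "lmodule A M \<Longrightarrow> Fm M M (\<lambda>x\<in>carrier M. x) = (\<lambda>x\<in>carrier (Fo M). x)"
    and comp: "\<lbrakk>lmodule A L; lmodule A M; lmodule A N; f \<in> Hom A L M; g \<in> Hom A M N\<rbrakk> \<Longrightarrow>
        Fm L N (compose (carrier L) g f) = compose (carrier (Fo L)) (Fm M N g) (Fm L M f)"
    and add: "\<lbrakk>lmodule A M; lmodule A N; f \<in> Hom A M N; g \<in> Hom A M N\<rbrakk> \<Longrightarrow>
        Fm M N (hom_add M N f g) = hom_add (Fo M) (Fo N) (Fm M N f) (Fm M N g)"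
    and scale: "\<lbrakk>lmodule A M; lmodule A N; f \<in> Hom A M N; c \<in> carrier K\<rbrakk> \<Longrightarrow>
        Fm M N (hom_scale A M N c f) = hom_scale B (Fo M) (Fo N) c (Fm M N f)"

definition natural_iso ::
    "('k, 'a) module \<Rightarrow> ('k, 'b) module \<Rightarrow>
      (('a, 'u) module \<Rightarrow> ('b, 'u) module) \<Rightarrow>
      (('a, 'u) module \<Rightarrow> ('a, 'u) module \<Rightarrow> ('u \<Rightarrow> 'u) \<Rightarrow> 'u \<Rightarrow> 'u) \<Rightarrow>
      (('a, 'u) module \<Rightarrow> ('b, 'u) module) \<Rightarrow>
      (('a, 'u) module \<Rightarrow> ('a, 'u) module \<Rightarrow> ('u \<Rightarrow> 'u) \<Rightarrow> 'u \<Rightarrow> 'u) \<Rightarrow>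
      (('a, 'u) module \<Rightarrow> 'u \<Rightarrow> 'u) \<Rightarrow> bool" where
  "natural_iso A B Fo Fm Go Gm \<eta> \<longleftrightarrow>
     (\<forall>M. lmodule A M \<longrightarrow>
        \<eta> M \<in> Hom B (Fo M) (Go M) \<and> bij_betw (\<eta> M) (carrier (Fo M)) (carrier (Go M))) \<and>
     (\<forall>M N f. lmodule A M \<and> lmodule A N \<and> f \<in> Hom A M N \<longrightarrow>
        compose (carrier (Fo M)) (\<eta> N) (Fm M N f)
          = compose (carrier (Fo M)) (Gm M N f) (\<eta> M))"

definition morita_equivalent ::
    "'u itself \<Rightarrow> ('k, 'x) ring_scheme \<Rightarrow> ('k, 'a) module \<Rightarrow> ('k, 'b) module \<Rightarrow> bool" where
  "morita_equivalent U K A B \<longleftrightarrow>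
     (\<exists>(Fo :: ('a, 'u) module \<Rightarrow> ('b, 'u) module) Fm
        (Go :: ('b, 'u) module \<Rightarrow> ('a, 'u) module) Gm \<eta> \<epsilon>.
        linear_functor K A B Fo Fm \<and> linear_functor K B A Go Gm \<and>
        natural_iso A A (\<lambda>M. M) (\<lambda>M N f. f)
          (\<lambda>M. Go (Fo M)) (\<lambda>M N f. Gm (Fo M) (Fo N) (Fm M N f)) \<eta> \<and>
        natural_iso B B (\<lambda>M. Fo (Go M)) (\<lambda>M N f. Fm (Go M) (Go N) (Gm M N f))
          (\<lambda>M. M) (\<lambda>M N f. f) \<epsilon>)"

text \<open>
  The universe \<open>'u\<close> is large enough for a ring \<open>R\<close> if it is infinite and \<open>R\<close> injects into it; up
  to isomorphism, the modules with carrier in \<open>'u\<close> then include all finitely generated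
  \<open>R\<close>-modules.  For a smaller \<open>'u\<close> an equivalence would carry no information (if \<open>'u\<close> has one
  element, there are only zero modules).  Conversely, any equivalence between the full module
  categories restricts, up to isomorphism, to one between the modules with carrier in a large
  enough \<open>'u\<close>, since it preserves generation by at most \<open>\<kappa>\<close> elements, \<open>\<kappa>\<close> an infinite cardinal.
\<close>

definition large_universe :: "'u itself \<Rightarrow> ('a, 'x) ring_scheme \<Rightarrow> bool" where
  "large_universe U R \<longleftrightarrow> infinite (UNIV :: 'u set) \<and> carrier R \<lesssim> (UNIV :: 'u set)"

end

theory Submission
  imports Defs
begin

text \<open>
  Let \<open>S\<close> and \<open>T\<close> be the simple \<open>\<Gamma>\<close>-modules at distinct \<open>I\<close> and \<open>J\<close>, and let \<open>G\<close> be the equivalence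
  from \<open>\<Gamma>\<close>-modules to \<open>\<Lambda>\<close>-modules.  Then \<open>G S\<close> and \<open>G T\<close> are simple, finite dimensional and not
  isomorphic.  A finite dimensional simple module has a maximal annihilator and is determined by it,
  so \<open>G S\<close> and \<open>G T\<close> are the simple modules at two distinct elements of \<open>cfs \<Lambda>\<close>.
  The group \<open>Ext\<^sup>1(S, T)\<close> vanishes iff every homomorphism \<open>ker p \<rightarrow> T\<close> extends to \<open>P\<close>, where
  \<open>p : P \<rightarrow> S\<close> is onto with \<open>P\<close> free, and in this case the same holds for every module \<open>Q\<close> mapping
  onto \<open>S\<close>.  Hence it suffices to extend homomorphisms from the kernel of \<open>\<Gamma> \<rightarrow> S\<close> to \<open>\<Gamma>\<close>, which
  stays within the universe; since \<open>G\<close> is exact and fully faithful, this is possible if homomorphisms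
  to \<open>G T\<close> extend from the kernel of \<open>G \<Gamma> \<rightarrow> G S\<close> to \<open>G \<Gamma>\<close>, and they do as
  \<open>Ext\<^sup>1(G S, G T) = 0\<close>.
\<close>

section \<open>Left modules and their homomorphisms\<close>

text \<open>Three obstacles shape the proof. The modules at hand have different element types, while
  the functors act only on modules with elements in \<open>'u\<close>; hence homomorphisms run
  between modules of arbitrary types, isomorphisms with copies are carried along explicitly, and
  quotients use chosen representatives so as not to leave a type.

  Finite dimension is not visibly categorical. If \<open>X\<close> represents the functor
  \<open>G\<close>, then \<open>G S\<close> is \<open>Hom(X, S)\<close>, and finitely many elements
  of \<open>X\<close> suffice to separate these homomorphisms; here compatibility of
  \<open>G\<close> with scalars from \<open>K\<close> enters. Jointly injective finite families of
  maps replace embeddings into powers of \<open>S\<close>, and the Noetherian property replaces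
  finite dimension, with which it agrees over a field.

  Simple modules are compared without the structure theory of matrix algebras, by a density argument
  that uses a finite subset detecting the annihilator. Finally, no right exactness of
  \<open>G\<close> is proved: a nonzero map to a simple module is onto, and a faithful additive
  functor keeps maps nonzero.\<close>

context abelian_group
begin

lemma diff_zero_right: "x \<in> carrier G \<Longrightarrow> x \<ominus> \<zero> = x"
  by (metis a_minus_def l_zero minus_equality r_zero zero_closed)

lemma diff_eq_zero_iff:
  "x \<in> carrier G \<Longrightarrow> y \<in> carrier G \<Longrightarrow> x \<ominus> y = \<zero> \<longleftrightarrow> x = y"
  by (metis a_inv_closed a_minus_def minus_equality minus_minus r_neg)

lemma add_diff_add_cancel:
  assumes "y \<in> carrier G" "u \<in> carrier G" "v \<in> carrier G"
  shows "u \<oplus> (y \<ominus> (u \<oplus> v)) = y \<ominus> v"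
proof -
  have "u \<oplus> (y \<ominus> (u \<oplus> v)) = (u \<oplus> \<ominus> u) \<oplus> (y \<oplus> \<ominus> v)"
    using assms by (simp only: a_minus_def minus_add a_ac a_closed a_inv_closed)
  then show ?thesis using assms by (simp add: a_minus_def r_neg)
qed

lemma diff_diff_cancel:
  assumes "x \<in> carrier G" "y \<in> carrier G" "z \<in> carrier G"
  shows "(x \<ominus> z) \<ominus> (y \<ominus> z) = x \<ominus> y"
proof -
  have "(x \<ominus> z) \<ominus> (y \<ominus> z) = (x \<oplus> \<ominus> y) \<oplus> (z \<oplus> \<ominus> z)"
    using assms by (simp only: a_minus_def minus_add minus_minus a_ac a_closed a_inv_closed)
  then show ?thesis using assms by (simp add: a_minus_def r_neg)
qed

end

context lmodule
begin

lemma smult_zero_left [simp]: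
  assumes "x \<in> carrier M"
  shows "\<zero>\<^bsub>R\<^esub> \<odot>\<^bsub>M\<^esub> x = \<zero>\<^bsub>M\<^esub>"
proof -
  have "\<zero>\<^bsub>R\<^esub> \<odot>\<^bsub>M\<^esub> x \<oplus>\<^bsub>M\<^esub> \<zero>\<^bsub>R\<^esub> \<odot>\<^bsub>M\<^esub> x = \<zero>\<^bsub>R\<^esub> \<odot>\<^bsub>M\<^esub> x"
    using smult_l_distr[of "\<zero>\<^bsub>R\<^esub>" "\<zero>\<^bsub>R\<^esub>" x] assms by simp
  then show ?thesis
    using assms smult_closed by (metis M.add.r_cancel_one R.zero_closed)
qed

lemma smult_zero_right [simp]:
  assumes "a \<in> carrier R"
  shows "a \<odot>\<^bsub>M\<^esub> \<zero>\<^bsub>M\<^esub> = \<zero>\<^bsub>M\<^esub>"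
proof -
  have "a \<odot>\<^bsub>M\<^esub> \<zero>\<^bsub>M\<^esub> \<oplus>\<^bsub>M\<^esub> a \<odot>\<^bsub>M\<^esub> \<zero>\<^bsub>M\<^esub> = a \<odot>\<^bsub>M\<^esub> \<zero>\<^bsub>M\<^esub>"
    using smult_r_distr[of a "\<zero>\<^bsub>M\<^esub>" "\<zero>\<^bsub>M\<^esub>"] assms by simp
  then show ?thesis
    using assms smult_closed by (metis M.add.r_cancel_one M.zero_closed)
qed

lemma smult_minus_left:
  assumes "a \<in> carrier R" "x \<in> carrier M"
  shows "(\<ominus>\<^bsub>R\<^esub> a) \<odot>\<^bsub>M\<^esub> x = \<ominus>\<^bsub>M\<^esub> (a \<odot>\<^bsub>M\<^esub> x)"
proof -
  have "(\<ominus>\<^bsub>R\<^esub> a) \<odot>\<^bsub>M\<^esub> x \<oplus>\<^bsub>M\<^esub> a \<odot>\<^bsub>M\<^esub> x = \<zero>\<^bsub>M\<^esub>"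
    using smult_l_distr[of "\<ominus>\<^bsub>R\<^esub> a" a x] assms by (simp add: R.l_neg)
  then show ?thesis
    using assms smult_closed by (metis M.minus_equality R.a_inv_closed)
qed

lemma smult_minus_right:
  assumes "a \<in> carrier R" "x \<in> carrier M"
  shows "a \<odot>\<^bsub>M\<^esub> (\<ominus>\<^bsub>M\<^esub> x) = \<ominus>\<^bsub>M\<^esub> (a \<odot>\<^bsub>M\<^esub> x)"
proof -
  have "a \<odot>\<^bsub>M\<^esub> (\<ominus>\<^bsub>M\<^esub> x) \<oplus>\<^bsub>M\<^esub> a \<odot>\<^bsub>M\<^esub> x = \<zero>\<^bsub>M\<^esub>"
    using smult_r_distr[of a "\<ominus>\<^bsub>M\<^esub> x" x] assms by (simp add: M.l_neg)
  then show ?thesis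
    using assms smult_closed by (metis M.minus_equality M.a_inv_closed)
qed

lemma smult_diff_left:
  assumes "a \<in> carrier R" "b \<in> carrier R" "x \<in> carrier M"
  shows "(a \<ominus>\<^bsub>R\<^esub> b) \<odot>\<^bsub>M\<^esub> x = a \<odot>\<^bsub>M\<^esub> x \<ominus>\<^bsub>M\<^esub> b \<odot>\<^bsub>M\<^esub> x"
  using assms by (simp add: a_minus_def smult_l_distr smult_minus_left)

lemma smult_diff_right:
  assumes "a \<in> carrier R" "x \<in> carrier M" "y \<in> carrier M"
  shows "a \<odot>\<^bsub>M\<^esub> (x \<ominus>\<^bsub>M\<^esub> y) = a \<odot>\<^bsub>M\<^esub> x \<ominus>\<^bsub>M\<^esub> a \<odot>\<^bsub>M\<^esub> y"
  using assms by (simp add: a_minus_def smult_r_distr smult_minus_right)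

lemma submoduleI:
  assumes "N \<subseteq> carrier M" "\<zero>\<^bsub>M\<^esub> \<in> N"
    and "\<And>x y. x \<in> N \<Longrightarrow> y \<in> N \<Longrightarrow> x \<oplus>\<^bsub>M\<^esub> y \<in> N"
    and "\<And>a x. a \<in> carrier R \<Longrightarrow> x \<in> N \<Longrightarrow> a \<odot>\<^bsub>M\<^esub> x \<in> N"
  shows "Module.submodule N R M"
proof (intro Module.submodule.intro subgroup.intro Module.submodule_axioms.intro)
  fix x assume x: "x \<in> N"
  have "\<ominus>\<^bsub>M\<^esub> x = (\<ominus>\<^bsub>R\<^esub> \<one>\<^bsub>R\<^esub>) \<odot>\<^bsub>M\<^esub> x"
    using x assms(1) by (auto simp: smult_minus_left smult_one)
  then have "\<ominus>\<^bsub>M\<^esub> x \<in> N" using assms(4) x by simp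
  then show "inv\<^bsub>add_monoid M\<^esub> x \<in> N" by (simp add: a_inv_def)
qed (use assms in auto)

lemma finsum_smult:
  assumes "finite F" "a \<in> carrier R" "f \<in> F \<rightarrow> carrier M"
  shows "a \<odot>\<^bsub>M\<^esub> (\<Oplus>\<^bsub>M\<^esub>z\<in>F. f z) = (\<Oplus>\<^bsub>M\<^esub>z\<in>F. a \<odot>\<^bsub>M\<^esub> f z)"
  using assms(1,3)
proof (induction F rule: finite_induct)
  case (insert x F)
  then have "f \<in> F \<rightarrow> carrier M" "f x \<in> carrier M" by auto
  moreover have "(\<lambda>z. a \<odot>\<^bsub>M\<^esub> f z) \<in> F \<rightarrow> carrier M"
    using insert.prems assms(2) by (auto intro: smult_closed)
  ultimately show ?case
    using insert assms(2) by (simp add: smult_r_distr smult_closed)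
qed (simp add: assms(2))

end

section \<open>Submodules, kernels, images and inverses of homomorphisms\<close>

lemma submoduleD:
  assumes "Module.submodule N R M"
  shows "N \<subseteq> carrier M" "\<zero>\<^bsub>M\<^esub> \<in> N"
    and "\<And>x y. x \<in> N \<Longrightarrow> y \<in> N \<Longrightarrow> x \<oplus>\<^bsub>M\<^esub> y \<in> N"
    and "\<And>x. x \<in> N \<Longrightarrow> \<ominus>\<^bsub>M\<^esub> x \<in> N"
    and "\<And>x y. x \<in> N \<Longrightarrow> y \<in> N \<Longrightarrow> x \<ominus>\<^bsub>M\<^esub> y \<in> N"
    and "\<And>a x. a \<in> carrier R \<Longrightarrow> x \<in> N \<Longrightarrow> a \<odot>\<^bsub>M\<^esub> x \<in> N"
proof -
  interpret Module.submodule N R M by fact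
  show "N \<subseteq> carrier M" "\<zero>\<^bsub>M\<^esub> \<in> N" using subset one_closed by auto
  show a: "\<And>x y. x \<in> N \<Longrightarrow> y \<in> N \<Longrightarrow> x \<oplus>\<^bsub>M\<^esub> y \<in> N" using m_closed by simp
  show m: "\<And>x. x \<in> N \<Longrightarrow> \<ominus>\<^bsub>M\<^esub> x \<in> N" using m_inv_closed by (simp add: a_inv_def)
  show "\<And>x y. x \<in> N \<Longrightarrow> y \<in> N \<Longrightarrow> x \<ominus>\<^bsub>M\<^esub> y \<in> N" using a m by (simp add: a_minus_def)
  show "\<And>a x. a \<in> carrier R \<Longrightarrow> x \<in> N \<Longrightarrow> a \<odot>\<^bsub>M\<^esub> x \<in> N" using smult_closed by simp
qed

lemma lmoduleI:
  assumes "ring R" "abelian_group M"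
    and "\<And>a x. a \<in> carrier R \<Longrightarrow> x \<in> carrier M \<Longrightarrow> a \<odot>\<^bsub>M\<^esub> x \<in> carrier M"
    and "\<And>a b x. a \<in> carrier R \<Longrightarrow> b \<in> carrier R \<Longrightarrow> x \<in> carrier M \<Longrightarrow>
        (a \<oplus>\<^bsub>R\<^esub> b) \<odot>\<^bsub>M\<^esub> x = a \<odot>\<^bsub>M\<^esub> x \<oplus>\<^bsub>M\<^esub> b \<odot>\<^bsub>M\<^esub> x"
    and "\<And>a x y. a \<in> carrier R \<Longrightarrow> x \<in> carrier M \<Longrightarrow> y \<in> carrier M \<Longrightarrow>
        a \<odot>\<^bsub>M\<^esub> (x \<oplus>\<^bsub>M\<^esub> y) = a \<odot>\<^bsub>M\<^esub> x \<oplus>\<^bsub>M\<^esub> a \<odot>\<^bsub>M\<^esub> y"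
    and "\<And>a b x. a \<in> carrier R \<Longrightarrow> b \<in> carrier R \<Longrightarrow> x \<in> carrier M \<Longrightarrow>
        (a \<otimes>\<^bsub>R\<^esub> b) \<odot>\<^bsub>M\<^esub> x = a \<odot>\<^bsub>M\<^esub> (b \<odot>\<^bsub>M\<^esub> x)"
    and "\<And>x. x \<in> carrier M \<Longrightarrow> \<one>\<^bsub>R\<^esub> \<odot>\<^bsub>M\<^esub> x = x"
  shows "lmodule R M"
  using assms by (simp add: lmodule_def lmodule_axioms_def)

lemma submodule_lmodule:
  fixes M :: "('a, 'm) module"
  assumes "lmodule R M" "Module.submodule N R M"
  shows "lmodule R (M\<lparr>carrier := N\<rparr>)"
proof -
  interpret lmodule R M by fact
  note N = submoduleD[OF assms(2)]
  have "abelian_group (M\<lparr>carrier := N\<rparr>)"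
  proof (rule abelian_groupI)
    fix x assume "x \<in> carrier (M\<lparr>carrier := N\<rparr>)"
    then show "\<exists>y\<in>carrier (M\<lparr>carrier := N\<rparr>). y \<oplus>\<^bsub>M\<lparr>carrier := N\<rparr>\<^esub> x = \<zero>\<^bsub>M\<lparr>carrier := N\<rparr>\<^esub>"
      using N(1,4) by (auto intro!: bexI[of _ "\<ominus>\<^bsub>M\<^esub> x"] simp: M.l_neg)
  qed (use N(1-3) in \<open>auto simp: M.a_ac subset_iff\<close>)
  then show ?thesis
    using N(1,6) R.ring_axioms
    by (intro lmoduleI) (auto simp: subset_iff smult_l_distr smult_r_distr smult_assoc smult_one)
qed

lemma module_homI:
  assumes "\<And>x. x \<in> carrier M \<Longrightarrow> f x \<in> carrier N"
    and "\<And>x y. x \<in> carrier M \<Longrightarrow> y \<in> carrier M \<Longrightarrow> f (x \<oplus>\<^bsub>M\<^esub> y) = f x \<oplus>\<^bsub>N\<^esub> f y"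
    and "\<And>a x. a \<in> carrier R \<Longrightarrow> x \<in> carrier M \<Longrightarrow> f (a \<odot>\<^bsub>M\<^esub> x) = a \<odot>\<^bsub>N\<^esub> f x"
  shows "f \<in> module_hom R M N"
  using assms by (auto simp: module_hom_def)

lemma module_homD:
  assumes "f \<in> module_hom R M N"
  shows "\<And>x. x \<in> carrier M \<Longrightarrow> f x \<in> carrier N"
    and "\<And>x y. x \<in> carrier M \<Longrightarrow> y \<in> carrier M \<Longrightarrow> f (x \<oplus>\<^bsub>M\<^esub> y) = f x \<oplus>\<^bsub>N\<^esub> f y"
    and "\<And>a x. a \<in> carrier R \<Longrightarrow> x \<in> carrier M \<Longrightarrow> f (a \<odot>\<^bsub>M\<^esub> x) = a \<odot>\<^bsub>N\<^esub> f x"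
  using assms by (auto simp: module_hom_def)

lemma
  assumes "lmodule R M" "lmodule R N" "f \<in> module_hom R M N"
  shows lmodule_hom_zero: "f \<zero>\<^bsub>M\<^esub> = \<zero>\<^bsub>N\<^esub>"
    and lmodule_hom_minus: "x \<in> carrier M \<Longrightarrow> f (\<ominus>\<^bsub>M\<^esub> x) = \<ominus>\<^bsub>N\<^esub> f x"
    and lmodule_hom_diff:
      "x \<in> carrier M \<Longrightarrow> y \<in> carrier M \<Longrightarrow> f (x \<ominus>\<^bsub>M\<^esub> y) = f x \<ominus>\<^bsub>N\<^esub> f y"
    and lmodule_hom_finsum: "finite F \<Longrightarrow> g \<in> F \<rightarrow> carrier M \<Longrightarrow>
        f (\<Oplus>\<^bsub>M\<^esub>z\<in>F. g z) = (\<Oplus>\<^bsub>N\<^esub>z\<in>F. f (g z))"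
proof -
  interpret M: lmodule R M by fact
  interpret N: lmodule R N by fact
  note f = module_homD[OF assms(3)]
  have z: "f \<zero>\<^bsub>M\<^esub> = \<zero>\<^bsub>N\<^esub>"
    using f(1,2)[of "\<zero>\<^bsub>M\<^esub>"] by (metis M.M.r_zero M.M.zero_closed N.M.add.r_cancel_one)
  have m: "f (\<ominus>\<^bsub>M\<^esub> x) = \<ominus>\<^bsub>N\<^esub> f x" if "x \<in> carrier M" for x
    using f(2)[of "\<ominus>\<^bsub>M\<^esub> x" x] that z f(1)
    by (metis M.M.a_inv_closed M.M.l_neg N.M.minus_equality)
  show "f \<zero>\<^bsub>M\<^esub> = \<zero>\<^bsub>N\<^esub>" "x \<in> carrier M \<Longrightarrow> f (\<ominus>\<^bsub>M\<^esub> x) = \<ominus>\<^bsub>N\<^esub> f x" using z m by auto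
  show "x \<in> carrier M \<Longrightarrow> y \<in> carrier M \<Longrightarrow> f (x \<ominus>\<^bsub>M\<^esub> y) = f x \<ominus>\<^bsub>N\<^esub> f y"
    using m f(2) by (simp add: a_minus_def)
  show "finite F \<Longrightarrow> g \<in> F \<rightarrow> carrier M \<Longrightarrow>
        f (\<Oplus>\<^bsub>M\<^esub>z\<in>F. g z) = (\<Oplus>\<^bsub>N\<^esub>z\<in>F. f (g z))"
  proof (induction F rule: finite_induct)
    case (insert x F)
    then have "g \<in> F \<rightarrow> carrier M" "g x \<in> carrier M" "(\<lambda>z. f (g z)) \<in> F \<rightarrow> carrier N"
      using f(1) by auto
    then show ?case
      using insert by (simp add: f)
  qed (simp add: z)
qed

lemma module_hom_inv_into:
  fixes M :: "('a, 'm) module" and N :: "('a, 'n) module"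
  assumes "lmodule R M" "lmodule R N" "f \<in> module_hom R M N"
    and "bij_betw f (carrier M) (carrier N)"
  shows "inv_into (carrier M) f \<in> module_hom R N M"
proof -
  interpret M: lmodule R M by fact
  note f = module_homD[OF assms(3)]
  let ?g = "inv_into (carrier M) f"
  have g: "?g y \<in> carrier M" "f (?g y) = y" if "y \<in> carrier N" for y
    using that assms(4) by (metis bij_betw_def inv_into_into) (use that assms(4) in \<open>metis bij_betw_inv_into_right\<close>)
  have gf: "?g (f x) = x" if "x \<in> carrier M" for x
    using that assms(4) by (metis bij_betw_inv_into_left)
  show ?thesis
  proof (rule module_homI)
    fix x y assume "x \<in> carrier N" "y \<in> carrier N"
    then show "?g (x \<oplus>\<^bsub>N\<^esub> y) = ?g x \<oplus>\<^bsub>M\<^esub> ?g y"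
      using g gf[of "?g x \<oplus>\<^bsub>M\<^esub> ?g y"] f(2) by simp
  next
    fix a x assume "a \<in> carrier R" "x \<in> carrier N"
    then show "?g (a \<odot>\<^bsub>N\<^esub> x) = a \<odot>\<^bsub>M\<^esub> ?g x"
      using g gf[of "a \<odot>\<^bsub>M\<^esub> ?g x"] f(3) M.smult_closed by simp
  qed (use g in auto)
qed

lemma module_hom_kernel_submodule:
  assumes "lmodule R M" "lmodule R N" "f \<in> module_hom R M N"
  shows "Module.submodule {x \<in> carrier M. f x = \<zero>\<^bsub>N\<^esub>} R M"
proof -
  interpret M: lmodule R M by fact
  interpret N: lmodule R N by fact
  note f = module_homD[OF assms(3)]
  show ?thesis
    by (rule M.submoduleI) (auto simp: f lmodule_hom_zero[OF assms] M.smult_closed)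
qed

lemma module_hom_image_submodule:
  assumes "lmodule R M" "lmodule R N" "f \<in> module_hom R M N" "Module.submodule L R M"
  shows "Module.submodule (f ` L) R N"
proof -
  interpret N: lmodule R N by fact
  note f = module_homD[OF assms(3)] and L = submoduleD[OF assms(4)]
  show ?thesis
  proof (rule N.submoduleI)
    show "\<zero>\<^bsub>N\<^esub> \<in> f ` L" using L(2) lmodule_hom_zero[OF assms(1-3)] by (metis imageI)
  next
    fix x y assume "x \<in> f ` L" "y \<in> f ` L"
    then obtain x' y' where "x' \<in> L" "y' \<in> L" "x = f x'" "y = f y'" by auto
    then have "x \<oplus>\<^bsub>N\<^esub> y = f (x' \<oplus>\<^bsub>M\<^esub> y')" "x' \<oplus>\<^bsub>M\<^esub> y' \<in> L" using L f by (auto simp: subset_iff)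
    then show "x \<oplus>\<^bsub>N\<^esub> y \<in> f ` L" by auto
  next
    fix a x assume "a \<in> carrier R" "x \<in> f ` L"
    then obtain x' where "x' \<in> L" "x = f x'" by auto
    then have "a \<odot>\<^bsub>N\<^esub> x = f (a \<odot>\<^bsub>M\<^esub> x')" "a \<odot>\<^bsub>M\<^esub> x' \<in> L" using L f \<open>a \<in> carrier R\<close> by (auto simp: subset_iff)
    then show "a \<odot>\<^bsub>N\<^esub> x \<in> f ` L" by auto
  qed (use L(1) f(1) in auto)
qed

lemma submodule_self:
  assumes "lmodule R M"
  shows "Module.submodule (carrier M) R M"
proof -
  interpret lmodule R M by fact
  show ?thesis by (rule submoduleI) (auto intro: smult_closed)
qed

lemma submodule_zero:
  assumes "lmodule R M"
  shows "Module.submodule {\<zero>\<^bsub>M\<^esub>} R M"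
proof -
  interpret lmodule R M by fact
  show ?thesis by (rule submoduleI) auto
qed

text \<open>Module axioms are equations, apart from the existence of negatives, which are images of
  negatives; all of them survive under a surjection compatible with the operations. So
  \<open>M'\<close> need not be known to be a group beforehand, and chosen representatives are
  covered as well as the quotient algebra.\<close>

lemma lmodule_hom_image:
  fixes M :: "('a, 'm) module" and M' :: "('a, 'n) module"
  assumes "lmodule R M" and carr: "carrier M' = r ` carrier M" and zero: "\<zero>\<^bsub>M'\<^esub> = r \<zero>\<^bsub>M\<^esub>"
    and add: "\<And>x y. x \<in> carrier M \<Longrightarrow> y \<in> carrier M \<Longrightarrow> r x \<oplus>\<^bsub>M'\<^esub> r y = r (x \<oplus>\<^bsub>M\<^esub> y)"
    and smult: "\<And>a x. a \<in> carrier R \<Longrightarrow> x \<in> carrier M \<Longrightarrow> a \<odot>\<^bsub>M'\<^esub> r x = r (a \<odot>\<^bsub>M\<^esub> x)"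
  shows "lmodule R M'" "r \<in> module_hom R M M'"
proof -
  interpret lmodule R M by fact
  have "abelian_group M'"
  proof (rule abelian_groupI)
    fix u assume "u \<in> carrier M'"
    then obtain x where x: "x \<in> carrier M" "u = r x" by (auto simp: carr)
    then have "r (\<ominus>\<^bsub>M\<^esub> x) \<in> carrier M'" "r (\<ominus>\<^bsub>M\<^esub> x) \<oplus>\<^bsub>M'\<^esub> u = \<zero>\<^bsub>M'\<^esub>"
      by (auto simp: carr zero add M.l_neg)
    then show "\<exists>v\<in>carrier M'. v \<oplus>\<^bsub>M'\<^esub> u = \<zero>\<^bsub>M'\<^esub>" by blast
  qed (auto simp: carr zero add M.a_ac)
  then show "lmodule R M'"
    using R.ring_axioms
    by (intro lmoduleI)
      (auto simp: carr add smult smult_closed smult_l_distr smult_r_distr smult_assoc smult_one)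
  show "r \<in> module_hom R M M'"
    by (rule module_homI) (auto simp: carr add smult)
qed

text \<open>
  This covers both copies along an injection \<open>r\<close> (with \<open>N = 0\<close>) and quotients (with \<open>r\<close> a choice
  of coset representatives, so that the quotient has the same element type as \<open>M\<close>).
\<close>

lemma lmodule_image:
  fixes M :: "('a, 'm) module" and r :: "'m \<Rightarrow> 'n"
  assumes "lmodule R M" "Module.submodule N R M"
    and r: "\<And>x y. x \<in> carrier M \<Longrightarrow> y \<in> carrier M \<Longrightarrow> r x = r y \<longleftrightarrow> x \<ominus>\<^bsub>M\<^esub> y \<in> N"
  obtains M' :: "('a, 'n) module"
  where "lmodule R M'" "carrier M' = r ` carrier M" "r \<in> module_hom R M M'"
proof -
  interpret lmodule R M by fact
  note N = submoduleD[OF assms(2)]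
  \<comment> \<open>The operations on \<open>M'\<close> are computed on preimages chosen by
    \<open>s\<close>. Another preimage differs by an element of \<open>N\<close>, so
    \<open>r\<close> of the result stays the same.\<close>
  define s where "s = inv_into (carrier M) r"
  define M' :: "('a, 'n) module" where
    "M' = \<lparr>carrier = r ` carrier M, mult = undefined, one = undefined, zero = r \<zero>\<^bsub>M\<^esub>,
           add = (\<lambda>u v. r (s u \<oplus>\<^bsub>M\<^esub> s v)), smult = (\<lambda>a u. r (a \<odot>\<^bsub>M\<^esub> s u))\<rparr>"
  have s: "s (r x) \<in> carrier M" "s (r x) \<ominus>\<^bsub>M\<^esub> x \<in> N" if "x \<in> carrier M" for x
  proof -
    show 1: "s (r x) \<in> carrier M" unfolding s_def using that by (simp add: inv_into_into)
    have "r (s (r x)) = r x" unfolding s_def using that by (simp add: f_inv_into_f)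
    then show "s (r x) \<ominus>\<^bsub>M\<^esub> x \<in> N" using r 1 that by blast
  qed
  have add: "r x \<oplus>\<^bsub>M'\<^esub> r y = r (x \<oplus>\<^bsub>M\<^esub> y)" if "x \<in> carrier M" "y \<in> carrier M" for x y
  proof -
    have "(s (r x) \<oplus>\<^bsub>M\<^esub> s (r y)) \<ominus>\<^bsub>M\<^esub> (x \<oplus>\<^bsub>M\<^esub> y)
        = (s (r x) \<ominus>\<^bsub>M\<^esub> x) \<oplus>\<^bsub>M\<^esub> (s (r y) \<ominus>\<^bsub>M\<^esub> y)"
      using s that by (simp add: a_minus_def M.minus_add M.a_ac)
    then show ?thesis
      unfolding M'_def using s that r N(3) by simp
  qed
  have smult: "a \<odot>\<^bsub>M'\<^esub> r x = r (a \<odot>\<^bsub>M\<^esub> x)" if "a \<in> carrier R" "x \<in> carrier M" for a x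
  proof -
    have "a \<odot>\<^bsub>M\<^esub> s (r x) \<ominus>\<^bsub>M\<^esub> a \<odot>\<^bsub>M\<^esub> x = a \<odot>\<^bsub>M\<^esub> (s (r x) \<ominus>\<^bsub>M\<^esub> x)"
      using s that by (simp add: smult_diff_right)
    then show ?thesis
      unfolding M'_def using s that r N(6) by (simp add: smult_closed)
  qed
  have carr: "carrier M' = r ` carrier M" and zero: "\<zero>\<^bsub>M'\<^esub> = r \<zero>\<^bsub>M\<^esub>"
    by (simp_all add: M'_def)
  show ?thesis
    by (rule that) (use lmodule_hom_image[OF assms(1) carr zero add smult] carr in auto)
qed

text \<open>Brings the regular module and the modules \<open>simple_at\<close>, whose element types
  are tied to the algebra, into the universe \<open>'u\<close>.\<close>

lemma lmodule_copy:
  fixes M :: "('a, 'm) module"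
  assumes "lmodule R M" "carrier M \<lesssim> (UNIV :: 'u set)"
  obtains M' :: "('a, 'u) module" and r
  where "lmodule R M'" "r \<in> module_hom R M M'" "bij_betw r (carrier M) (carrier M')"
proof -
  interpret lmodule R M by fact
  obtain r :: "'m \<Rightarrow> 'u" where r: "inj_on r (carrier M)"
    using assms(2) by (auto simp: lepoll_def)
  have "r x = r y \<longleftrightarrow> x \<ominus>\<^bsub>M\<^esub> y \<in> {\<zero>\<^bsub>M\<^esub>}" if "x \<in> carrier M" "y \<in> carrier M" for x y
    using that r by (auto simp: inj_on_eq_iff M.diff_eq_zero_iff)
  from lmodule_image[OF assms(1) submodule_zero[OF assms(1)] this]
  obtain M' :: "('a, 'u) module" where "lmodule R M'" "carrier M' = r ` carrier M" "r \<in> module_hom R M M'"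
    by blast
  then show ?thesis using that r by (simp add: bij_betw_def)
qed

lemma lmodule_quotient:
  fixes M :: "('a, 'm) module"
  assumes "lmodule R M" "Module.submodule N R M"
  obtains Q :: "('a, 'm) module" and r
  where "lmodule R Q" "r \<in> module_hom R M Q" "r ` carrier M = carrier Q"
    "\<And>x. x \<in> carrier M \<Longrightarrow> r x = \<zero>\<^bsub>Q\<^esub> \<longleftrightarrow> x \<in> N"
proof -
  interpret lmodule R M by fact
  note N = submoduleD[OF assms(2)]
  define r where "r x = (SOME y. y \<in> carrier M \<and> x \<ominus>\<^bsub>M\<^esub> y \<in> N)" for x
  have r1: "r x \<in> carrier M \<and> x \<ominus>\<^bsub>M\<^esub> r x \<in> N" if "x \<in> carrier M" for x
    unfolding r_def by (rule someI[of _ x]) (use that N(2) in \<open>simp add: a_minus_def M.r_neg\<close>)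
  have r: "r x = r y \<longleftrightarrow> x \<ominus>\<^bsub>M\<^esub> y \<in> N" if x: "x \<in> carrier M" and y: "y \<in> carrier M" for x y
  proof
    assume e: "r x = r y"
    have "(x \<ominus>\<^bsub>M\<^esub> r x) \<ominus>\<^bsub>M\<^esub> (y \<ominus>\<^bsub>M\<^esub> r x) \<in> N" using r1[OF x] r1[OF y] N(5) e by simp
    moreover have "(x \<ominus>\<^bsub>M\<^esub> r x) \<ominus>\<^bsub>M\<^esub> (y \<ominus>\<^bsub>M\<^esub> r x) = x \<ominus>\<^bsub>M\<^esub> y"
      using x y r1[OF x] by (intro M.diff_diff_cancel) auto
    ultimately show "x \<ominus>\<^bsub>M\<^esub> y \<in> N" by simp
  next
    assume d: "x \<ominus>\<^bsub>M\<^esub> y \<in> N"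
    \<comment> \<open>The choice operator returns equal values for equal predicates, so it is enough
      that \<open>z\<close> represents the coset of \<open>x\<close> exactly when it represents that
      of \<open>y\<close>.\<close>
    have "x \<ominus>\<^bsub>M\<^esub> z \<in> N \<longleftrightarrow> y \<ominus>\<^bsub>M\<^esub> z \<in> N" if z: "z \<in> carrier M" for z
    proof -
      have 1: "x \<ominus>\<^bsub>M\<^esub> z = (x \<ominus>\<^bsub>M\<^esub> y) \<oplus>\<^bsub>M\<^esub> (y \<ominus>\<^bsub>M\<^esub> z)"
        using x y z by (simp add: a_minus_def M.a_assoc M.r_neg1 M.r_neg2)
      have 2: "y \<ominus>\<^bsub>M\<^esub> z = \<ominus>\<^bsub>M\<^esub> (x \<ominus>\<^bsub>M\<^esub> y) \<oplus>\<^bsub>M\<^esub> (x \<ominus>\<^bsub>M\<^esub> z)"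
        using x y z 1 by (simp add: M.r_neg1)
      show ?thesis using 1 2 d N by metis
    qed
    then show "r x = r y" unfolding r_def by metis
  qed
  from lmodule_image[OF assms r]
  obtain Q :: "('a, 'm) module" where Q: "lmodule R Q" "carrier Q = r ` carrier M" "r \<in> module_hom R M Q"
    by blast
  have "r x = \<zero>\<^bsub>Q\<^esub> \<longleftrightarrow> x \<in> N" if "x \<in> carrier M" for x
    using r[OF that, of "\<zero>\<^bsub>M\<^esub>"] lmodule_hom_zero[OF assms(1) Q(1,3)] that
    by (simp add: M.diff_zero_right)
  then show ?thesis using that Q by simp
qed

section \<open>Factoring homomorphisms; extensional homomorphisms\<close>

lemma module_hom_comp:
  assumes "f \<in> module_hom R L M" "g \<in> module_hom R M N"
  shows "(\<lambda>x. g (f x)) \<in> module_hom R L N"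
  by (rule module_homI) (simp_all add: module_homD[OF assms(1)] module_homD[OF assms(2)])

lemma module_hom_restrict_carrier:
  fixes M :: "('a, 'm) module"
  assumes "f \<in> module_hom R M N" "L \<subseteq> carrier M"
  shows "f \<in> module_hom R (M\<lparr>carrier := L\<rparr>) N"
  using assms by (auto simp: module_hom_def subset_iff)

lemma inj_on_module_homI:
  assumes "lmodule R M" "lmodule R N" "f \<in> module_hom R M N"
    and "\<And>x. x \<in> carrier M \<Longrightarrow> f x = \<zero>\<^bsub>N\<^esub> \<Longrightarrow> x = \<zero>\<^bsub>M\<^esub>"
  shows "inj_on f (carrier M)"
proof (rule inj_onI)
  interpret M: lmodule R M by fact
  interpret N: lmodule R N by fact
  fix x y assume xy: "x \<in> carrier M" "y \<in> carrier M" "f x = f y"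
  then have "f (x \<ominus>\<^bsub>M\<^esub> y) = \<zero>\<^bsub>N\<^esub>"
    using module_homD(1)[OF assms(3)] by (simp add: lmodule_hom_diff[OF assms(1-3)] N.M.diff_eq_zero_iff)
  then show "x = y" using assms(4) xy M.M.diff_eq_zero_iff by (metis M.M.minus_closed)
qed

text \<open>Two preimages of a point under \<open>p\<close> differ by an element of the kernel,
  which \<open>f\<close> kills, so \<open>f\<close> of a chosen preimage is well defined. Maps out
  of \<open>Q\<close> thus arise without forming a quotient of \<open>P\<close>, and with three
  unrelated element types.\<close>

lemma module_hom_factor:
  fixes P :: "('a, 'p) module" and Q :: "('a, 'q) module" and T :: "('a, 't) module"
  assumes P: "lmodule R P" and Q: "lmodule R Q" and T: "lmodule R T"
    and p: "p \<in> module_hom R P Q" "p ` carrier P = carrier Q"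
    and f: "f \<in> module_hom R P T"
    and ker: "\<And>x. x \<in> carrier P \<Longrightarrow> p x = \<zero>\<^bsub>Q\<^esub> \<Longrightarrow> f x = \<zero>\<^bsub>T\<^esub>"
  obtains g where "g \<in> module_hom R Q T" "\<And>x. x \<in> carrier P \<Longrightarrow> g (p x) = f x"
proof -
  interpret P: lmodule R P by fact
  interpret Q: lmodule R Q by fact
  interpret T: lmodule R T by fact
  note pD = module_homD[OF p(1)] and fD = module_homD[OF f]
  define g where "g y = f (inv_into (carrier P) p y)" for y
  have g: "g (p x) = f x" if x: "x \<in> carrier P" for x
  proof -
    let ?x = "inv_into (carrier P) p (p x)"
    have "?x \<in> carrier P" "p ?x = p x" using x by (auto simp: inv_into_into f_inv_into_f)
    then have "f (?x \<ominus>\<^bsub>P\<^esub> x) = \<zero>\<^bsub>T\<^esub>"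
      using x by (intro ker) (auto simp: lmodule_hom_diff[OF P Q p(1)] pD Q.M.diff_eq_zero_iff)
    then show ?thesis
      using x \<open>?x \<in> carrier P\<close> by (simp add: lmodule_hom_diff[OF P T f] fD T.M.diff_eq_zero_iff g_def)
  qed
  have "g \<in> module_hom R Q T"
  proof (rule module_homI)
    fix y assume "y \<in> carrier Q"
    then obtain x where "x \<in> carrier P" "y = p x" using p(2) by blast
    then show "g y \<in> carrier T" using g fD by simp
  next
    fix y z assume "y \<in> carrier Q" "z \<in> carrier Q"
    then obtain x w where "x \<in> carrier P" "y = p x" "w \<in> carrier P" "z = p w"
      using p(2) by blast
    then show "g (y \<oplus>\<^bsub>Q\<^esub> z) = g y \<oplus>\<^bsub>T\<^esub> g z" using g fD pD(2)[symmetric] by simp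
  next
    fix a y assume "a \<in> carrier R" "y \<in> carrier Q"
    moreover from this obtain x where "x \<in> carrier P" "y = p x" using p(2) by blast
    ultimately show "g (a \<odot>\<^bsub>Q\<^esub> y) = a \<odot>\<^bsub>T\<^esub> g y"
      using g fD pD(3)[symmetric] by (simp add: P.smult_closed)
  qed
  then show ?thesis using that g by blast
qed

lemma
  assumes "f \<in> Hom R M N"
  shows HomD: "f \<in> module_hom R M N"
    and Hom_closed: "x \<in> carrier M \<Longrightarrow> f x \<in> carrier N"
  using assms by (auto simp: Hom_def module_hom_def)

lemma HomI:
  fixes M :: "('a, 'm) module"
  assumes "lmodule R M" "f \<in> module_hom R M N"
  shows "(\<lambda>x\<in>carrier M. f x) \<in> Hom R M N"
proof -
  interpret lmodule R M by fact
  show ?thesis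
    using module_homD[OF assms(2)] by (auto simp: Hom_def module_hom_def smult_closed)
qed

lemma Hom_eqI:
  assumes "f \<in> Hom R M N" "g \<in> Hom R M N" "\<And>x. x \<in> carrier M \<Longrightarrow> f x = g x"
  shows "f = g"
  using assms by (auto simp: Hom_def intro: extensionalityI)

lemma compose_Hom:
  fixes L :: "('a, 'l) module"
  assumes "lmodule R L" "f \<in> Hom R L M" "g \<in> Hom R M N"
  shows "compose (carrier L) g f \<in> Hom R L N"
  unfolding compose_def using HomI[OF assms(1) module_hom_comp[OF HomD HomD]] assms(2,3) by blast

lemma hom_zero_Hom:
  assumes "lmodule R M" "lmodule R N"
  shows "hom_zero M N \<in> Hom R M N"
proof -
  interpret N: lmodule R N by fact
  show ?thesis unfolding hom_zero_def by (rule HomI[OF assms(1)], rule module_homI) auto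
qed

lemma hom_add_Hom:
  assumes "lmodule R M" "lmodule R N" "f \<in> Hom R M N" "g \<in> Hom R M N"
  shows "hom_add M N f g \<in> Hom R M N"
proof -
  interpret N: lmodule R N by fact
  note f = module_homD[OF HomD[OF assms(3)]] and g = module_homD[OF HomD[OF assms(4)]]
  show ?thesis unfolding hom_add_def
    by (rule HomI[OF assms(1)], rule module_homI) (auto simp: f g N.M.a_ac N.smult_r_distr)
qed

section \<open>Free modules of rank one\<close>

text \<open>Freeness of rank one is made a property of a module with a basis element, because the
  copy of the ring that the functors can see has its elements in \<open>'u\<close>.\<close>

definition free_lmodule_on :: "('a, 'x) ring_scheme \<Rightarrow> ('a, 'm) module \<Rightarrow> 'm \<Rightarrow> bool" where
  "free_lmodule_on R M e \<longleftrightarrow>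
     lmodule R M \<and> e \<in> carrier M \<and> bij_betw (\<lambda>a. a \<odot>\<^bsub>M\<^esub> e) (carrier R) (carrier M)"

definition regular_lmodule :: "('a, 'x) ring_scheme \<Rightarrow> ('a, 'a) module" where
  "regular_lmodule R =
     \<lparr>carrier = carrier R, mult = mult R, one = one R, zero = zero R, add = add R, smult = mult R\<rparr>"

lemma regular_lmodule_simps [simp]:
  "carrier (regular_lmodule R) = carrier R" "\<zero>\<^bsub>regular_lmodule R\<^esub> = \<zero>\<^bsub>R\<^esub>"
  "x \<oplus>\<^bsub>regular_lmodule R\<^esub> y = x \<oplus>\<^bsub>R\<^esub> y" "x \<odot>\<^bsub>regular_lmodule R\<^esub> y = x \<otimes>\<^bsub>R\<^esub> y"
  by (simp_all add: regular_lmodule_def)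

lemma regular_lmodule:
  assumes "ring R"
  shows "lmodule R (regular_lmodule R)"
proof -
  interpret ring R by fact
  have "abelian_group (regular_lmodule R)"
    by (rule abelian_groupI) (auto simp: a_ac intro: bexI[of _ "\<ominus>\<^bsub>R\<^esub> _"] l_neg)
  then show ?thesis
    using assms by (intro lmoduleI) (auto simp: l_distr r_distr m_assoc)
qed

lemma module_hom_eval:
  assumes "lmodule R M" "x \<in> carrier M"
  shows "(\<lambda>a. a \<odot>\<^bsub>M\<^esub> x) \<in> module_hom R (regular_lmodule R) M"
proof -
  interpret lmodule R M by fact
  show ?thesis
    by (rule module_homI) (use assms(2) in \<open>auto simp: smult_l_distr smult_assoc smult_closed\<close>)
qed

lemma free_lmodule_on_exists:
  assumes "ring R" "carrier R \<lesssim> (UNIV :: 'u set)"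
  obtains M :: "('a, 'u) module" and e where "free_lmodule_on (R :: ('a, 'x) ring_scheme) M e"
proof -
  interpret ring R by fact
  obtain M :: "('a, 'u) module" and r where M: "lmodule R M"
    "r \<in> module_hom R (regular_lmodule R) M" "bij_betw r (carrier R) (carrier M)"
    using lmodule_copy[OF regular_lmodule[OF assms(1)]] assms(2)
    by (metis regular_lmodule_simps(1))
  note r = module_homD[OF M(2)]
  have "a \<odot>\<^bsub>M\<^esub> r \<one>\<^bsub>R\<^esub> = r a" if "a \<in> carrier R" for a
    using r(3)[of a "\<one>\<^bsub>R\<^esub>"] that by simp
  then have "bij_betw (\<lambda>a. a \<odot>\<^bsub>M\<^esub> r \<one>\<^bsub>R\<^esub>) (carrier R) (carrier M)"
    using M(3) by (subst bij_betw_cong[where g = r]) auto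
  then have "free_lmodule_on R M (r \<one>\<^bsub>R\<^esub>)"
    using M(1) r(1)[of "\<one>\<^bsub>R\<^esub>"] by (simp add: free_lmodule_on_def)
  then show ?thesis using that by blast
qed

lemma free_lmodule_on_elem:
  assumes "free_lmodule_on R U e" "u \<in> carrier U"
  obtains a where "a \<in> carrier R" "u = a \<odot>\<^bsub>U\<^esub> e"
  using assms by (auto simp: free_lmodule_on_def bij_betw_def)

text \<open>The map \<open>a \<mapsto> a x\<close> factors through \<open>a \<mapsto> a e\<close>,
  since the latter is bijective and so has zero kernel.\<close>

lemma free_lmodule_on_hom:
  fixes U :: "('a, 'u) module" and M :: "('a, 'm) module"
  assumes "free_lmodule_on R U e" "lmodule R M" "x \<in> carrier M"
  obtains h where "h \<in> Hom R U M" "\<And>a. a \<in> carrier R \<Longrightarrow> h (a \<odot>\<^bsub>U\<^esub> e) = a \<odot>\<^bsub>M\<^esub> x" "h e = x"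
proof -
  have U: "lmodule R U" and e: "e \<in> carrier U"
    and b: "bij_betw (\<lambda>a. a \<odot>\<^bsub>U\<^esub> e) (carrier R) (carrier U)"
    using assms(1) by (auto simp: free_lmodule_on_def)
  interpret U: lmodule R U by fact
  interpret M: lmodule R M by fact
  have inj: "a = \<zero>\<^bsub>R\<^esub>" if "a \<in> carrier R" "a \<odot>\<^bsub>U\<^esub> e = \<zero>\<^bsub>U\<^esub>" for a
    using b that e by (auto simp: bij_betw_def inj_on_def)
  obtain g where g: "g \<in> module_hom R U M"
    and ga: "\<And>a. a \<in> carrier R \<Longrightarrow> g (a \<odot>\<^bsub>U\<^esub> e) = a \<odot>\<^bsub>M\<^esub> x"
    by (rule module_hom_factor[OF regular_lmodule[OF U.R.ring_axioms] U assms(2)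
        module_hom_eval[OF U e] _ module_hom_eval[OF assms(2,3)]])
      (use b assms(3) in \<open>auto simp: bij_betw_def dest: inj\<close>)
  show ?thesis
    using that[OF HomI[OF U g]] ga ga[of "\<one>\<^bsub>R\<^esub>"] e assms(3)
    by (simp add: U.smult_one M.smult_one U.smult_closed)
qed

lemma free_lmodule_on_hom_eqI:
  assumes "free_lmodule_on R U e" "f \<in> Hom R U M" "g \<in> Hom R U M" "f e = g e"
  shows "f = g"
proof (rule Hom_eqI[OF assms(2,3)])
  fix u assume "u \<in> carrier U"
  then obtain a where "a \<in> carrier R" "u = a \<odot>\<^bsub>U\<^esub> e" by (rule free_lmodule_on_elem[OF assms(1)])
  then show "f u = g u"
    using assms(1,4) module_homD(3)[OF HomD[OF assms(2)]] module_homD(3)[OF HomD[OF assms(3)]]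
    by (simp add: free_lmodule_on_def)
qed

section \<open>Simple modules and annihilators\<close>

lemma simple_lmoduleD:
  assumes "simple_lmodule R S"
  shows "lmodule R S"
    and "\<And>N. Module.submodule N R S \<Longrightarrow> x \<in> N \<Longrightarrow> x \<noteq> \<zero>\<^bsub>S\<^esub> \<Longrightarrow> N = carrier S"
  using assms by (auto simp: simple_lmodule_def)

lemma simple_lmodule_nonzero:
  assumes "simple_lmodule R S"
  obtains x where "x \<in> carrier S" "x \<noteq> \<zero>\<^bsub>S\<^esub>"
proof -
  interpret lmodule R S using assms by (simp add: simple_lmodule_def)
  have "carrier S \<noteq> {\<zero>\<^bsub>S\<^esub>}" using assms by (simp add: simple_lmodule_def)
  then show ?thesis using that M.zero_closed by blast
qed

text \<open>First half of Schur's lemma: a nonzero element of the kernel would make the kernel all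
  of \<open>S\<close>, against \<open>f x\<close> being nonzero.\<close>

lemma simple_lmodule_hom_inj:
  assumes "simple_lmodule R S" "lmodule R N" "f \<in> module_hom R S N"
    and "x \<in> carrier S" "f x \<noteq> \<zero>\<^bsub>N\<^esub>"
  shows "inj_on f (carrier S)"
proof (rule inj_on_module_homI[OF simple_lmoduleD(1)[OF assms(1)] assms(2,3)], rule ccontr)
  fix y assume "y \<in> carrier S" "f y = \<zero>\<^bsub>N\<^esub>" "y \<noteq> \<zero>\<^bsub>S\<^esub>"
  then have "{x \<in> carrier S. f x = \<zero>\<^bsub>N\<^esub>} = carrier S"
    using simple_lmoduleD(2)[OF assms(1)
        module_hom_kernel_submodule[OF simple_lmoduleD(1)[OF assms(1)] assms(2,3)]] by blast
  then show False using assms(4,5) by blast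
qed

text \<open>The other half of Schur's lemma. The submodule \<open>L\<close> is a parameter because
  it is often a left ideal, with \<open>f\<close> the map \<open>a \<mapsto> a s\<close>; the
  conclusion then reads \<open>L s = S\<close>.\<close>

lemma simple_lmodule_hom_surj:
  assumes "simple_lmodule R S" "lmodule R M" "f \<in> module_hom R M S"
    and "Module.submodule L R M" "x \<in> L" "f x \<noteq> \<zero>\<^bsub>S\<^esub>"
  shows "f ` L = carrier S"
  using simple_lmoduleD(2)[OF assms(1) module_hom_image_submodule[OF assms(2) _ assms(3,4)], of "f x"]
    simple_lmoduleD(1)[OF assms(1)] assms(5,6) by blast

lemma simple_lmodule_hom_bij:
  assumes "simple_lmodule R S" "simple_lmodule R S'" "f \<in> module_hom R S S'"
    and "x \<in> carrier S" "f x \<noteq> \<zero>\<^bsub>S'\<^esub>"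
  shows "bij_betw f (carrier S) (carrier S')"
  using simple_lmodule_hom_inj[OF assms(1) _ assms(3-5)]
    simple_lmodule_hom_surj[OF assms(2) _ assms(3) submodule_self assms(4,5)]
    simple_lmoduleD(1)[OF assms(1)] simple_lmoduleD(1)[OF assms(2)] by (simp add: bij_betw_def)

lemma simple_lmodule_transfer:
  fixes S :: "('a, 's) module" and S' :: "('a, 't) module"
  assumes "simple_lmodule R S" "lmodule R S'" "f \<in> module_hom R S S'"
    and "bij_betw f (carrier S) (carrier S')"
  shows "simple_lmodule R S'"
proof -
  have S: "lmodule R S" using assms(1) by (rule simple_lmoduleD)
  interpret S: lmodule R S by fact
  let ?g = "inv_into (carrier S) f"
  have g: "?g \<in> module_hom R S' S" by (rule module_hom_inv_into[OF S assms(2-4)])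
  have fg: "f (?g y) = y" if "y \<in> carrier S'" for y
    using that assms(4) by (metis bij_betw_inv_into_right)
  have f0: "f \<zero>\<^bsub>S\<^esub> = \<zero>\<^bsub>S'\<^esub>" by (rule lmodule_hom_zero[OF S assms(2,3)])
  have "N = {\<zero>\<^bsub>S'\<^esub>} \<or> N = carrier S'" if N: "Module.submodule N R S'" for N
  proof -
    have "f ` (?g ` N) = N" using submoduleD(1)[OF N] fg by (force simp: image_iff)
    moreover have "?g ` N = {\<zero>\<^bsub>S\<^esub>} \<or> ?g ` N = carrier S"
      using assms(1) module_hom_image_submodule[OF assms(2) S g N] by (simp add: simple_lmodule_def)
    ultimately show ?thesis using assms(4) f0 by (metis bij_betw_def image_empty image_insert)
  qed
  moreover have "carrier S' \<noteq> {\<zero>\<^bsub>S'\<^esub>}"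
  proof -
    obtain x where "x \<in> carrier S" "x \<noteq> \<zero>\<^bsub>S\<^esub>" using assms(1) by (rule simple_lmodule_nonzero)
    then have "f x \<in> carrier S'" "f x \<noteq> \<zero>\<^bsub>S'\<^esub>"
      using assms(4) f0 S.M.zero_closed by (auto simp: bij_betw_def inj_on_def)
    then show ?thesis by blast
  qed
  ultimately show ?thesis using assms(2) by (simp add: simple_lmodule_def)
qed

section \<open>Annihilators of simple modules and a density argument\<close>

definition annihilator :: "('a, 'x) ring_scheme \<Rightarrow> ('a, 'm) module \<Rightarrow> 'a set" where
  "annihilator R M = {a \<in> carrier R. \<forall>x\<in>carrier M. a \<odot>\<^bsub>M\<^esub> x = \<zero>\<^bsub>M\<^esub>}"

lemma annihilator_ideal:
  assumes "lmodule R M"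
  shows "ideal (annihilator R M) R"
proof -
  interpret lmodule R M by fact
  show ?thesis
  proof (rule idealI)
    show "subgroup (annihilator R M) (add_monoid R)"
      by (rule R.add.subgroupI)
        (auto simp: annihilator_def smult_l_distr smult_minus_left intro!: exI[of _ "\<zero>\<^bsub>R\<^esub>"]
          simp flip: a_inv_def)
  qed (auto simp: annihilator_def smult_assoc smult_closed R.ring_axioms)
qed

lemma annihilator_transfer:
  assumes "lmodule R M" "lmodule R N" "f \<in> module_hom R M N"
    and "bij_betw f (carrier M) (carrier N)"
  shows "annihilator R M = annihilator R N"
proof -
  interpret M: lmodule R M by fact
  have "a \<odot>\<^bsub>M\<^esub> x = \<zero>\<^bsub>M\<^esub> \<longleftrightarrow> a \<odot>\<^bsub>N\<^esub> f x = \<zero>\<^bsub>N\<^esub>" if "a \<in> carrier R" "x \<in> carrier M" for a x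
  proof -
    have "a \<odot>\<^bsub>M\<^esub> x = \<zero>\<^bsub>M\<^esub> \<longleftrightarrow> f (a \<odot>\<^bsub>M\<^esub> x) = f \<zero>\<^bsub>M\<^esub>"
      using assms(4) that M.smult_closed by (auto simp: bij_betw_def inj_on_eq_iff)
    then show ?thesis
      using that module_homD(3)[OF assms(3)] lmodule_hom_zero[OF assms(1-3)] by simp
  qed
  moreover have "carrier N = f ` carrier M" using assms(4) by (simp add: bij_betw_def)
  ultimately show ?thesis by (auto simp: annihilator_def)
qed

text \<open>It says that \<open>R\<close> modulo the annihilator embeds into a finite power of
  \<open>M\<close>, by \<open>a \<mapsto> (a x)\<close> for \<open>x\<close> in \<open>F\<close>.
  Finite dimensional modules over an algebra have this property, and the comparison of simple
  modules below uses finite dimension only through it, hence makes sense over any ring.\<close>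

definition finitely_faithful :: "('a, 'x) ring_scheme \<Rightarrow> ('a, 'm) module \<Rightarrow> bool" where
  "finitely_faithful R M \<longleftrightarrow>
     (\<exists>F. finite F \<and> F \<subseteq> carrier M \<and>
        (\<forall>a\<in>carrier R. (\<forall>x\<in>F. a \<odot>\<^bsub>M\<^esub> x = \<zero>\<^bsub>M\<^esub>) \<longrightarrow> a \<in> annihilator R M))"

text \<open>
  If \<open>L x \<noteq> 0\<close> and every \<open>a \<in> L\<close> killing \<open>x\<close> kills \<open>s'\<close>, then \<open>a x \<mapsto> a s'\<close> is a homomorphism
  \<open>S = L x \<rightarrow> S'\<close>; otherwise \<open>L\<close> can be replaced by the elements of \<open>L\<close> killing \<open>x\<close>.
\<close>

lemma hom_between_simples:
  fixes S :: "('a, 's) module" and S' :: "('a, 't) module"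
  assumes S: "simple_lmodule R S" and S': "simple_lmodule R S'"
    and "finite F" "F \<subseteq> carrier S" "s' \<in> carrier S'"
    and "Module.submodule L R (regular_lmodule R)"
    and "\<exists>a\<in>L. a \<odot>\<^bsub>S'\<^esub> s' \<noteq> \<zero>\<^bsub>S'\<^esub>"
    and "\<And>a. a \<in> L \<Longrightarrow> \<forall>x\<in>F. a \<odot>\<^bsub>S\<^esub> x = \<zero>\<^bsub>S\<^esub> \<Longrightarrow> a \<odot>\<^bsub>S'\<^esub> s' = \<zero>\<^bsub>S'\<^esub>"
  shows "\<exists>f\<in>module_hom R S S'. \<exists>x\<in>carrier S. f x \<noteq> \<zero>\<^bsub>S'\<^esub>"
  using assms(3-)
proof (induction F arbitrary: L rule: finite_induct)
  \<comment> \<open>For empty \<open>F\<close> every element of \<open>L\<close> would kill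
    \<open>s'\<close>, contrary to assumption.\<close>
  case empty
  then show ?case by blast
next
  case (insert x F)
  have lm: "lmodule R S" "lmodule R S'" using S S' by (auto dest: simple_lmoduleD)
  interpret S: lmodule R S by fact
  interpret S': lmodule R S' by fact
  note R = regular_lmodule[OF S.R.ring_axioms]
  note L = submoduleD[OF insert.prems(3), simplified]
  have x: "x \<in> carrier S" using insert.prems by simp
  let ?L = "{a \<in> L. a \<odot>\<^bsub>S\<^esub> x = \<zero>\<^bsub>S\<^esub>}"
  show ?case
  proof (cases "\<exists>a\<in>?L. a \<odot>\<^bsub>S'\<^esub> s' \<noteq> \<zero>\<^bsub>S'\<^esub>")
    case True
    have sub: "Module.submodule ?L R (regular_lmodule R)"
      by (rule lmodule.submoduleI[OF R])
        (use L x in \<open>auto simp: S.smult_l_distr S.smult_assoc subset_iff\<close>)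
    show ?thesis
      by (rule insert.IH[OF _ insert.prems(2) sub True]) (use insert.prems in auto)
  next
    case False
    let ?P = "(regular_lmodule R)\<lparr>carrier := L\<rparr>"
    have hx: "(\<lambda>a. a \<odot>\<^bsub>S\<^esub> x) \<in> module_hom R ?P S"
      and hs: "(\<lambda>a. a \<odot>\<^bsub>S'\<^esub> s') \<in> module_hom R ?P S'"
      using module_hom_restrict_carrier[OF module_hom_eval] lm x insert.prems(2) L(1) by auto
    obtain a where a: "a \<in> L" "a \<odot>\<^bsub>S'\<^esub> s' \<noteq> \<zero>\<^bsub>S'\<^esub>" using insert.prems(4) by blast
    have ax: "a \<odot>\<^bsub>S\<^esub> x \<noteq> \<zero>\<^bsub>S\<^esub>" using False a by blast
    have surj: "(\<lambda>a. a \<odot>\<^bsub>S\<^esub> x) ` L = carrier S"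
      by (rule simple_lmodule_hom_surj[OF S R module_hom_eval[OF lm(1) x] insert.prems(3) a(1) ax])
    obtain g where g: "g \<in> module_hom R S S'"
      "\<And>b. b \<in> L \<Longrightarrow> g (b \<odot>\<^bsub>S\<^esub> x) = b \<odot>\<^bsub>S'\<^esub> s'"
      using module_hom_factor[OF submodule_lmodule[OF R insert.prems(3)] lm hx _ hs] surj False
      by auto
    have "g (a \<odot>\<^bsub>S\<^esub> x) \<noteq> \<zero>\<^bsub>S'\<^esub>" "a \<odot>\<^bsub>S\<^esub> x \<in> carrier S" using g(2)[OF a(1)] a surj by auto
    then show ?thesis using g(1) by blast
  qed
qed

text \<open>\<open>hom_between_simples\<close> is started with \<open>L = R\<close>: an element
  killing \<open>F\<close> annihilates \<open>S\<close>, hence \<open>S'\<close>, hence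
  \<open>s'\<close>, while \<open>1\<close> does not kill \<open>s'\<close>. The nonzero map
  obtained is bijective by Schur's lemma.\<close>

lemma simple_lmodules_isomorphic:
  fixes S :: "('a, 's) module" and S' :: "('a, 't) module"
  assumes "simple_lmodule R S" "simple_lmodule R S'" "finitely_faithful R S"
    and "annihilator R S \<subseteq> annihilator R S'"
  obtains f where "f \<in> module_hom R S S'" "bij_betw f (carrier S) (carrier S')"
proof -
  interpret S': lmodule R S' using assms(2) by (rule simple_lmoduleD)
  obtain s' where s': "s' \<in> carrier S'" "s' \<noteq> \<zero>\<^bsub>S'\<^esub>" using assms(2) by (rule simple_lmodule_nonzero)
  obtain F where F: "finite F" "F \<subseteq> carrier S"
    "\<And>a. a \<in> carrier R \<Longrightarrow> \<forall>x\<in>F. a \<odot>\<^bsub>S\<^esub> x = \<zero>\<^bsub>S\<^esub> \<Longrightarrow> a \<in> annihilator R S"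
    using assms(3) by (auto simp: finitely_faithful_def)
  have "\<exists>f\<in>module_hom R S S'. \<exists>x\<in>carrier S. f x \<noteq> \<zero>\<^bsub>S'\<^esub>"
  proof (rule hom_between_simples[OF assms(1,2) F(1,2) s'(1)])
    show "Module.submodule (carrier R) R (regular_lmodule R)"
      using submodule_self[OF regular_lmodule[OF S'.R.ring_axioms]] by simp
    show "\<exists>a\<in>carrier R. a \<odot>\<^bsub>S'\<^esub> s' \<noteq> \<zero>\<^bsub>S'\<^esub>" using s' S'.smult_one by (metis S'.R.one_closed)
  qed (use F(3) assms(4) s'(1) in \<open>auto simp: annihilator_def\<close>)
  then show ?thesis using that simple_lmodule_hom_bij[OF assms(1,2)] by blast
qed

text \<open>Suppose that \<open>e\<close> already fixes \<open>F\<close>, and consider the defect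
  \<open>s = y - e y\<close> of a further element \<open>y\<close>. As \<open>J\<close> does not
  annihilate \<open>S\<close>, either \<open>s = 0\<close> or \<open>J s = S\<close>; so some
  \<open>f\<close> in \<open>J\<close> fixes \<open>s\<close>, and combining \<open>e\<close> with
  \<open>f\<close> repairs \<open>y\<close> without disturbing \<open>F\<close>.\<close>

lemma ideal_identity_on_finite:
  assumes S: "simple_lmodule R S" and J: "ideal J R" "\<not> J \<subseteq> annihilator R S"
    and "finite F" "F \<subseteq> carrier S"
  shows "\<exists>e\<in>J. \<forall>x\<in>F. e \<odot>\<^bsub>S\<^esub> x = x"
  using assms(4,5)
proof (induction F rule: finite_induct)
  case empty
  interpret ideal J R by fact
  show ?case using additive_subgroup.zero_closed[OF is_additive_subgroup] by blast
next
  case (insert y F)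
  have lm: "lmodule R S" using S by (rule simple_lmoduleD)
  interpret S: lmodule R S by fact
  interpret J: ideal J R by fact
  note R = regular_lmodule[OF S.R.ring_axioms]
  note sub = J.Icarr
  obtain e where e: "e \<in> J" "\<And>x. x \<in> F \<Longrightarrow> e \<odot>\<^bsub>S\<^esub> x = x" using insert by auto
  have y: "y \<in> carrier S" using insert by simp
  define s where "s = y \<ominus>\<^bsub>S\<^esub> e \<odot>\<^bsub>S\<^esub> y"
  have s: "s \<in> carrier S" using y e sub by (simp add: s_def S.smult_closed)
  have "\<exists>f\<in>J. f \<odot>\<^bsub>S\<^esub> s = s"
  proof (cases "s = \<zero>\<^bsub>S\<^esub>")
    case True
    then show ?thesis using J.additive_subgroup_axioms additive_subgroup.zero_closed by (auto intro!: bexI[of _ "\<zero>\<^bsub>R\<^esub>"])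
  next
    case False
    have Jsub: "Module.submodule J R (regular_lmodule R)"
      by (rule lmodule.submoduleI[OF R]) (auto simp: sub J.I_l_closed)
    have "\<exists>f\<in>J. f \<odot>\<^bsub>S\<^esub> s \<noteq> \<zero>\<^bsub>S\<^esub>"
    proof (rule ccontr)
      assume a: "\<not> (\<exists>f\<in>J. f \<odot>\<^bsub>S\<^esub> s \<noteq> \<zero>\<^bsub>S\<^esub>)"
      \<comment> \<open>The elements killed by \<open>J\<close> form a submodule because
        \<open>J\<close> is closed under multiplication from the right; containing the nonzero
        \<open>s\<close>, it is all of \<open>S\<close>.\<close>
      let ?N = "{x \<in> carrier S. \<forall>f\<in>J. f \<odot>\<^bsub>S\<^esub> x = \<zero>\<^bsub>S\<^esub>}"
      have "Module.submodule ?N R S"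
      proof (rule S.submoduleI)
        fix a x assume "a \<in> carrier R" "x \<in> ?N"
        then show "a \<odot>\<^bsub>S\<^esub> x \<in> ?N"
          by (auto simp: S.smult_closed sub simp flip: S.smult_assoc intro: J.I_r_closed)
      qed (auto simp: sub S.smult_r_distr)
      then have "?N = carrier S"
        by (rule simple_lmoduleD(2)[OF S _ _ False]) (use a s in auto)
      then have "J \<subseteq> annihilator R S" using sub by (auto simp: annihilator_def)
      then show False using J(2) by simp
    qed
    then obtain f where f: "f \<in> J" "f \<odot>\<^bsub>S\<^esub> s \<noteq> \<zero>\<^bsub>S\<^esub>" by blast
    have "(\<lambda>a. a \<odot>\<^bsub>S\<^esub> s) ` J = carrier S"
      by (rule simple_lmodule_hom_surj[OF S R module_hom_eval[OF lm s] Jsub f])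
    then show ?thesis using s by (metis imageE)
  qed
  then obtain f where f: "f \<in> J" "f \<odot>\<^bsub>S\<^esub> s = s" by blast
  \<comment> \<open>that is, \<open>1 - ?e = (1 - f)(1 - e)\<close>\<close>
  let ?e = "e \<oplus>\<^bsub>R\<^esub> (f \<ominus>\<^bsub>R\<^esub> f \<otimes>\<^bsub>R\<^esub> e)"
  have act: "?e \<odot>\<^bsub>S\<^esub> x = e \<odot>\<^bsub>S\<^esub> x \<oplus>\<^bsub>S\<^esub> f \<odot>\<^bsub>S\<^esub> (x \<ominus>\<^bsub>S\<^esub> e \<odot>\<^bsub>S\<^esub> x)" if "x \<in> carrier S" for x
    using that e(1) f(1) sub
    by (simp add: S.smult_l_distr S.smult_diff_left S.smult_diff_right S.smult_assoc S.smult_closed)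
  have "?e \<in> J"
    using e f sub by (simp add: J.I_r_closed J.a_closed J.a_inv_closed a_minus_def)
  moreover have "?e \<odot>\<^bsub>S\<^esub> x = x" if "x \<in> F" for x
    using that insert.prems e f sub act[of x] by (auto simp: a_minus_def S.M.r_neg)
  moreover have "?e \<odot>\<^bsub>S\<^esub> y = y"
    using act[OF y] f(2) y e(1) sub
    by (simp add: s_def[symmetric]) (simp add: s_def a_minus_def S.M.a_lcomm[of "e \<odot>\<^bsub>S\<^esub> y"] S.smult_closed S.M.r_neg)
  ultimately show ?case by (intro bexI[of _ ?e]) auto
qed

text \<open>An ideal strictly above the annihilator contains some \<open>e\<close> acting as the
  identity on \<open>F\<close>. Then \<open>1 - e\<close> kills \<open>F\<close>, so it lies in the
  annihilator and thus in the ideal, which therefore contains \<open>1\<close>.\<close>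

lemma annihilator_maximalideal:
  assumes S: "simple_lmodule R S" and "finitely_faithful R S"
  shows "maximalideal (annihilator R S) R"
proof (rule maximalidealI)
  have lm: "lmodule R S" using S by (rule simple_lmoduleD)
  interpret S: lmodule R S by fact
  show "ideal (annihilator R S) R" by (rule annihilator_ideal[OF lm])
  obtain x where x: "x \<in> carrier S" "x \<noteq> \<zero>\<^bsub>S\<^esub>" using S by (rule simple_lmodule_nonzero)
  then have "\<one>\<^bsub>R\<^esub> \<notin> annihilator R S" by (auto simp: annihilator_def S.smult_one)
  then show "carrier R \<noteq> annihilator R S" by auto
  fix J assume J: "ideal J R" "annihilator R S \<subseteq> J" "J \<subseteq> carrier R"
  interpret J: ideal J R by fact
  obtain F where F: "finite F" "F \<subseteq> carrier S"
    "\<And>a. a \<in> carrier R \<Longrightarrow> \<forall>x\<in>F. a \<odot>\<^bsub>S\<^esub> x = \<zero>\<^bsub>S\<^esub> \<Longrightarrow> a \<in> annihilator R S"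
    using assms(2) by (auto simp: finitely_faithful_def)
  show "J = annihilator R S \<or> J = carrier R"
  proof (cases "J \<subseteq> annihilator R S")
    case False
    then obtain e where e: "e \<in> J" "\<And>x. x \<in> F \<Longrightarrow> e \<odot>\<^bsub>S\<^esub> x = x"
      using ideal_identity_on_finite[OF S J(1) _ F(1,2)] by blast
    have "\<one>\<^bsub>R\<^esub> \<ominus>\<^bsub>R\<^esub> e \<in> J"
    proof -
      have "(\<one>\<^bsub>R\<^esub> \<ominus>\<^bsub>R\<^esub> e) \<odot>\<^bsub>S\<^esub> x = \<zero>\<^bsub>S\<^esub>" if "x \<in> F" for x
        using e that F(2) J.Icarr
        by (auto simp: S.smult_diff_left S.smult_one S.M.diff_eq_zero_iff subset_iff)
      then show ?thesis using F(3)[of "\<one>\<^bsub>R\<^esub> \<ominus>\<^bsub>R\<^esub> e"] e(1) J(2) J.Icarr by auto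
    qed
    then have "(\<one>\<^bsub>R\<^esub> \<ominus>\<^bsub>R\<^esub> e) \<oplus>\<^bsub>R\<^esub> e \<in> J" using e(1) by (rule J.a_closed)
    then have "\<one>\<^bsub>R\<^esub> \<in> J" using e(1) J.Icarr by (simp add: a_minus_def S.R.a_assoc S.R.l_neg)
    then show ?thesis using J.one_imp_carrier by simp
  qed (use J in auto)
qed

text \<open>The module is \<open>R\<close> modulo a maximal left ideal, found by Zorn's lemma among
  the left ideals without \<open>1\<close>. It needs the element type of \<open>R\<close> itself,
  because \<open>simple_at\<close> chooses among modules of just that type; coset representatives
  provide it.\<close>

lemma simple_lmodule_exists:
  assumes "ring R" "\<one>\<^bsub>R\<^esub> \<noteq> \<zero>\<^bsub>R\<^esub>"
  shows "\<exists>M :: ('a, 'a) module. simple_lmodule (R :: ('a, 'x) ring_scheme) M"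
proof -
  interpret ring R by fact
  note lm = regular_lmodule[OF assms(1)]
  let ?\<L> = "{L. Module.submodule L R (regular_lmodule R) \<and> \<one>\<^bsub>R\<^esub> \<notin> L}"
  have "\<exists>L\<in>?\<L>. \<forall>X\<in>?\<L>. L \<subseteq> X \<longrightarrow> X = L"
  proof (rule subset_Zorn_nonempty)
    show "?\<L> \<noteq> {}" using submodule_zero[OF lm] assms(2) by auto
  next
    fix \<C> assume ne: "\<C> \<noteq> {}" and ch: "subset.chain ?\<L> \<C>"
    have sub: "Module.submodule L R (regular_lmodule R)" "\<one>\<^bsub>R\<^esub> \<notin> L" if "L \<in> \<C>" for L
      using ch that by (auto simp: subset.chain_def)
    have "Module.submodule (\<Union>\<C>) R (regular_lmodule R)"
    proof (rule lmodule.submoduleI[OF lm])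
      show "\<Union>\<C> \<subseteq> carrier (regular_lmodule R)" using submoduleD(1)[OF sub(1)] by blast
      show "\<zero>\<^bsub>regular_lmodule R\<^esub> \<in> \<Union>\<C>" using submoduleD(2)[OF sub(1)] ne by blast
    next
      fix x y assume "x \<in> \<Union>\<C>" "y \<in> \<Union>\<C>"
      then obtain L L' where L: "x \<in> L" "L \<in> \<C>" "y \<in> L'" "L' \<in> \<C>" by blast
      moreover have "L \<subseteq> L' \<or> L' \<subseteq> L" using ch L unfolding subset_chain_def by blast
      ultimately show "x \<oplus>\<^bsub>regular_lmodule R\<^esub> y \<in> \<Union>\<C>" using submoduleD(3)[OF sub(1)] by blast
    next
      fix a x assume "a \<in> carrier R" "x \<in> \<Union>\<C>"
      then show "a \<odot>\<^bsub>regular_lmodule R\<^esub> x \<in> \<Union>\<C>" using submoduleD(6)[OF sub(1)] by blast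
    qed
    then show "\<Union>\<C> \<in> ?\<L>" using sub(2) by blast
  qed
  then obtain L where L: "Module.submodule L R (regular_lmodule R)" "\<one>\<^bsub>R\<^esub> \<notin> L"
    and max: "\<And>X. Module.submodule X R (regular_lmodule R) \<Longrightarrow> \<one>\<^bsub>R\<^esub> \<notin> X \<Longrightarrow> L \<subseteq> X \<Longrightarrow> X = L"
    by blast
  obtain Q :: "('a, 'a) module" and r where Q: "lmodule R Q"
    and r: "r \<in> module_hom R (regular_lmodule R) Q" "r ` carrier R = carrier Q"
    and ker: "\<And>x. x \<in> carrier R \<Longrightarrow> r x = \<zero>\<^bsub>Q\<^esub> \<longleftrightarrow> x \<in> L"
    by (rule lmodule_quotient[OF lm L(1)]) (auto simp: regular_lmodule_simps)
  interpret Q: lmodule R Q by fact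
  note rD = module_homD[OF r(1), simplified]
  have "N = {\<zero>\<^bsub>Q\<^esub>} \<or> N = carrier Q" if N: "Module.submodule N R Q" for N
  proof -
    note ND = submoduleD[OF N]
    let ?X = "{x \<in> carrier R. r x \<in> N}"
    have X: "Module.submodule ?X R (regular_lmodule R)"
      by (rule lmodule.submoduleI[OF lm])
        (use rD ND lmodule_hom_zero[OF lm Q r(1)] in auto)
    have "L \<subseteq> ?X"
    proof
      fix x assume "x \<in> L"
      then show "x \<in> ?X" using submoduleD(1)[OF L(1)] ker[of x] ND(2) by auto
    qed
    then consider "?X = L" | "\<one>\<^bsub>R\<^esub> \<in> ?X" using max[OF X] by blast
    then show ?thesis
    proof cases
      case 1
      have "y = \<zero>\<^bsub>Q\<^esub>" if y: "y \<in> N" for y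
      proof -
        obtain x where x: "x \<in> carrier R" "y = r x" using y ND(1) r(2) by blast
        then have "x \<in> ?X" using y by simp
        then have "x \<in> L" unfolding 1 .
        then show ?thesis using ker[OF x(1)] x(2) by simp
      qed
      then show ?thesis using ND(2) by blast
    next
      case 2
      have "r x \<in> N" if "x \<in> carrier R" for x
        using rD(3)[of x "\<one>\<^bsub>R\<^esub>"] ND(6)[of x "r \<one>\<^bsub>R\<^esub>"] 2 that by simp
      then have "r ` carrier R \<subseteq> N" by (rule image_subsetI)
      then show ?thesis using ND(1) unfolding r(2) by simp
    qed
  qed
  moreover have "carrier Q \<noteq> {\<zero>\<^bsub>Q\<^esub>}" using ker[of "\<one>\<^bsub>R\<^esub>"] L(2) r(2) by auto
  ultimately have "simple_lmodule R Q" using Q by (simp add: simple_lmodule_def)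
  then show ?thesis by blast
qed

section \<open>Restriction of scalars\<close>

lemma restrict_scalars_simps [simp]:
  "carrier (restrict_scalars \<phi> M) = carrier M" "\<zero>\<^bsub>restrict_scalars \<phi> M\<^esub> = \<zero>\<^bsub>M\<^esub>"
  "x \<oplus>\<^bsub>restrict_scalars \<phi> M\<^esub> y = x \<oplus>\<^bsub>M\<^esub> y" "a \<odot>\<^bsub>restrict_scalars \<phi> M\<^esub> x = \<phi> a \<odot>\<^bsub>M\<^esub> x"
  by (simp_all add: restrict_scalars_def)

lemma restrict_scalars_lmodule:
  assumes "ring A" "\<phi> \<in> ring_hom A B" "lmodule B M"
  shows "lmodule A (restrict_scalars \<phi> M)"
proof -
  interpret lmodule B M by fact
  note \<phi> = ring_hom_memE[OF assms(2)]
  have "abelian_group (restrict_scalars \<phi> M)"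
    by (rule abelian_groupI) (auto simp: M.a_ac intro: bexI[of _ "\<ominus>\<^bsub>M\<^esub> _"] M.l_neg)
  then show ?thesis
    using assms(1)
    by (intro lmoduleI)
      (auto simp: \<phi> smult_closed smult_l_distr smult_r_distr smult_assoc smult_one)
qed

lemma restrict_scalars_simple:
  assumes "ring A" "\<phi> \<in> ring_hom A B" "\<phi> ` carrier A = carrier B" "simple_lmodule B M"
  shows "simple_lmodule A (restrict_scalars \<phi> M)"
proof -
  have M: "lmodule B M" using assms(4) by (rule simple_lmoduleD)
  interpret lmodule B M by fact
  have "Module.submodule N B M" if "Module.submodule N A (restrict_scalars \<phi> M)" for N
  proof (rule submoduleI)
    fix a x assume "a \<in> carrier B" "x \<in> N"
    moreover from this obtain b where "b \<in> carrier A" "a = \<phi> b" using assms(3) by blast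
    ultimately show "a \<odot>\<^bsub>M\<^esub> x \<in> N" using submoduleD(6)[OF that] by simp
  qed (use submoduleD(1-3)[OF that] in auto)
  then show ?thesis
    using assms(4) restrict_scalars_lmodule[OF assms(1,2) M] by (auto simp: simple_lmodule_def)
qed

text \<open>By maximality of \<open>I\<close> it is enough that the annihilator is a proper ideal
  containing \<open>I\<close>; it is proper since \<open>1\<close> acts as the identity on a nonzero
  module. Thus \<open>I\<close> can be recovered from its simple module, which lets distinctness of
  ideals be argued with modules.\<close>

lemma
  assumes "maximalideal I A"
  shows simple_at_simple: "simple_lmodule A (simple_at A I)"
    and simple_at_annihilator: "annihilator A (simple_at A I) = I"
proof -
  interpret maximalideal I A by fact
  have ideal: "ideal I A" by (rule is_ideal)
  have Q: "ring (A Quot I)" by (rule quotient_is_ring)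
  have hom: "(+>\<^bsub>A\<^esub>) I \<in> ring_hom A (A Quot I)" by (rule rcos_ring_hom)
  have surj: "(+>\<^bsub>A\<^esub>) I ` carrier A = carrier (A Quot I)"
    by (auto simp: FactRing_simps)
  have "\<one>\<^bsub>A Quot I\<^esub> \<noteq> \<zero>\<^bsub>A Quot I\<^esub>"
  proof
    assume "\<one>\<^bsub>A Quot I\<^esub> = \<zero>\<^bsub>A Quot I\<^esub>"
    then have "I +>\<^bsub>A\<^esub> \<one>\<^bsub>A\<^esub> = I" by (simp add: FactRing_def)
    then have "\<one>\<^bsub>A\<^esub> \<in> I" using rcos_const_imp_mem by simp
    then show False using one_imp_carrier I_notcarr by simp
  qed
  then have ex: "\<exists>M :: ('a set, 'a set) module. simple_lmodule (A Quot I) M"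
    by (rule simple_lmodule_exists[OF Q])
  define S' :: "('a set, 'a set) module" where "S' = (SOME M. simple_lmodule (A Quot I) M)"
  have S': "simple_lmodule (A Quot I) S'" unfolding S'_def by (rule someI_ex[OF ex])
  interpret S': lmodule "A Quot I" S' using S' by (rule simple_lmoduleD)
  have at: "simple_at A I = restrict_scalars ((+>\<^bsub>A\<^esub>) I) S'" by (simp add: simple_at_def S'_def)
  show simple: "simple_lmodule A (simple_at A I)"
    unfolding at by (rule restrict_scalars_simple[OF ring_axioms hom surj S'])
  let ?N = "annihilator A (simple_at A I)"
  have N: "ideal ?N A" by (rule annihilator_ideal[OF simple_lmoduleD(1)[OF simple]])
  have "I \<subseteq> ?N"
  proof
    fix a assume a: "a \<in> I"
    then have "I +>\<^bsub>A\<^esub> a = \<zero>\<^bsub>A Quot I\<^esub>"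
      using a_rcos_zero[OF ideal a] by (simp add: FactRing_def)
    then show "a \<in> ?N" using Icarr[OF a] by (simp add: annihilator_def at)
  qed
  moreover have "?N \<noteq> carrier A"
  proof
    assume "?N = carrier A"
    then have "\<one>\<^bsub>A\<^esub> \<in> ?N" by simp
    moreover have "I +>\<^bsub>A\<^esub> \<one>\<^bsub>A\<^esub> = \<one>\<^bsub>A Quot I\<^esub>" by (simp add: FactRing_def)
    ultimately have "x = \<zero>\<^bsub>S'\<^esub>" if "x \<in> carrier S'" for x
      using that by (simp add: annihilator_def at S'.smult_one)
    then show False using simple_lmodule_nonzero[OF S'] by metis
  qed
  moreover have "?N \<subseteq> carrier A" by (auto simp: annihilator_def)
  ultimately show "?N = I" using I_maximal[OF N] by blast
qed

section \<open>Noetherian modules and finite dimension\<close>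

text \<open>Generation is expressed by comparison with submodules instead of linear combinations, so
  that images, preimages and intersections are handled without coefficients. If \<open>N\<close> is
  a submodule, it is the smallest one containing \<open>F\<close>.\<close>

definition generates :: "('a, 'x) ring_scheme \<Rightarrow> ('a, 'm) module \<Rightarrow> 'm set \<Rightarrow> 'm set \<Rightarrow> bool" where
  "generates R M F N \<longleftrightarrow> F \<subseteq> N \<and> (\<forall>N'. Module.submodule N' R M \<longrightarrow> F \<subseteq> N' \<longrightarrow> N \<subseteq> N')"

definition noetherian_lmodule :: "('a, 'x) ring_scheme \<Rightarrow> ('a, 'm) module \<Rightarrow> bool" where
  "noetherian_lmodule R M \<longleftrightarrow>
     (\<forall>N. Module.submodule N R M \<longrightarrow> (\<exists>F. finite F \<and> generates R M F N))"

lemma submodule_Int: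
  assumes "lmodule R M" "Module.submodule N R M" "Module.submodule N' R M"
  shows "Module.submodule (N \<inter> N') R M"
proof -
  interpret lmodule R M by fact
  show ?thesis
    by (rule submoduleI) (use submoduleD[OF assms(2)] submoduleD[OF assms(3)] in auto)
qed

text \<open>The family \<open>H\<close> embeds \<open>V\<close> into a finite power of
  \<open>W\<close>; the power itself is avoided by induction on \<open>H\<close>. For one more map
  \<open>h\<close>, generators of a submodule \<open>U\<close> are lifts of generators of
  \<open>h U\<close> together with those obtained for the part of \<open>U\<close> in the kernel of
  \<open>h\<close>.\<close>

lemma noetherian_joint_inj:
  assumes V: "lmodule R V" and W: "lmodule R W" "noetherian_lmodule R W"
    and H: "finite H" "H \<subseteq> module_hom R V W"
    and inj: "\<And>v. v \<in> carrier V \<Longrightarrow> \<forall>h\<in>H. h v = \<zero>\<^bsub>W\<^esub> \<Longrightarrow> v = \<zero>\<^bsub>V\<^esub>"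
  shows "noetherian_lmodule R V"
proof -
  interpret V: lmodule R V by fact
  \<comment> \<open>The claim is finite generation of \<open>U\<close> modulo the elements killed by
    all of \<open>H\<close>. Joint injectivity, which smaller families would not inherit, is used
    only at the end, where these elements reduce to zero.\<close>
  have *: "\<exists>F. finite F \<and> F \<subseteq> U \<and> (\<forall>N. Module.submodule N R V \<longrightarrow> F \<subseteq> N \<longrightarrow>
      {u \<in> U. \<forall>h\<in>H. h u = \<zero>\<^bsub>W\<^esub>} \<subseteq> N \<longrightarrow> U \<subseteq> N)" if "Module.submodule U R V" for U
    using H that
  proof (induction H arbitrary: U rule: finite_induct)
    case empty
    show ?case by (rule exI[of _ "{}"]) auto
  next
    case (insert h H)
    have h: "h \<in> module_hom R V W" using insert.prems by simp
    note U = insert.prems(2)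
    let ?U = "U \<inter> {u \<in> carrier V. h u = \<zero>\<^bsub>W\<^esub>}"
    have "Module.submodule ?U R V"
      by (rule submodule_Int[OF V U module_hom_kernel_submodule[OF V W(1) h]])
    then obtain F where F: "finite F" "F \<subseteq> ?U" "\<And>N. Module.submodule N R V \<Longrightarrow> F \<subseteq> N \<Longrightarrow>
      {u \<in> ?U. \<forall>h\<in>H. h u = \<zero>\<^bsub>W\<^esub>} \<subseteq> N \<Longrightarrow> ?U \<subseteq> N"
      using insert.IH[of ?U] insert.prems(1) by auto
    obtain F1 where F1: "finite F1" "generates R W F1 (h ` U)"
      using W(2) module_hom_image_submodule[OF V W(1) h U] by (auto simp: noetherian_lmodule_def)
    then obtain F0 where F0: "finite F0" "F0 \<subseteq> U" "h ` F0 = F1"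
      unfolding generates_def by (metis finite_subset_image)
    show ?case
    proof (intro exI conjI allI impI)
      show "finite (F \<union> F0)" "F \<union> F0 \<subseteq> U" using F(1,2) F0(1,2) by auto
      fix N assume N: "Module.submodule N R V" "F \<union> F0 \<subseteq> N"
        and ker: "{u \<in> U. \<forall>h\<in>insert h H. h u = \<zero>\<^bsub>W\<^esub>} \<subseteq> N"
      have UN: "?U \<subseteq> N" by (rule F(3)) (use N ker in auto)
      have "Module.submodule (h ` (U \<inter> N)) R W"
        by (rule module_hom_image_submodule[OF V W(1) h submodule_Int[OF V U N(1)]])
      moreover have "F1 \<subseteq> h ` (U \<inter> N)" using F0 N(2) by auto
      ultimately have hU: "h ` U \<subseteq> h ` (U \<inter> N)" using F1(2) unfolding generates_def by blast
      show "U \<subseteq> N"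
      proof
        fix u assume u: "u \<in> U"
        then obtain n where n: "n \<in> U" "n \<in> N" "h u = h n" using hU by auto
        have c: "u \<in> carrier V" "n \<in> carrier V" using u n submoduleD(1)[OF U] by auto
        have "u \<ominus>\<^bsub>V\<^esub> n \<in> U" using submoduleD(5)[OF U] u n by blast
        moreover have "h (u \<ominus>\<^bsub>V\<^esub> n) = \<zero>\<^bsub>W\<^esub>"
          using n c lmodule.axioms(2)[OF W(1)] module_homD(1)[OF h c(2)]
          by (simp add: lmodule_hom_diff[OF V W(1) h] abelian_group.diff_eq_zero_iff)
        ultimately have "u \<ominus>\<^bsub>V\<^esub> n \<in> N" using UN c by auto
        then have "(u \<ominus>\<^bsub>V\<^esub> n) \<oplus>\<^bsub>V\<^esub> n \<in> N" using submoduleD(3)[OF N(1)] n by blast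
        then show "u \<in> N" using c by (simp add: a_minus_def V.M.a_assoc V.M.l_neg)
      qed
    qed
  qed
  show ?thesis unfolding noetherian_lmodule_def
  proof (intro allI impI)
    fix U assume U: "Module.submodule U R V"
    from *[OF U] obtain F where F: "finite F" "F \<subseteq> U" "\<And>N. Module.submodule N R V \<Longrightarrow> F \<subseteq> N \<Longrightarrow>
      {u \<in> U. \<forall>h\<in>H. h u = \<zero>\<^bsub>W\<^esub>} \<subseteq> N \<Longrightarrow> U \<subseteq> N" by blast
    have "U \<subseteq> N" if "Module.submodule N R V" "F \<subseteq> N" for N
      by (rule F(3)[OF that]) (use inj submoduleD(1)[OF U] submoduleD(2)[OF that(1)] in auto)
    then show "\<exists>F. finite F \<and> generates R V F U" using F by (auto simp: generates_def)
  qed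
qed

lemma noetherian_surj:
  assumes V: "lmodule R V" "noetherian_lmodule R V" and W: "lmodule R W"
    and f: "f \<in> module_hom R V W" "f ` carrier V = carrier W"
  shows "noetherian_lmodule R W"
  unfolding noetherian_lmodule_def
proof (intro allI impI)
  interpret V: lmodule R V by fact
  note fD = module_homD[OF f(1)]
  have pre: "Module.submodule {v \<in> carrier V. f v \<in> N} R V" if "Module.submodule N R W" for N
    by (rule V.submoduleI)
      (use fD submoduleD[OF that] lmodule_hom_zero[OF V(1) W f(1)] V.smult_closed in auto)
  fix N assume N: "Module.submodule N R W"
  obtain F where F: "finite F" "generates R V F {v \<in> carrier V. f v \<in> N}"
    using V(2) pre[OF N] by (auto simp: noetherian_lmodule_def)
  have "N \<subseteq> N'" if N': "Module.submodule N' R W" "f ` F \<subseteq> N'" for N'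
  proof
    fix y assume y: "y \<in> N"
    then obtain v where v: "v \<in> carrier V" "y = f v" using f(2) submoduleD(1)[OF N] by blast
    have "F \<subseteq> {v \<in> carrier V. f v \<in> N'}" using N'(2) F(2) by (auto simp: generates_def)
    then have "{v \<in> carrier V. f v \<in> N} \<subseteq> {v \<in> carrier V. f v \<in> N'}"
      using F(2) pre[OF N'(1)] unfolding generates_def by blast
    then show "y \<in> N'" using v y by auto
  qed
  then show "\<exists>F. finite F \<and> generates R W F N"
    using F by (intro exI[of _ "f ` F"]) (auto simp: generates_def)
qed

section \<open>Finite dimension as a Noetherian condition\<close>

lemma vectorspace_lmodule:
  fixes V :: "('k, 'v) module"
  assumes "vectorspace K V"
  shows "lmodule K V"
proof -
  interpret vectorspace K V by fact
  show ?thesis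
    by (rule lmoduleI)
      (auto simp: smult_l_distr smult_r_distr smult_assoc1 ring_axioms abelian_group_axioms)
qed

lemma lmodule_vectorspace:
  fixes V :: "('k, 'v) module"
  assumes "field K" "lmodule K V"
  shows "vectorspace K V"
proof -
  interpret field K by fact
  interpret lmodule K V by fact
  have "module K V"
    by (rule moduleI)
      (auto simp: smult_l_distr smult_r_distr smult_assoc smult_one smult_closed is_cring
        M.abelian_group_axioms)
  then show ?thesis using assms(1) by (simp add: vectorspace_def)
qed

lemma submodule_iff:
  fixes V :: "('k, 'v) module"
  assumes "vectorspace K V"
  shows "LinearCombinations.submodule K N V \<longleftrightarrow> Module.submodule N K V"
proof -
  interpret V: vectorspace K V by fact
  show ?thesis
  proof
    assume "LinearCombinations.submodule K N V"
    then interpret N: LinearCombinations.submodule K N V .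
    show "Module.submodule N K V"
      by (rule lmodule.submoduleI[OF vectorspace_lmodule[OF assms]])
        (use N.subset N.m_closed N.zero_closed N.smult_closed in auto)
  next
    assume N: "Module.submodule N K V"
    show "LinearCombinations.submodule K N V"
      by (rule LinearCombinations.submodule.intro)
        (use submoduleD[OF N] V.module_axioms in auto)
  qed
qed

text \<open>Among the linearly independent subsets of a subspace \<open>N\<close> there is a maximal
  one, because their sizes are bounded by the dimension, and by maximality it spans
  \<open>N\<close>. For the converse, generators of the whole space suffice.\<close>

lemma fin_dim_iff_noetherian:
  fixes V :: "('k, 'v) module"
  assumes "vectorspace K V"
  shows "vectorspace.fin_dim K V \<longleftrightarrow> noetherian_lmodule K V"
proof
  interpret V: vectorspace K V by fact
  note iff = submodule_iff[OF assms]
  show "noetherian_lmodule K V" if fd: "V.fin_dim"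
    unfolding noetherian_lmodule_def
  proof (intro allI impI)
    fix N assume N: "Module.submodule N K V"
    note ND = submoduleD[OF N]
    have "\<exists>L. finite L \<and> maximal L (\<lambda>L. L \<subseteq> N \<and> V.lin_indpt L)"
    proof (rule maximal_exists)
      show "{} \<subseteq> N \<and> V.lin_indpt {}" by (auto simp: V.lin_dep_def)
    next
      fix L assume "L \<subseteq> N \<and> V.lin_indpt L"
      then show "finite L \<and> card L \<le> V.dim" using V.li_le_dim[OF fd, of L] ND(1) by auto
    qed
    then obtain L where fin: "finite L" and max: "maximal L (\<lambda>L. L \<subseteq> N \<and> V.lin_indpt L)"
      by (elim exE conjE)
    have L: "L \<subseteq> N" "V.lin_indpt L" using max by (simp_all add: maximal_def)
    have "N \<subseteq> N'" if N': "Module.submodule N' K V" "L \<subseteq> N'" for N'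
    proof
      fix w assume w: "w \<in> N"
      have "w \<in> V.span L" if "w \<notin> L"
      proof -
        have "V.lin_dep (L \<union> {w})"
          using max[unfolded maximal_def, THEN conjunct2, rule_format, of "L \<union> {w}"] w L(1) that
          by auto
        then show ?thesis using V.lin_dep_iff_in_span[of L w] L ND(1) w that by auto
      qed
      moreover have "V.span L \<subseteq> N'" by (rule V.span_is_subset[OF N'(2)]) (simp add: iff N'(1))
      ultimately show "w \<in> N'" using N'(2) by blast
    qed
    then show "\<exists>F. finite F \<and> generates K V F N" using fin L(1) by (auto simp: generates_def)
  qed
  show "V.fin_dim" if n: "noetherian_lmodule K V"
  proof -
    obtain F where F: "finite F" "generates K V F (carrier V)"
      using n submodule_self[OF vectorspace_lmodule[OF assms]] by (auto simp: noetherian_lmodule_def)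
    then have FV: "F \<subseteq> carrier V" by (simp add: generates_def)
    have "Module.submodule (V.span F) K V" using V.span_is_submodule[OF FV] iff by simp
    then have "carrier V \<subseteq> V.span F"
      using F(2) V.in_own_span[OF FV] by (simp add: generates_def)
    then have "V.span F = carrier V" using V.span_is_subset2[OF FV] by blast
    then show ?thesis unfolding V.fin_dim_def using F(1) FV by blast
  qed
qed

section \<open>Finite dimensional simple modules over an algebra\<close>

text \<open>This is the action of \<open>K\<close> that \<open>hom_scale\<close> uses on
  homomorphisms; with it every \<open>A\<close>-homomorphism is \<open>K\<close>-linear.\<close>

definition base_space :: "('k, 'a) module \<Rightarrow> ('a, 'm) module \<Rightarrow> ('k, 'm) module" where
  "base_space A M = restrict_scalars (\<lambda>c. c \<odot>\<^bsub>A\<^esub> \<one>\<^bsub>A\<^esub>) M"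

lemma base_space_simps [simp]:
  "carrier (base_space A M) = carrier M" "\<zero>\<^bsub>base_space A M\<^esub> = \<zero>\<^bsub>M\<^esub>"
  "x \<oplus>\<^bsub>base_space A M\<^esub> y = x \<oplus>\<^bsub>M\<^esub> y" "c \<odot>\<^bsub>base_space A M\<^esub> x = (c \<odot>\<^bsub>A\<^esub> \<one>\<^bsub>A\<^esub>) \<odot>\<^bsub>M\<^esub> x"
  by (simp_all add: base_space_def)

lemma
  fixes A :: "('k, 'a) module"
  assumes "k_algebra K A"
  shows k_algebra_field: "field K"
    and k_algebra_ring: "ring A"
    and k_algebra_vectorspace: "vectorspace K A"
    and k_algebra_scalar_closed: "c \<in> carrier K \<Longrightarrow> c \<odot>\<^bsub>A\<^esub> \<one>\<^bsub>A\<^esub> \<in> carrier A"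
    and k_algebra_scalar_mult: "c \<in> carrier K \<Longrightarrow> a \<in> carrier A \<Longrightarrow> (c \<odot>\<^bsub>A\<^esub> \<one>\<^bsub>A\<^esub>) \<otimes>\<^bsub>A\<^esub> a = c \<odot>\<^bsub>A\<^esub> a"
    and k_algebra_mult_scalar: "c \<in> carrier K \<Longrightarrow> a \<in> carrier A \<Longrightarrow> a \<otimes>\<^bsub>A\<^esub> (c \<odot>\<^bsub>A\<^esub> \<one>\<^bsub>A\<^esub>) = c \<odot>\<^bsub>A\<^esub> a"
    and k_algebra_scalar_hom: "(\<lambda>c. c \<odot>\<^bsub>A\<^esub> \<one>\<^bsub>A\<^esub>) \<in> ring_hom K A"
proof -
  interpret A: k_algebra K A by fact
  interpret V: lmodule K A
    by (rule vectorspace_lmodule[OF A.vectorspace_axioms])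
  show "field K" "ring A" "vectorspace K A" by unfold_locales
  show c: "c \<in> carrier K \<Longrightarrow> c \<odot>\<^bsub>A\<^esub> \<one>\<^bsub>A\<^esub> \<in> carrier A" for c
    using V.smult_closed A.A.one_closed by blast
  show m: "c \<in> carrier K \<Longrightarrow> a \<in> carrier A \<Longrightarrow> (c \<odot>\<^bsub>A\<^esub> \<one>\<^bsub>A\<^esub>) \<otimes>\<^bsub>A\<^esub> a = c \<odot>\<^bsub>A\<^esub> a" for c a
    by (simp add: A.smult_mult_left)
  show "c \<in> carrier K \<Longrightarrow> a \<in> carrier A \<Longrightarrow> a \<otimes>\<^bsub>A\<^esub> (c \<odot>\<^bsub>A\<^esub> \<one>\<^bsub>A\<^esub>) = c \<odot>\<^bsub>A\<^esub> a"
    by (simp add: A.smult_mult_right)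
  show "(\<lambda>c. c \<odot>\<^bsub>A\<^esub> \<one>\<^bsub>A\<^esub>) \<in> ring_hom K A"
    by (rule ring_hom_memI) (auto simp: c m V.smult_l_distr V.smult_assoc V.smult_one)
qed

lemma base_space_lmodule:
  assumes "k_algebra K A" "lmodule A M"
  shows "lmodule K (base_space A M)"
  unfolding base_space_def
  by (rule restrict_scalars_lmodule[OF _ k_algebra_scalar_hom[OF assms(1)] assms(2)])
    (use k_algebra_field[OF assms(1)] in \<open>simp add: field_def domain_def cring_def\<close>)

lemma module_hom_base_space:
  assumes "k_algebra K A" "f \<in> module_hom A M N"
  shows "f \<in> module_hom K (base_space A M) (base_space A N)"
  by (rule module_homI)
    (simp_all add: module_homD[OF assms(2)] k_algebra_scalar_closed[OF assms(1)])

lemma module_hom_eval_base_space: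
  assumes "k_algebra K A" "lmodule A M" "x \<in> carrier M"
  shows "(\<lambda>a. a \<odot>\<^bsub>M\<^esub> x) \<in> module_hom K A (base_space A M)"
proof -
  interpret lmodule A M by fact
  show ?thesis
  proof (rule module_homI)
    fix c a assume "c \<in> carrier K" "a \<in> carrier A"
    then show "(c \<odot>\<^bsub>A\<^esub> a) \<odot>\<^bsub>M\<^esub> x = c \<odot>\<^bsub>base_space A M\<^esub> (a \<odot>\<^bsub>M\<^esub> x)"
      using k_algebra_scalar_mult[OF assms(1), symmetric, of c a] assms(3)
      by (simp add: smult_assoc k_algebra_scalar_closed[OF assms(1)])
  qed (use assms(3) in \<open>auto simp: smult_closed smult_l_distr\<close>)
qed

text \<open>For \<open>F\<close> one takes generators over \<open>K\<close>. The elements killed by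
  \<open>a\<close> form a \<open>K\<close>-subspace, though in general not an
  \<open>A\<close>-submodule; if they include \<open>F\<close>, they are everything.\<close>

lemma noetherian_finitely_faithful:
  assumes "k_algebra K A" "lmodule A M" "noetherian_lmodule K (base_space A M)"
  shows "finitely_faithful A M"
proof -
  interpret lmodule A M by fact
  note lm = base_space_lmodule[OF assms(1,2)]
  obtain F where F: "finite F" "generates K (base_space A M) F (carrier M)"
    using assms(3) submodule_self[OF lm] by (auto simp: noetherian_lmodule_def)
  have "a \<in> annihilator A M" if a: "a \<in> carrier A" and aF: "\<forall>x\<in>F. a \<odot>\<^bsub>M\<^esub> x = \<zero>\<^bsub>M\<^esub>" for a
  proof -
    let ?N = "{x \<in> carrier M. a \<odot>\<^bsub>M\<^esub> x = \<zero>\<^bsub>M\<^esub>}"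
    have "Module.submodule ?N K (base_space A M)"
    proof (rule lmodule.submoduleI[OF lm])
      fix c x assume c: "c \<in> carrier K" and x: "x \<in> ?N"
      note cA = k_algebra_scalar_closed[OF assms(1) c]
      \<comment> \<open>The scalar \<open>c 1\<close> is central in \<open>A\<close>, so it can be
        moved past \<open>a\<close>.\<close>
      have "a \<odot>\<^bsub>M\<^esub> ((c \<odot>\<^bsub>A\<^esub> \<one>\<^bsub>A\<^esub>) \<odot>\<^bsub>M\<^esub> x) = (c \<odot>\<^bsub>A\<^esub> \<one>\<^bsub>A\<^esub>) \<odot>\<^bsub>M\<^esub> (a \<odot>\<^bsub>M\<^esub> x)"
        using smult_assoc[OF a cA, of x] smult_assoc[OF cA a, of x] x
          k_algebra_scalar_mult[OF assms(1) c a] k_algebra_mult_scalar[OF assms(1) c a] by simp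
      then show "c \<odot>\<^bsub>base_space A M\<^esub> x \<in> ?N" using x cA by (simp add: smult_closed)
    qed (use a in \<open>auto simp: smult_r_distr\<close>)
    then have "carrier M \<subseteq> ?N" using F(2) aF unfolding generates_def by blast
    then show ?thesis using a by (auto simp: annihilator_def)
  qed
  then show ?thesis using F unfolding finitely_faithful_def generates_def by blast
qed

lemma
  assumes "k_algebra K A" "ideal I A"
  shows quot_algebra_lmodule: "lmodule K (quot_algebra A I)"
    and quot_algebra_proj: "(\<lambda>a. I +>\<^bsub>A\<^esub> a) \<in> module_hom K A (quot_algebra A I)"
    and quot_algebra_surj: "(\<lambda>a. I +>\<^bsub>A\<^esub> a) ` carrier A = carrier (quot_algebra A I)"
    and quot_algebra_zero: "a \<in> carrier A \<Longrightarrow> I +>\<^bsub>A\<^esub> a = \<zero>\<^bsub>quot_algebra A I\<^esub> \<longleftrightarrow> a \<in> I"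
proof -
  interpret ideal I A by fact
  note V = vectorspace_lmodule[OF k_algebra_vectorspace[OF assms(1)]]
  interpret V: lmodule K A by (rule V)
  note eq = quotient_eq_iff_same_a_r_cos[OF assms(2)]
  show carr: "(\<lambda>a. I +>\<^bsub>A\<^esub> a) ` carrier A = carrier (quot_algebra A I)"
    by (auto simp: quot_algebra_def FactRing_simps)
  have zero: "\<zero>\<^bsub>quot_algebra A I\<^esub> = I +>\<^bsub>A\<^esub> \<zero>\<^bsub>A\<^esub>"
    using a_rcos_zero[OF assms(2), of "\<zero>\<^bsub>A\<^esub>"] zero_closed by (simp add: quot_algebra_def FactRing_def)
  have add: "(I +>\<^bsub>A\<^esub> x) \<oplus>\<^bsub>quot_algebra A I\<^esub> (I +>\<^bsub>A\<^esub> y) = I +>\<^bsub>A\<^esub> (x \<oplus>\<^bsub>A\<^esub> y)"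
    if "x \<in> carrier A" "y \<in> carrier A" for x y
    using that by (simp add: quot_algebra_def FactRing_def a_rcos_sum)
  have smult: "c \<odot>\<^bsub>quot_algebra A I\<^esub> (I +>\<^bsub>A\<^esub> x) = I +>\<^bsub>A\<^esub> (c \<odot>\<^bsub>A\<^esub> x)"
    if c: "c \<in> carrier K" and x: "x \<in> carrier A" for c x
  proof -
    \<comment> \<open>Scalar multiplication on the quotient is a union over all members
      \<open>y\<close> of the coset. Its terms agree: if \<open>y - x\<close> is in
      \<open>I\<close>, so is \<open>c y - c x = (c 1)(y - x)\<close>.\<close>
    have "I +>\<^bsub>A\<^esub> (c \<odot>\<^bsub>A\<^esub> y) = I +>\<^bsub>A\<^esub> (c \<odot>\<^bsub>A\<^esub> x)" if yx: "y \<in> I +>\<^bsub>A\<^esub> x" for y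
    proof -
      obtain i where i: "i \<in> I" "y = i \<oplus>\<^bsub>A\<^esub> x" using yx by (auto simp: a_r_coset_def')
      then have y: "y \<in> carrier A" "y \<ominus>\<^bsub>A\<^esub> x = i"
        using x Icarr[OF i(1)] by (auto simp: a_minus_def a_assoc r_neg)
      have "c \<odot>\<^bsub>A\<^esub> y \<ominus>\<^bsub>A\<^esub> c \<odot>\<^bsub>A\<^esub> x = c \<odot>\<^bsub>A\<^esub> i"
        using V.smult_diff_right[OF c y(1) x] y by simp
      also have "\<dots> = (c \<odot>\<^bsub>A\<^esub> \<one>\<^bsub>A\<^esub>) \<otimes>\<^bsub>A\<^esub> i"
        using k_algebra_scalar_mult[OF assms(1) c] Icarr[OF i(1)] by simp
      finally have "c \<odot>\<^bsub>A\<^esub> y \<ominus>\<^bsub>A\<^esub> c \<odot>\<^bsub>A\<^esub> x \<in> I"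
        using I_l_closed[OF i(1)] k_algebra_scalar_closed[OF assms(1) c] by simp
      then show ?thesis using eq c x y by (simp add: V.smult_closed)
    qed
    then have "(\<Union>y\<in>I +>\<^bsub>A\<^esub> x. I +>\<^bsub>A\<^esub> (c \<odot>\<^bsub>A\<^esub> y)) = (\<Union>y\<in>I +>\<^bsub>A\<^esub> x. I +>\<^bsub>A\<^esub> (c \<odot>\<^bsub>A\<^esub> x))"
      by (rule SUP_cong[OF refl])
    moreover have "I +>\<^bsub>A\<^esub> x \<noteq> {}" using a_rcos_self[OF x] by blast
    ultimately show ?thesis by (simp add: quot_algebra_def)
  qed
  show "lmodule K (quot_algebra A I)" "(\<lambda>a. I +>\<^bsub>A\<^esub> a) \<in> module_hom K A (quot_algebra A I)"
    using lmodule_hom_image[OF V carr[symmetric] zero] add smult by auto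
  show "a \<in> carrier A \<Longrightarrow> I +>\<^bsub>A\<^esub> a = \<zero>\<^bsub>quot_algebra A I\<^esub> \<longleftrightarrow> a \<in> I"
    using eq[of a "\<zero>\<^bsub>A\<^esub>"] by (simp add: zero diff_zero_right)
qed

text \<open>For nonzero \<open>x\<close> the map \<open>a \<mapsto> a x\<close> is onto by
  simplicity and kills \<open>I\<close>, so the simple module is a quotient of the finite
  dimensional \<open>A / I\<close>.\<close>

lemma cfs_simple_at_noetherian:
  assumes A: "k_algebra K A" and I: "I \<in> cfs K A"
  shows "noetherian_lmodule K (base_space A (simple_at A I))"
proof -
  let ?S = "simple_at A I" and ?Q = "quot_algebra A I"
  have max: "maximalideal I A" and fd: "vectorspace.fin_dim K ?Q" using I by (auto simp: cfs_def)
  note ideal = maximalideal.axioms(1)[OF max]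
  note Q = quot_algebra_lmodule[OF A ideal]
  note S = simple_at_simple[OF max]
  note lm = simple_lmoduleD(1)[OF S]
  note V = vectorspace_lmodule[OF k_algebra_vectorspace[OF A]]
  interpret S: lmodule A ?S by (rule lm)
  have n: "noetherian_lmodule K ?Q"
    using fd fin_dim_iff_noetherian lmodule_vectorspace[OF k_algebra_field[OF A] Q] by blast
  obtain x where x: "x \<in> carrier ?S" "x \<noteq> \<zero>\<^bsub>?S\<^esub>" using S by (rule simple_lmodule_nonzero)
  obtain g where g: "g \<in> module_hom K ?Q (base_space A ?S)"
    "\<And>a. a \<in> carrier A \<Longrightarrow> g (I +>\<^bsub>A\<^esub> a) = a \<odot>\<^bsub>?S\<^esub> x"
  proof (rule module_hom_factor[OF V Q base_space_lmodule[OF A lm] quot_algebra_proj[OF A ideal]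
        quot_algebra_surj[OF A ideal] module_hom_eval_base_space[OF A lm x(1)]])
    fix a assume "a \<in> carrier A" "I +>\<^bsub>A\<^esub> a = \<zero>\<^bsub>?Q\<^esub>"
    then have "a \<in> annihilator A ?S"
      using quot_algebra_zero[OF A ideal] simple_at_annihilator[OF max] by blast
    then show "a \<odot>\<^bsub>?S\<^esub> x = \<zero>\<^bsub>base_space A ?S\<^esub>" using x by (simp add: annihilator_def)
  qed blast
  have "(\<lambda>a. a \<odot>\<^bsub>?S\<^esub> x) ` carrier A = carrier ?S"
    by (rule simple_lmodule_hom_surj[OF S regular_lmodule[OF S.R.ring_axioms] module_hom_eval[OF lm x(1)],
        of _ "\<one>\<^bsub>A\<^esub>"])
      (use submodule_self[OF regular_lmodule[OF S.R.ring_axioms]] x S.smult_one in auto)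
  then have "g ` carrier ?Q = carrier ?S"
    unfolding quot_algebra_surj[OF A ideal, symmetric] image_image using g(2) by (simp cong: image_cong_simp)
  then show ?thesis
    using noetherian_surj[OF Q n base_space_lmodule[OF A lm] g(1)] by simp
qed

text \<open>Maximality is \<open>annihilator_maximalideal\<close>. For finite dimension, the maps
  \<open>a \<mapsto> a x\<close>, with \<open>x\<close> in a finite set \<open>F\<close> detecting
  the annihilator, embed the quotient algebra into a power of \<open>S\<close>.\<close>

lemma annihilator_cfs:
  assumes A: "k_algebra K A" and S: "simple_lmodule A S" "noetherian_lmodule K (base_space A S)"
  shows "annihilator A S \<in> cfs K A"
proof -
  let ?I = "annihilator A S"
  let ?Q = "quot_algebra A ?I"
  note lm = simple_lmoduleD(1)[OF S(1)]
  note ff = noetherian_finitely_faithful[OF A lm S(2)]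
  have max: "maximalideal ?I A" by (rule annihilator_maximalideal[OF S(1) ff])
  note ideal = maximalideal.axioms(1)[OF max]
  note Q = quot_algebra_lmodule[OF A ideal]
  note V = vectorspace_lmodule[OF k_algebra_vectorspace[OF A]]
  obtain F where F: "finite F" "F \<subseteq> carrier S"
    "\<And>a. a \<in> carrier A \<Longrightarrow> \<forall>x\<in>F. a \<odot>\<^bsub>S\<^esub> x = \<zero>\<^bsub>S\<^esub> \<Longrightarrow> a \<in> ?I"
    using ff by (auto simp: finitely_faithful_def)
  have "\<exists>g. g \<in> module_hom K ?Q (base_space A S) \<and> (\<forall>a\<in>carrier A. g (?I +>\<^bsub>A\<^esub> a) = a \<odot>\<^bsub>S\<^esub> x)"
    if x: "x \<in> F" for x
  proof -
    have xS: "x \<in> carrier S" using x F(2) by blast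
    obtain g where "g \<in> module_hom K ?Q (base_space A S)"
      "\<And>a. a \<in> carrier A \<Longrightarrow> g (?I +>\<^bsub>A\<^esub> a) = a \<odot>\<^bsub>S\<^esub> x"
    proof (rule module_hom_factor[OF V Q base_space_lmodule[OF A lm] quot_algebra_proj[OF A ideal]
          quot_algebra_surj[OF A ideal] module_hom_eval_base_space[OF A lm xS]])
      fix a assume "a \<in> carrier A" "?I +>\<^bsub>A\<^esub> a = \<zero>\<^bsub>?Q\<^esub>"
      then have "a \<in> ?I" using quot_algebra_zero[OF A ideal] by blast
      then show "a \<odot>\<^bsub>S\<^esub> x = \<zero>\<^bsub>base_space A S\<^esub>" using xS by (simp add: annihilator_def)
    qed blast
    then show ?thesis by blast
  qed
  then obtain g where g: "\<And>x. x \<in> F \<Longrightarrow> g x \<in> module_hom K ?Q (base_space A S)"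
    "\<And>x a. x \<in> F \<Longrightarrow> a \<in> carrier A \<Longrightarrow> g x (?I +>\<^bsub>A\<^esub> a) = a \<odot>\<^bsub>S\<^esub> x" by metis
  have "noetherian_lmodule K ?Q"
  proof (rule noetherian_joint_inj[OF Q base_space_lmodule[OF A lm] S(2)])
    show "finite (g ` F)" "g ` F \<subseteq> module_hom K ?Q (base_space A S)" using F(1) g(1) by auto
    fix v assume v: "v \<in> carrier ?Q" "\<forall>h\<in>g ` F. h v = \<zero>\<^bsub>base_space A S\<^esub>"
    obtain a where a: "a \<in> carrier A" "v = ?I +>\<^bsub>A\<^esub> a"
      using v(1) quot_algebra_surj[OF A ideal] by blast
    have "\<forall>x\<in>F. a \<odot>\<^bsub>S\<^esub> x = \<zero>\<^bsub>S\<^esub>" using v(2) g(2) a by simp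
    then have "a \<in> ?I" by (rule F(3)[OF a(1)])
    then show "v = \<zero>\<^bsub>?Q\<^esub>" using quot_algebra_zero[OF A ideal a(1)] a(2) by simp
  qed
  then show ?thesis
    using max fin_dim_iff_noetherian[OF lmodule_vectorspace[OF k_algebra_field[OF A] Q]]
    by (simp add: cfs_def)
qed

section \<open>Free modules\<close>

lemma free_lmodule_simps:
  assumes "ring R"
  shows "carrier (free_lmodule R Z) = {f \<in> Z \<rightarrow>\<^sub>E carrier R. finite {z \<in> Z. f z \<noteq> \<zero>\<^bsub>R\<^esub>}}"
    and "\<zero>\<^bsub>free_lmodule R Z\<^esub> = (\<lambda>z\<in>Z. \<zero>\<^bsub>R\<^esub>)"
    and "f \<oplus>\<^bsub>free_lmodule R Z\<^esub> g = (\<lambda>z\<in>Z. f z \<oplus>\<^bsub>R\<^esub> g z)"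
    and "a \<odot>\<^bsub>free_lmodule R Z\<^esub> f = (\<lambda>z\<in>Z. a \<otimes>\<^bsub>R\<^esub> f z)"
  by (simp_all add: free_lmodule_def ring.func_space_def[OF assms])

lemma free_lmodule_lmodule:
  fixes R :: "('a, 'x) ring_scheme" and Z :: "'z set"
  assumes "ring R"
  shows "lmodule R (free_lmodule R Z)"
proof -
  interpret ring R by fact
  note [simp] = free_lmodule_simps[OF assms]
  let ?P = "free_lmodule R Z"
  \<comment> \<open>One fact serves sums, multiples and negatives: a pointwise operation
    \<open>h\<close> sending zeros to zero has its support inside the union of the two
    supports.\<close>
  have fin: "finite {z \<in> Z. h (f z) (g z) \<noteq> \<zero>\<^bsub>R\<^esub>}"
    if "finite {z \<in> Z. f z \<noteq> \<zero>\<^bsub>R\<^esub>}" "finite {z \<in> Z. g z \<noteq> \<zero>\<^bsub>R\<^esub>}" "h \<zero>\<^bsub>R\<^esub> \<zero>\<^bsub>R\<^esub> = \<zero>\<^bsub>R\<^esub>"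
    for f g :: "'z \<Rightarrow> 'a" and h
    by (rule finite_subset[OF _ finite_UnI[OF that(1,2)]]) (use that(3) in auto)
  have add: "(\<lambda>z\<in>Z. f z \<oplus>\<^bsub>R\<^esub> g z) \<in> carrier ?P" if "f \<in> carrier ?P" "g \<in> carrier ?P" for f g
    using that fin[of f g "\<lambda>x y. x \<oplus>\<^bsub>R\<^esub> y"] by (auto simp: PiE_iff cong: conj_cong)
  have smult: "(\<lambda>z\<in>Z. a \<otimes>\<^bsub>R\<^esub> f z) \<in> carrier ?P" if "a \<in> carrier R" "f \<in> carrier ?P" for a f
    using that fin[of f f "\<lambda>x y. a \<otimes>\<^bsub>R\<^esub> x"] by (auto simp: PiE_iff cong: conj_cong)
  have neg: "(\<lambda>z\<in>Z. \<ominus>\<^bsub>R\<^esub> f z) \<in> carrier ?P" if "f \<in> carrier ?P" for f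
    using that fin[of f f "\<lambda>x y. \<ominus>\<^bsub>R\<^esub> x"] by (auto simp: PiE_iff cong: conj_cong)
  have mem: "f z \<in> carrier R" if "f \<in> carrier ?P" "z \<in> Z" for f z using that by (auto simp: PiE_iff)
  have ext: "(\<lambda>z\<in>Z. f z) = f" if "f \<in> carrier ?P" for f using that by (auto simp: PiE_iff extensional_restrict)
  note [simp del] = free_lmodule_simps(1)[OF assms]
  have "abelian_group ?P"
  proof (rule abelian_groupI)
    show "\<zero>\<^bsub>?P\<^esub> \<in> carrier ?P" by (simp add: free_lmodule_simps(1)[OF assms] cong: conj_cong)
    fix f assume f: "f \<in> carrier ?P"
    show "\<zero>\<^bsub>?P\<^esub> \<oplus>\<^bsub>?P\<^esub> f = f"
      using f ext[OF f] by (simp add: mem cong: restrict_cong)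
    have "(\<lambda>z\<in>Z. \<ominus>\<^bsub>R\<^esub> f z) \<oplus>\<^bsub>?P\<^esub> f = \<zero>\<^bsub>?P\<^esub>"
      using f by (simp add: mem l_neg cong: restrict_cong)
    then show "\<exists>g\<in>carrier ?P. g \<oplus>\<^bsub>?P\<^esub> f = \<zero>\<^bsub>?P\<^esub>" using neg[OF f] by blast
  qed (simp_all add: add mem a_ac cong: restrict_cong)
  then show ?thesis
    using assms ext
    by (intro lmoduleI) (simp_all add: smult mem l_distr r_distr m_assoc cong: restrict_cong)
qed

section \<open>Maps out of free modules\<close>

definition free_basis :: "('a, 'x) ring_scheme \<Rightarrow> 'z set \<Rightarrow> 'z \<Rightarrow> 'z \<Rightarrow> 'a" where
  "free_basis R Z z = (\<lambda>y\<in>Z. if y = z then \<one>\<^bsub>R\<^esub> else \<zero>\<^bsub>R\<^esub>)"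

text \<open>On the free module this is the linear map with value \<open>\<sigma> z\<close> at the
  basis element of \<open>z\<close>. The maps \<open>free_map\<close> of the resolution are the case
  where \<open>\<sigma>\<close> is the identity; the general case supplies lifts.\<close>

definition free_extension ::
    "('a, 'x) ring_scheme \<Rightarrow> ('a, 'm) module \<Rightarrow> 'z set \<Rightarrow> ('z \<Rightarrow> 'm) \<Rightarrow> ('z \<Rightarrow> 'a) \<Rightarrow> 'm" where
  "free_extension R M Z \<sigma> f = (\<Oplus>\<^bsub>M\<^esub>z\<in>{z \<in> Z. f z \<noteq> \<zero>\<^bsub>R\<^esub>}. f z \<odot>\<^bsub>M\<^esub> \<sigma> z)"

lemma free_basis_closed:
  assumes "ring R"
  shows "free_basis R Z z \<in> carrier (free_lmodule R Z)"
proof -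
  interpret ring R by fact
  have "finite {y \<in> Z. free_basis R Z z y \<noteq> \<zero>\<^bsub>R\<^esub>}"
    by (rule finite_subset[of _ "{z}"]) (auto simp: free_basis_def)
  then show ?thesis by (auto simp: free_lmodule_simps[OF assms] free_basis_def)
qed

text \<open>The supports of \<open>f\<close>, \<open>g\<close> and their sum differ, so additivity
  can be checked only after the three sums are taken over a common finite index set.\<close>

lemma free_extension_superset:
  assumes "lmodule R M" "\<sigma> \<in> Z \<rightarrow> carrier M" "f \<in> Z \<rightarrow> carrier R"
    and "finite F" "F \<subseteq> Z" "{z \<in> Z. f z \<noteq> \<zero>\<^bsub>R\<^esub>} \<subseteq> F"
  shows "free_extension R M Z \<sigma> f = (\<Oplus>\<^bsub>M\<^esub>z\<in>F. f z \<odot>\<^bsub>M\<^esub> \<sigma> z)"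
proof -
  interpret lmodule R M by fact
  have \<sigma>: "\<sigma> z \<in> carrier M" "f z \<in> carrier R" if "z \<in> F" for z using that assms by auto
  show ?thesis unfolding free_extension_def
    by (rule M.add.finprod_mono_neutral_cong_left) (use assms(4-6) \<sigma> in \<open>auto simp: smult_closed\<close>)
qed

lemma free_extension_hom:
  fixes R :: "('a, 'x) ring_scheme" and M :: "('a, 'm) module"
  assumes "lmodule R M" "\<sigma> \<in> Z \<rightarrow> carrier M"
  shows "free_extension R M Z \<sigma> \<in> module_hom R (free_lmodule R Z) M"
proof -
  interpret lmodule R M by fact
  note P = free_lmodule_lmodule[OF R.ring_axioms, of Z]
  interpret P: lmodule R "free_lmodule R Z" by (rule P)
  note simps = free_lmodule_simps[OF R.ring_axioms]
  note sup = free_extension_superset[OF assms]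
  have D: "f \<in> Z \<rightarrow> carrier R" "finite {z \<in> Z. f z \<noteq> \<zero>\<^bsub>R\<^esub>}" if "f \<in> carrier (free_lmodule R Z)" for f
    using that by (auto simp: simps)
  show ?thesis
  proof (rule module_homI)
    fix f assume "f \<in> carrier (free_lmodule R Z)"
    note f = D[OF this]
    show "free_extension R M Z \<sigma> f \<in> carrier M"
      unfolding free_extension_def
      by (rule M.finsum_closed) (use assms(2) f(1) in \<open>auto intro!: smult_closed\<close>)
  next
    fix f g assume fg: "f \<in> carrier (free_lmodule R Z)" "g \<in> carrier (free_lmodule R Z)"
    note f = D[OF fg(1)] and g = D[OF fg(2)]
    note s = D[OF P.M.a_closed[OF fg]]
    let ?F = "{z \<in> Z. f z \<noteq> \<zero>\<^bsub>R\<^esub>} \<union> {z \<in> Z. g z \<noteq> \<zero>\<^bsub>R\<^esub>}"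
    have F: "finite ?F" "?F \<subseteq> Z" using f(2) g(2) by auto
    have c: "f z \<in> carrier R" "g z \<in> carrier R" "\<sigma> z \<in> carrier M" if "z \<in> ?F" for z
      using that f(1) g(1) assms(2) by auto
    have sF: "{z \<in> Z. (f \<oplus>\<^bsub>free_lmodule R Z\<^esub> g) z \<noteq> \<zero>\<^bsub>R\<^esub>} \<subseteq> ?F" by (auto simp: simps)
    have "free_extension R M Z \<sigma> (f \<oplus>\<^bsub>free_lmodule R Z\<^esub> g)
        = (\<Oplus>\<^bsub>M\<^esub>z\<in>?F. (f \<oplus>\<^bsub>free_lmodule R Z\<^esub> g) z \<odot>\<^bsub>M\<^esub> \<sigma> z)"
      by (rule sup[OF s(1) F sF])
    also have "\<dots> = (\<Oplus>\<^bsub>M\<^esub>z\<in>?F. f z \<odot>\<^bsub>M\<^esub> \<sigma> z \<oplus>\<^bsub>M\<^esub> g z \<odot>\<^bsub>M\<^esub> \<sigma> z)"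
      by (rule M.finsum_cong') (use c in \<open>auto simp: simps smult_l_distr smult_closed\<close>)
    also have "\<dots> = (\<Oplus>\<^bsub>M\<^esub>z\<in>?F. f z \<odot>\<^bsub>M\<^esub> \<sigma> z) \<oplus>\<^bsub>M\<^esub> (\<Oplus>\<^bsub>M\<^esub>z\<in>?F. g z \<odot>\<^bsub>M\<^esub> \<sigma> z)"
      by (rule M.finsum_addf) (use c in \<open>auto simp: smult_closed\<close>)
    also have "\<dots> = free_extension R M Z \<sigma> f \<oplus>\<^bsub>M\<^esub> free_extension R M Z \<sigma> g"
      using sup[OF f(1) F] sup[OF g(1) F] by simp
    finally show "free_extension R M Z \<sigma> (f \<oplus>\<^bsub>free_lmodule R Z\<^esub> g)
      = free_extension R M Z \<sigma> f \<oplus>\<^bsub>M\<^esub> free_extension R M Z \<sigma> g" .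
  next
    fix a f assume a: "a \<in> carrier R" and fP: "f \<in> carrier (free_lmodule R Z)"
    note f = D[OF fP]
    note s = D[OF P.smult_closed[OF a fP]]
    let ?F = "{z \<in> Z. f z \<noteq> \<zero>\<^bsub>R\<^esub>}"
    have c: "f z \<in> carrier R" "\<sigma> z \<in> carrier M" if "z \<in> ?F" for z
      using that f(1) assms(2) by auto
    have sF: "{z \<in> Z. (a \<odot>\<^bsub>free_lmodule R Z\<^esub> f) z \<noteq> \<zero>\<^bsub>R\<^esub>} \<subseteq> ?F" using a by (auto simp: simps)
    have "free_extension R M Z \<sigma> (a \<odot>\<^bsub>free_lmodule R Z\<^esub> f)
        = (\<Oplus>\<^bsub>M\<^esub>z\<in>?F. (a \<odot>\<^bsub>free_lmodule R Z\<^esub> f) z \<odot>\<^bsub>M\<^esub> \<sigma> z)"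
      by (rule sup[OF s(1) f(2) _ sF]) auto
    also have "\<dots> = (\<Oplus>\<^bsub>M\<^esub>z\<in>?F. a \<odot>\<^bsub>M\<^esub> (f z \<odot>\<^bsub>M\<^esub> \<sigma> z))"
      by (rule M.finsum_cong') (use c a in \<open>auto simp: simps smult_assoc smult_closed\<close>)
    also have "\<dots> = a \<odot>\<^bsub>M\<^esub> free_extension R M Z \<sigma> f"
      unfolding free_extension_def
      by (rule finsum_smult[OF f(2) a, symmetric]) (use c in \<open>auto simp: smult_closed\<close>)
    finally show "free_extension R M Z \<sigma> (a \<odot>\<^bsub>free_lmodule R Z\<^esub> f) = a \<odot>\<^bsub>M\<^esub> free_extension R M Z \<sigma> f" .
  qed
qed

lemma free_extension_basis:
  assumes "lmodule R M" "\<sigma> \<in> Z \<rightarrow> carrier M" "z \<in> Z"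
  shows "free_extension R M Z \<sigma> (free_basis R Z z) = \<sigma> z"
proof -
  interpret lmodule R M by fact
  have "free_basis R Z z \<in> Z \<rightarrow> carrier R" by (auto simp: free_basis_def)
  then have "free_extension R M Z \<sigma> (free_basis R Z z) = (\<Oplus>\<^bsub>M\<^esub>y\<in>{z}. free_basis R Z z y \<odot>\<^bsub>M\<^esub> \<sigma> y)"
    by (rule free_extension_superset[OF assms(1,2)])
      (use assms(3) in \<open>auto simp: free_basis_def split: if_splits\<close>)
  also have "\<dots> = \<sigma> z"
    using assms(2,3) by (auto simp: free_basis_def smult_one smult_closed Pi_iff)
  finally show ?thesis .
qed

lemma hom_free_extension:
  assumes "lmodule R M" "lmodule R N" "q \<in> module_hom R M N" "\<sigma> \<in> Z \<rightarrow> carrier M"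
    and "f \<in> carrier (free_lmodule R Z)"
  shows "q (free_extension R M Z \<sigma> f) = free_extension R N Z (\<lambda>z. q (\<sigma> z)) f"
proof -
  interpret M: lmodule R M by fact
  interpret N: lmodule R N by fact
  note qD = module_homD[OF assms(3)]
  have f: "finite {z \<in> Z. f z \<noteq> \<zero>\<^bsub>R\<^esub>}" "\<And>z. z \<in> Z \<Longrightarrow> f z \<in> carrier R"
    using assms(5) by (auto simp: free_lmodule_simps[OF M.R.ring_axioms])
  have \<sigma>: "\<And>z. z \<in> Z \<Longrightarrow> \<sigma> z \<in> carrier M" using assms(4) by auto
  have "q (free_extension R M Z \<sigma> f) = (\<Oplus>\<^bsub>N\<^esub>z\<in>{z \<in> Z. f z \<noteq> \<zero>\<^bsub>R\<^esub>}. q (f z \<odot>\<^bsub>M\<^esub> \<sigma> z))"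
    unfolding free_extension_def
    by (rule lmodule_hom_finsum[OF assms(1-3) f(1)]) (use f(2) \<sigma> M.smult_closed in auto)
  also have "\<dots> = free_extension R N Z (\<lambda>z. q (\<sigma> z)) f"
    unfolding free_extension_def
    by (rule N.M.finsum_cong') (use f(2) \<sigma> qD in \<open>auto intro!: N.smult_closed\<close>)
  finally show ?thesis .
qed

lemma free_map_hom:
  assumes "lmodule R M" "Z \<subseteq> carrier M"
  shows "free_map R M Z \<in> module_hom R (free_lmodule R Z) M"
    and "f \<in> carrier (free_lmodule R Z) \<Longrightarrow> free_map R M Z f = free_extension R M Z (\<lambda>z. z) f"
    and "z \<in> Z \<Longrightarrow> free_map R M Z (free_basis R Z z) = z"
proof -
  interpret lmodule R M by fact
  have id: "(\<lambda>z. z) \<in> Z \<rightarrow> carrier M" using assms(2) by auto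
  show e: "f \<in> carrier (free_lmodule R Z) \<Longrightarrow> free_map R M Z f = free_extension R M Z (\<lambda>z. z) f" for f
    by (simp add: free_map_def free_extension_def)
  have "free_map R M Z = (\<lambda>f\<in>carrier (free_lmodule R Z). free_extension R M Z (\<lambda>z. z) f)"
    unfolding free_map_def free_extension_def ..
  then have "free_map R M Z \<in> Hom R (free_lmodule R Z) M"
    using HomI[OF free_lmodule_lmodule[OF R.ring_axioms] free_extension_hom[OF assms(1) id]] by simp
  then show "free_map R M Z \<in> module_hom R (free_lmodule R Z) M" by (rule HomD)
  show "z \<in> Z \<Longrightarrow> free_map R M Z (free_basis R Z z) = z"
    using e[OF free_basis_closed[OF R.ring_axioms]] free_extension_basis[OF assms(1) id] by simp
qed

text \<open>The reason why consecutive maps of the canonical resolution compose to zero: a linear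
  combination of elements killed by \<open>q\<close> is killed by \<open>q\<close>.\<close>

lemma free_map_kernel:
  fixes M :: "('a, 'm) module" and N :: "('a, 'n) module"
  assumes "lmodule R M" "lmodule R N" "q \<in> module_hom R M N"
    and "f \<in> carrier (free_lmodule R (a_kernel M N q))"
  shows "free_map R M (a_kernel M N q) f \<in> a_kernel M N q"
proof -
  interpret M: lmodule R M by fact
  interpret N: lmodule R N by fact
  let ?Z = "a_kernel M N q"
  have Z: "?Z \<subseteq> carrier M" "\<And>z. z \<in> ?Z \<Longrightarrow> q z = \<zero>\<^bsub>N\<^esub>" by (auto simp: a_kernel_def')
  have id: "(\<lambda>z. z) \<in> ?Z \<rightarrow> carrier M" using Z(1) by auto
  have f: "\<And>z. z \<in> ?Z \<Longrightarrow> f z \<in> carrier R"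
    using assms(4) by (auto simp: free_lmodule_simps[OF M.R.ring_axioms])
  have "q (free_map R M ?Z f) = free_extension R N ?Z q f"
    using hom_free_extension[OF assms(1-3) id assms(4)] free_map_hom(2)[OF assms(1) Z(1) assms(4)] by simp
  also have "\<dots> = \<zero>\<^bsub>N\<^esub>"
    unfolding free_extension_def by (rule N.M.add.finprod_one_eqI) (use f Z(2) in auto)
  finally show ?thesis
    using module_homD(1)[OF free_map_hom(1)[OF assms(1) Z(1)] assms(4)] by (simp add: a_kernel_def')
qed

section \<open>Vanishing of \<open>Ext\<^sup>1\<close> as an extension property\<close>

text \<open>
  Here \<open>Q = f(P) + ker q\<close>, and the extension of \<open>\<phi>\<close> is \<open>f x + z \<mapsto> \<psi> x + \<phi> z\<close>, where \<open>\<psi>\<close>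
  extends the map \<open>\<phi> \<circ> f\<close> on \<open>ker p\<close>.
\<close>

lemma extension_comparison:
  fixes P :: "('a, 'p) module" and Q :: "('a, 'q) module" and S :: "('a, 's) module" and T :: "('a, 't) module"
  assumes P: "lmodule R P" and Q: "lmodule R Q" and S: "lmodule R S" and T: "lmodule R T"
    and p: "p \<in> module_hom R P S" "p ` carrier P = carrier S" and q: "q \<in> module_hom R Q S"
    and f: "f \<in> module_hom R P Q" "\<And>x. x \<in> carrier P \<Longrightarrow> q (f x) = p x"
    and ext: "\<And>\<phi>. \<phi> \<in> module_hom R (P\<lparr>carrier := {x \<in> carrier P. p x = \<zero>\<^bsub>S\<^esub>}\<rparr>) T \<Longrightarrow>
        \<exists>\<psi>\<in>module_hom R P T. \<forall>x\<in>carrier P. p x = \<zero>\<^bsub>S\<^esub> \<longrightarrow> \<psi> x = \<phi> x"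
    and \<phi>: "\<phi> \<in> module_hom R (Q\<lparr>carrier := {y \<in> carrier Q. q y = \<zero>\<^bsub>S\<^esub>}\<rparr>) T"
  shows "\<exists>\<theta>\<in>module_hom R Q T. \<forall>y\<in>carrier Q. q y = \<zero>\<^bsub>S\<^esub> \<longrightarrow> \<theta> y = \<phi> y"
proof -
  interpret P: lmodule R P by fact
  interpret Q: lmodule R Q by fact
  interpret S: lmodule R S by fact
  interpret T: lmodule R T by fact
  note pD = module_homD[OF p(1)] and qD = module_homD[OF q] and fD = module_homD[OF f(1)]
  let ?K = "Q\<lparr>carrier := {y \<in> carrier Q. q y = \<zero>\<^bsub>S\<^esub>}\<rparr>"
  note K = submodule_lmodule[OF Q module_hom_kernel_submodule[OF Q S q]]
  interpret K: lmodule R ?K by (rule K)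
  have \<phi>D: "\<And>y. y \<in> carrier Q \<Longrightarrow> q y = \<zero>\<^bsub>S\<^esub> \<Longrightarrow> \<phi> y \<in> carrier T"
    "\<And>y z. y \<in> carrier Q \<Longrightarrow> q y = \<zero>\<^bsub>S\<^esub> \<Longrightarrow> z \<in> carrier Q \<Longrightarrow> q z = \<zero>\<^bsub>S\<^esub> \<Longrightarrow> \<phi> (y \<oplus>\<^bsub>Q\<^esub> z) = \<phi> y \<oplus>\<^bsub>T\<^esub> \<phi> z"
    "\<And>a y. a \<in> carrier R \<Longrightarrow> y \<in> carrier Q \<Longrightarrow> q y = \<zero>\<^bsub>S\<^esub> \<Longrightarrow> \<phi> (a \<odot>\<^bsub>Q\<^esub> y) = a \<odot>\<^bsub>T\<^esub> \<phi> y"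
    using module_homD[OF \<phi>] by auto
  have "(\<lambda>x. \<phi> (f x)) \<in> module_hom R (P\<lparr>carrier := {x \<in> carrier P. p x = \<zero>\<^bsub>S\<^esub>}\<rparr>) T"
    by (rule module_homI) (auto simp: fD \<phi>D f(2))
  then obtain \<psi> where \<psi>: "\<psi> \<in> module_hom R P T"
    "\<And>x. x \<in> carrier P \<Longrightarrow> p x = \<zero>\<^bsub>S\<^esub> \<Longrightarrow> \<psi> x = \<phi> (f x)"
    using ext by blast
  note \<psi>D = module_homD[OF \<psi>(1)]
  define s where "s y = inv_into (carrier P) p (q y)" for y
  have s: "s y \<in> carrier P" "p (s y) = q y" if "y \<in> carrier Q" for y
    unfolding s_def using that qD(1) p(2) by (auto simp: inv_into_into f_inv_into_f)
  have dQ: "y \<ominus>\<^bsub>Q\<^esub> f x \<in> carrier Q" "q (y \<ominus>\<^bsub>Q\<^esub> f x) = \<zero>\<^bsub>S\<^esub>"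
    if "y \<in> carrier Q" "x \<in> carrier P" "p x = q y" for x y
    using that by (simp_all add: fD lmodule_hom_diff[OF Q S q] f(2) S.M.diff_eq_zero_iff qD)
  define \<theta> where "\<theta> y = \<psi> (s y) \<oplus>\<^bsub>T\<^esub> \<phi> (y \<ominus>\<^bsub>Q\<^esub> f (s y))" for y
  \<comment> \<open>The value does not depend on the choice of \<open>x\<close>: another choice
    changes it by some \<open>d\<close> in the kernel of \<open>p\<close>, and the two changes
    \<open>\<psi> d\<close> and \<open>\<phi> (f d)\<close> cancel because \<open>\<psi>\<close>
    extends \<open>\<phi> \<circ> f\<close>.\<close>
  have key: "\<theta> y = \<psi> x \<oplus>\<^bsub>T\<^esub> \<phi> (y \<ominus>\<^bsub>Q\<^esub> f x)" if y: "y \<in> carrier Q" and x: "x \<in> carrier P" "p x = q y" for x y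
  proof -
    let ?d = "s y \<ominus>\<^bsub>P\<^esub> x"
    have d: "?d \<in> carrier P" "p ?d = \<zero>\<^bsub>S\<^esub>"
      using s[OF y] x by (simp_all add: lmodule_hom_diff[OF P S p(1)] S.M.diff_eq_zero_iff pD qD y)
    have e1: "s y = ?d \<oplus>\<^bsub>P\<^esub> x" using s[OF y] x by (simp add: a_minus_def P.M.a_assoc P.M.l_neg)
    have "y \<ominus>\<^bsub>Q\<^esub> f x = f ?d \<oplus>\<^bsub>Q\<^esub> (y \<ominus>\<^bsub>Q\<^esub> f (s y))"
    proof -
      have "y \<ominus>\<^bsub>Q\<^esub> f (s y) = y \<ominus>\<^bsub>Q\<^esub> (f ?d \<oplus>\<^bsub>Q\<^esub> f x)" using fD(2)[OF d(1) x(1)] e1 by simp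
      also have "f ?d \<oplus>\<^bsub>Q\<^esub> \<dots> = y \<ominus>\<^bsub>Q\<^esub> f x"
        using y fD(1)[OF d(1)] fD(1)[OF x(1)] by (rule Q.M.add_diff_add_cancel)
      finally show ?thesis by simp
    qed
    then have "\<phi> (y \<ominus>\<^bsub>Q\<^esub> f x) = \<psi> ?d \<oplus>\<^bsub>T\<^esub> \<phi> (y \<ominus>\<^bsub>Q\<^esub> f (s y))"
      using \<phi>D(2)[OF fD(1)[OF d(1)] _ dQ[OF y s(1)[OF y] s(2)[OF y]]] f(2)[OF d(1)] d \<psi>(2)[OF d] by simp
    moreover have "\<psi> (s y) = \<psi> ?d \<oplus>\<^bsub>T\<^esub> \<psi> x" using \<psi>D(2)[OF d(1) x(1)] e1 by simp
    ultimately show ?thesis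
      unfolding \<theta>_def using \<psi>D(1)[OF d(1)] \<psi>D(1)[OF x(1)] \<phi>D(1)[OF dQ[OF y s(1)[OF y] s(2)[OF y]]]
      by (simp add: T.M.a_ac)
  qed
  have "\<theta> \<in> module_hom R Q T"
  proof (rule module_homI)
    fix y assume y: "y \<in> carrier Q"
    show "\<theta> y \<in> carrier T" unfolding \<theta>_def using s[OF y] \<psi>D(1) \<phi>D(1) dQ[OF y] by simp
  next
    fix y z assume y: "y \<in> carrier Q" and z: "z \<in> carrier Q"
    note sy = s[OF y] and sz = s[OF z]
    have "\<theta> (y \<oplus>\<^bsub>Q\<^esub> z) = \<psi> (s y \<oplus>\<^bsub>P\<^esub> s z) \<oplus>\<^bsub>T\<^esub> \<phi> ((y \<oplus>\<^bsub>Q\<^esub> z) \<ominus>\<^bsub>Q\<^esub> f (s y \<oplus>\<^bsub>P\<^esub> s z))"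
      by (rule key) (use y z sy sz in \<open>simp_all add: pD qD\<close>)
    moreover have "(y \<oplus>\<^bsub>Q\<^esub> z) \<ominus>\<^bsub>Q\<^esub> f (s y \<oplus>\<^bsub>P\<^esub> s z) = (y \<ominus>\<^bsub>Q\<^esub> f (s y)) \<oplus>\<^bsub>Q\<^esub> (z \<ominus>\<^bsub>Q\<^esub> f (s z))"
      using y z sy sz fD by (simp add: a_minus_def Q.M.minus_add Q.M.a_ac)
    ultimately show "\<theta> (y \<oplus>\<^bsub>Q\<^esub> z) = \<theta> y \<oplus>\<^bsub>T\<^esub> \<theta> z"
      using dQ[OF y sy] dQ[OF z sz] sy sz \<psi>D \<phi>D unfolding \<theta>_def by (simp add: T.M.a_ac)
  next
    fix a y assume a: "a \<in> carrier R" and y: "y \<in> carrier Q"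
    note sy = s[OF y]
    have "\<theta> (a \<odot>\<^bsub>Q\<^esub> y) = \<psi> (a \<odot>\<^bsub>P\<^esub> s y) \<oplus>\<^bsub>T\<^esub> \<phi> (a \<odot>\<^bsub>Q\<^esub> y \<ominus>\<^bsub>Q\<^esub> f (a \<odot>\<^bsub>P\<^esub> s y))"
      by (rule key) (use a y sy in \<open>simp_all add: pD qD P.smult_closed Q.smult_closed\<close>)
    moreover have "a \<odot>\<^bsub>Q\<^esub> y \<ominus>\<^bsub>Q\<^esub> f (a \<odot>\<^bsub>P\<^esub> s y) = a \<odot>\<^bsub>Q\<^esub> (y \<ominus>\<^bsub>Q\<^esub> f (s y))"
      using a y sy fD by (simp add: Q.smult_diff_right)
    ultimately show "\<theta> (a \<odot>\<^bsub>Q\<^esub> y) = a \<odot>\<^bsub>T\<^esub> \<theta> y"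
      using dQ[OF y sy] sy a \<psi>D \<phi>D unfolding \<theta>_def by (simp add: T.smult_r_distr)
  qed
  moreover have "\<theta> y = \<phi> y" if y: "y \<in> carrier Q" "q y = \<zero>\<^bsub>S\<^esub>" for y
    using key[OF y(1) P.M.zero_closed] y lmodule_hom_zero[OF P S p(1)] lmodule_hom_zero[OF P Q f(1)]
      lmodule_hom_zero[OF P T \<psi>(1)] \<phi>D(1)[OF y] by (simp add: Q.M.diff_zero_right)
  ultimately show ?thesis by blast
qed

text \<open>What matters is that the coset of \<open>f\<close> is \<open>B\<close> iff
  \<open>f\<close> lies in \<open>B\<close>. Closure of \<open>B\<close> under sums and differences
  and a left neutral element give this, so no group structure on the cocycles has to be
  established.\<close>

lemma FactGroup_carrier_trivial_iff:
  assumes add: "\<And>f g. f \<in> B \<Longrightarrow> g \<in> B \<Longrightarrow> g \<otimes>\<^bsub>G\<^esub> f \<in> B"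
    and diff: "\<And>f g. f \<in> B \<Longrightarrow> g \<in> B \<Longrightarrow> \<exists>h\<in>B. h \<otimes>\<^bsub>G\<^esub> f = g"
    and one: "\<one>\<^bsub>G\<^esub> \<in> B" "\<one>\<^bsub>G\<^esub> \<in> carrier G" "\<And>f. f \<in> carrier G \<Longrightarrow> \<one>\<^bsub>G\<^esub> \<otimes>\<^bsub>G\<^esub> f = f"
  shows "carrier (G Mod B) = {\<one>\<^bsub>G Mod B\<^esub>} \<longleftrightarrow> carrier G \<subseteq> B"
proof -
  have "(B #>\<^bsub>G\<^esub> f) = B" if "f \<in> B" for f
    using add[OF that] diff[OF that] by (auto simp: r_coset_def)
  moreover have "f \<in> B" if "B #>\<^bsub>G\<^esub> f = B" "f \<in> carrier G" for f
    using one(1) one(3)[OF that(2)] that(1) by (force simp: r_coset_def)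
  ultimately have "B #>\<^bsub>G\<^esub> f = B \<longleftrightarrow> f \<in> B" if "f \<in> carrier G" for f using that by blast
  then show ?thesis using one(2) by (auto simp: FactGroup_def RCOSETS_def)
qed

text \<open>A cocycle is a map \<open>P1 \<rightarrow> T\<close> vanishing on the kernel of
  \<open>d1\<close>. As \<open>d1\<close> maps \<open>P1\<close> onto the kernel of
  \<open>d\<close>, this amounts to a map from that kernel to \<open>T\<close>, and the cocycle is a
  coboundary exactly when the map extends to \<open>P\<close>.\<close>

lemma Ext1_trivial_iff:
  fixes R :: "('a, 'x) ring_scheme" and S :: "('a, 's) module" and T :: "('a, 't) module"
  assumes S: "lmodule R S" and T: "lmodule R T"
  defines "P \<equiv> free_lmodule R (carrier S)" and "d \<equiv> free_map R S (carrier S)"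
  shows "carrier (Ext1 R S T) = {\<one>\<^bsub>Ext1 R S T\<^esub>} \<longleftrightarrow>
    (\<forall>\<phi>\<in>module_hom R (P\<lparr>carrier := {x \<in> carrier P. d x = \<zero>\<^bsub>S\<^esub>}\<rparr>) T.
       \<exists>\<psi>\<in>module_hom R P T. \<forall>x\<in>carrier P. d x = \<zero>\<^bsub>S\<^esub> \<longrightarrow> \<psi> x = \<phi> x)"
proof -
  interpret S: lmodule R S by fact
  interpret T: lmodule R T by fact
  note R = S.R.ring_axioms
  have P: "lmodule R P" unfolding P_def by (rule free_lmodule_lmodule[OF R])
  have d: "d \<in> module_hom R P S" unfolding d_def P_def by (rule free_map_hom(1)[OF S]) simp
  define Z where "Z = a_kernel P S d"
  have Z: "Z = {x \<in> carrier P. d x = \<zero>\<^bsub>S\<^esub>}" "Z \<subseteq> carrier P" by (auto simp: Z_def a_kernel_def')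
  define P1 where "P1 = free_lmodule R Z"
  define d1 where "d1 = free_map R P Z"
  have P1: "lmodule R P1" unfolding P1_def by (rule free_lmodule_lmodule[OF R])
  have d1: "d1 \<in> module_hom R P1 P" unfolding d1_def P1_def by (rule free_map_hom(1)[OF P Z(2)])
  have d1Z: "d1 f \<in> Z" if "f \<in> carrier P1" for f
    using free_map_kernel[OF P S d] that unfolding d1_def P1_def Z_def by blast
  have d1b: "free_basis R Z z \<in> carrier P1" "d1 (free_basis R Z z) = z" if "z \<in> Z" for z
    unfolding P1_def d1_def using free_basis_closed[OF R] free_map_hom(3)[OF P Z(2) that] by auto
  define Z1 where "Z1 = a_kernel P1 P d1"
  have Z1: "Z1 = {x \<in> carrier P1. d1 x = \<zero>\<^bsub>P\<^esub>}" "Z1 \<subseteq> carrier P1" by (auto simp: Z1_def a_kernel_def')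
  define P2 where "P2 = free_lmodule R Z1"
  define d2 where "d2 = free_map R P1 Z1"
  have P2: "lmodule R P2" unfolding P2_def by (rule free_lmodule_lmodule[OF R])
  have d2Z: "d2 f \<in> Z1" if "f \<in> carrier P2" for f
    using free_map_kernel[OF P1 P d1] that unfolding d2_def P2_def Z1_def by blast
  have d2b: "free_basis R Z1 z \<in> carrier P2" "d2 (free_basis R Z1 z) = z" if "z \<in> Z1" for z
    unfolding P2_def d2_def using free_basis_closed[OF R] free_map_hom(3)[OF P1 Z1(2) that] by auto
  interpret P: lmodule R P by (rule P)
  interpret P1: lmodule R P1 by (rule P1)
  define C where "C = {f \<in> Hom R P1 T. compose (carrier P2) f d2 = hom_zero P2 T}"
  define B where "B = (\<lambda>g. compose (carrier P1) g d1) ` Hom R P T"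
  define G where "G = (hom_group R P1 T)\<lparr>carrier := C\<rparr>"
  have Ext: "Ext1 R S T = G Mod B"
    unfolding Ext1_def Let_def G_def B_def C_def P_def d_def Z_def P1_def d1_def Z1_def P2_def d2_def ..
  have C: "f \<in> C \<longleftrightarrow> f \<in> Hom R P1 T \<and> (\<forall>z\<in>Z1. f z = \<zero>\<^bsub>T\<^esub>)" for f
  proof -
    have "compose (carrier P2) f d2 = hom_zero P2 T \<longleftrightarrow> (\<forall>x\<in>carrier P2. f (d2 x) = \<zero>\<^bsub>T\<^esub>)"
      by (auto simp: compose_def hom_zero_def fun_eq_iff restrict_def)
    \<comment> \<open>Each \<open>z\<close> in \<open>Z1\<close> is the image of its basis element
      in \<open>P2\<close>, so vanishing on the image of \<open>d2\<close> is vanishing on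
      \<open>Z1\<close>.\<close>
    also have "\<dots> \<longleftrightarrow> (\<forall>z\<in>Z1. f z = \<zero>\<^bsub>T\<^esub>)" using d2Z d2b by metis
    finally show ?thesis by (simp add: C_def)
  qed
  have B: "f \<in> B \<longleftrightarrow> f \<in> Hom R P1 T \<and> (\<exists>g\<in>module_hom R P T. \<forall>x\<in>carrier P1. f x = g (d1 x))" for f
  proof
    assume "f \<in> B"
    then obtain g where g: "g \<in> Hom R P T" "f = compose (carrier P1) g d1" by (auto simp: B_def)
    then have "f \<in> Hom R P1 T"
      using HomI[OF P1 module_hom_comp[OF d1 HomD[OF g(1)]]] by (simp add: compose_def)
    then show "f \<in> Hom R P1 T \<and> (\<exists>g\<in>module_hom R P T. \<forall>x\<in>carrier P1. f x = g (d1 x))"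
      using HomD[OF g(1)] g(2) by (auto simp: compose_def)
  next
    assume "f \<in> Hom R P1 T \<and> (\<exists>g\<in>module_hom R P T. \<forall>x\<in>carrier P1. f x = g (d1 x))"
    then obtain g where f: "f \<in> Hom R P1 T" and g: "g \<in> module_hom R P T" "\<And>x. x \<in> carrier P1 \<Longrightarrow> f x = g (d1 x)"
      by blast
    note rg = HomI[OF P g(1)]
    have "f = compose (carrier P1) (\<lambda>x\<in>carrier P. g x) d1"
      by (rule Hom_eqI[OF f])
        (use HomI[OF P1 module_hom_comp[OF d1 HomD[OF rg]]] module_homD(1)[OF d1] g(2) in \<open>auto simp: compose_def\<close>)
    then show "f \<in> B" using rg by (auto simp: B_def)
  qed
  have "carrier (Ext1 R S T) = {\<one>\<^bsub>Ext1 R S T\<^esub>} \<longleftrightarrow> C \<subseteq> B"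
  proof -
    have "carrier (G Mod B) = {\<one>\<^bsub>G Mod B\<^esub>} \<longleftrightarrow> carrier G \<subseteq> B"
    proof (rule FactGroup_carrier_trivial_iff)
      show "\<one>\<^bsub>G\<^esub> \<in> carrier G"
        using hom_zero_Hom[OF P1 T] Z1(2) by (auto simp: G_def hom_group_def C hom_zero_def)
      have "(\<lambda>x. \<zero>\<^bsub>T\<^esub>) \<in> module_hom R P T" by (rule module_homI) auto
      then show "\<one>\<^bsub>G\<^esub> \<in> B"
        using hom_zero_Hom[OF P1 T] by (auto simp: G_def hom_group_def B hom_zero_def)
      show "\<one>\<^bsub>G\<^esub> \<otimes>\<^bsub>G\<^esub> f = f" if "f \<in> carrier G" for f
      proof -
        have f: "f \<in> Hom R P1 T" using that by (simp add: G_def C)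
        show ?thesis
          using hom_add_Hom[OF P1 T hom_zero_Hom[OF P1 T] f]
          by (auto intro!: Hom_eqI[OF _ f] simp: G_def hom_group_def hom_add_def hom_zero_def Hom_closed[OF f])
      qed
    next
      fix f f' assume "f \<in> B" "f' \<in> B"
      then obtain g g' where f: "f \<in> Hom R P1 T" "f' \<in> Hom R P1 T"
        and g: "g \<in> module_hom R P T" "\<And>x. x \<in> carrier P1 \<Longrightarrow> f x = g (d1 x)"
          "g' \<in> module_hom R P T" "\<And>x. x \<in> carrier P1 \<Longrightarrow> f' x = g' (d1 x)"
        unfolding B by blast
      note gD = module_homD[OF g(1)] module_homD[OF g(3)]
      have s: "(\<lambda>x. g' x \<oplus>\<^bsub>T\<^esub> g x) \<in> module_hom R P T"
        by (rule module_homI) (auto simp: gD T.M.a_ac T.smult_r_distr)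
      then show "f' \<otimes>\<^bsub>G\<^esub> f \<in> B"
        using hom_add_Hom[OF P1 T f(2,1)] g(2,4) by (auto simp: G_def hom_group_def B hom_add_def)
      have m: "(\<lambda>x. g' x \<ominus>\<^bsub>T\<^esub> g x) \<in> module_hom R P T"
        by (rule module_homI) (auto simp: gD a_minus_def T.M.a_ac T.M.minus_add T.smult_r_distr T.smult_minus_right)
      \<comment> \<open>The difference \<open>f' - f\<close> is the coboundary of
        \<open>g' - g\<close>.\<close>
      let ?h = "\<lambda>x\<in>carrier P1. g' (d1 x) \<ominus>\<^bsub>T\<^esub> g (d1 x)"
      have h: "?h \<in> Hom R P1 T" using HomI[OF P1 module_hom_comp[OF d1 m]] .
      have "?h \<in> B" unfolding B using h m by auto
      moreover have "hom_add P1 T ?h f = f'"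
        by (rule Hom_eqI[OF hom_add_Hom[OF P1 T h f(1)] f(2)])
          (use g gD module_homD(1)[OF d1] in \<open>simp add: hom_add_def a_minus_def T.M.a_assoc T.M.l_neg\<close>)
      ultimately show "\<exists>h\<in>B. h \<otimes>\<^bsub>G\<^esub> f = f'" by (auto simp: G_def hom_group_def)
    qed
    then show ?thesis by (simp add: Ext G_def)
  qed
  also have "C \<subseteq> B \<longleftrightarrow> (\<forall>\<phi>\<in>module_hom R (P\<lparr>carrier := Z\<rparr>) T.
       \<exists>\<psi>\<in>module_hom R P T. \<forall>x\<in>Z. \<psi> x = \<phi> x)"
  proof (intro iffI ballI subsetI)
    fix \<phi> assume CB: "C \<subseteq> B" and \<phi>: "\<phi> \<in> module_hom R (P\<lparr>carrier := Z\<rparr>) T"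
    have d1': "d1 \<in> module_hom R P1 (P\<lparr>carrier := Z\<rparr>)"
      using module_homD[OF d1] d1Z by (auto intro!: module_homI)
    let ?f = "\<lambda>x\<in>carrier P1. \<phi> (d1 x)"
    have f: "?f \<in> Hom R P1 T" by (rule HomI[OF P1 module_hom_comp[OF d1' \<phi>]])
    have "lmodule R (P\<lparr>carrier := Z\<rparr>)"
      unfolding Z(1) by (rule submodule_lmodule[OF P module_hom_kernel_submodule[OF P S d]])
    then have "\<phi> \<zero>\<^bsub>P\<^esub> = \<zero>\<^bsub>T\<^esub>" using lmodule_hom_zero[OF _ T \<phi>] by simp
    then have "?f \<in> C" using f by (auto simp: C Z1)
    then obtain g where g: "g \<in> module_hom R P T" "\<And>x. x \<in> carrier P1 \<Longrightarrow> ?f x = g (d1 x)"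
      using CB B by blast
    have "g z = \<phi> z" if "z \<in> Z" for z using g(2)[OF d1b(1)[OF that]] d1b[OF that] by simp
    then show "\<exists>\<psi>\<in>module_hom R P T. \<forall>x\<in>Z. \<psi> x = \<phi> x" using g(1) by blast
  next
    fix f assume ext: "\<forall>\<phi>\<in>module_hom R (P\<lparr>carrier := Z\<rparr>) T. \<exists>\<psi>\<in>module_hom R P T. \<forall>x\<in>Z. \<psi> x = \<phi> x"
      and "f \<in> C"
    then have f: "f \<in> Hom R P1 T" "\<And>z. z \<in> Z1 \<Longrightarrow> f z = \<zero>\<^bsub>T\<^esub>" by (auto simp: C)
    have PZ: "lmodule R (P\<lparr>carrier := Z\<rparr>)"
      unfolding Z(1) by (rule submodule_lmodule[OF P module_hom_kernel_submodule[OF P S d]])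
    have d1': "d1 \<in> module_hom R P1 (P\<lparr>carrier := Z\<rparr>)"
      using module_homD[OF d1] d1Z by (auto intro!: module_homI)
    have surj: "d1 ` carrier P1 = carrier (P\<lparr>carrier := Z\<rparr>)" using d1Z d1b by force
    obtain \<phi> where \<phi>: "\<phi> \<in> module_hom R (P\<lparr>carrier := Z\<rparr>) T" "\<And>x. x \<in> carrier P1 \<Longrightarrow> \<phi> (d1 x) = f x"
      by (rule module_hom_factor[OF P1 PZ T d1' surj HomD[OF f(1)]]) (use f(2) Z1 in auto)
    obtain \<psi> where \<psi>: "\<psi> \<in> module_hom R P T" "\<And>x. x \<in> Z \<Longrightarrow> \<psi> x = \<phi> x" using ext \<phi>(1) by blast
    have "\<forall>x\<in>carrier P1. f x = \<psi> (d1 x)" using \<psi>(2)[OF d1Z] \<phi>(2) by simp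
    then show "f \<in> B" using f(1) \<psi>(1) B by blast
  qed
  finally show ?thesis unfolding Z(1) by (simp add: Ball_def imp_conjL)
qed

text \<open>Choosing a preimage in \<open>Q\<close> for each element of \<open>S\<close> gives, by
  freeness, a map over \<open>S\<close> from the canonical free module to \<open>Q\<close>, along
  which the extension property is transferred to \<open>Q\<close>.\<close>

lemma Ext1_trivial_extends:
  fixes S :: "('a, 's) module" and T :: "('a, 't) module" and Q :: "('a, 'q) module"
  assumes S: "lmodule R S" and T: "lmodule R T"
    and triv: "carrier (Ext1 R S T) = {\<one>\<^bsub>Ext1 R S T\<^esub>}"
    and Q: "lmodule R Q" "q \<in> module_hom R Q S" "q ` carrier Q = carrier S"
    and \<phi>: "\<phi> \<in> module_hom R (Q\<lparr>carrier := {y \<in> carrier Q. q y = \<zero>\<^bsub>S\<^esub>}\<rparr>) T"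
  shows "\<exists>\<theta>\<in>module_hom R Q T. \<forall>y\<in>carrier Q. q y = \<zero>\<^bsub>S\<^esub> \<longrightarrow> \<theta> y = \<phi> y"
proof -
  interpret S: lmodule R S by fact
  note R = S.R.ring_axioms
  let ?P = "free_lmodule R (carrier S)" and ?d = "free_map R S (carrier S)"
  note P = free_lmodule_lmodule[OF R, of "carrier S"]
  note d = free_map_hom[OF S subset_refl]
  let ?\<sigma> = "inv_into (carrier Q) q"
  have \<sigma>: "?\<sigma> \<in> carrier S \<rightarrow> carrier Q" "\<And>s. s \<in> carrier S \<Longrightarrow> q (?\<sigma> s) = s"
    using Q(3) by (auto simp: inv_into_into f_inv_into_f)
  let ?f = "free_extension R Q (carrier S) ?\<sigma>"
  have f: "q (?f x) = ?d x" if x: "x \<in> carrier ?P" for x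
  proof -
    have xR: "\<And>s. s \<in> carrier S \<Longrightarrow> x s \<in> carrier R" using x by (auto simp: free_lmodule_simps[OF R])
    have "q (?f x) = free_extension R S (carrier S) (\<lambda>z. q (?\<sigma> z)) x"
      by (rule hom_free_extension[OF Q(1) S Q(2) \<sigma>(1) x])
    also have "\<dots> = free_extension R S (carrier S) (\<lambda>z. z) x"
      unfolding free_extension_def
      by (rule S.M.finsum_cong') (use \<sigma>(2) xR in \<open>auto intro!: S.smult_closed\<close>)
    finally show ?thesis using d(2)[OF x] by simp
  qed
  have surj: "?d ` carrier ?P = carrier S"
  proof
    show "?d ` carrier ?P \<subseteq> carrier S" using module_homD(1)[OF d(1)] by blast
    show "carrier S \<subseteq> ?d ` carrier ?P" using d(3) free_basis_closed[OF R] by (metis imageI subsetI)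
  qed
  show ?thesis
    by (rule extension_comparison[OF P Q(1) S T d(1) surj Q(2) free_extension_hom[OF Q(1) \<sigma>(1)] f _ \<phi>])
      (use triv Ext1_trivial_iff[OF S T] in auto)
qed

text \<open>Here the transfer runs from the small \<open>U\<close> to the canonical free module:
  sending \<open>e\<close> to the basis element at \<open>p e\<close> defines a map over
  \<open>S\<close>. Thus vanishing of \<open>Ext1\<close> can be verified on a cyclic module that
  fits into the universe.\<close>

lemma Ext1_trivialI:
  fixes S :: "('a, 's) module" and T :: "('a, 't) module" and U :: "('a, 'u) module"
  assumes S: "lmodule R S" and T: "lmodule R T"
    and U: "free_lmodule_on R U e" and p: "p \<in> module_hom R U S" "p ` carrier U = carrier S"
    and ext: "\<And>\<phi>. \<phi> \<in> module_hom R (U\<lparr>carrier := {x \<in> carrier U. p x = \<zero>\<^bsub>S\<^esub>}\<rparr>) T \<Longrightarrow>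
        \<exists>\<psi>\<in>module_hom R U T. \<forall>x\<in>carrier U. p x = \<zero>\<^bsub>S\<^esub> \<longrightarrow> \<psi> x = \<phi> x"
  shows "carrier (Ext1 R S T) = {\<one>\<^bsub>Ext1 R S T\<^esub>}"
proof -
  interpret S: lmodule R S by fact
  note R = S.R.ring_axioms
  have lmU: "lmodule R U" and e: "e \<in> carrier U" using U by (auto simp: free_lmodule_on_def)
  let ?P = "free_lmodule R (carrier S)" and ?d = "free_map R S (carrier S)"
  note P = free_lmodule_lmodule[OF R, of "carrier S"]
  note d = free_map_hom[OF S subset_refl]
  have pe: "p e \<in> carrier S" using module_homD(1)[OF p(1) e] .
  obtain f where f: "f \<in> Hom R U ?P" "f e = free_basis R (carrier S) (p e)"
    by (rule free_lmodule_on_hom[OF U P free_basis_closed[OF R]])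
  have "?d (f x) = p x" if x: "x \<in> carrier U" for x
  proof -
    obtain a where a: "a \<in> carrier R" "x = a \<odot>\<^bsub>U\<^esub> e" using x by (rule free_lmodule_on_elem[OF U])
    then show ?thesis
      using module_homD(3)[OF HomD[OF f(1)] a(1) e] module_homD(3)[OF p(1) a(1) e]
        module_homD(3)[OF d(1) a(1) free_basis_closed[OF R]] f(2) d(3)[OF pe] by simp
  qed
  then show ?thesis
    unfolding Ext1_trivial_iff[OF S T]
    using extension_comparison[OF lmU P S T p d(1) HomD[OF f(1)] _ ext] by blast
qed

section \<open>Equivalences of module categories\<close>

lemma Hom_zero:
  fixes M :: "('a, 'm) module" and N :: "('a, 'n) module"
  assumes "lmodule R M" "lmodule R N" "f \<in> Hom R M N"
  shows "f \<zero>\<^bsub>M\<^esub> = \<zero>\<^bsub>N\<^esub>"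
  by (rule lmodule_hom_zero[OF assms(1,2) HomD[OF assms(3)]])

lemma Hom_id:
  fixes M :: "('a, 'm) module"
  assumes "lmodule R M"
  shows "(\<lambda>x\<in>carrier M. x) \<in> Hom R M M"
  by (rule HomI[OF assms]) (auto simp: module_hom_def)

lemma Hom_inverse:
  fixes M :: "('a, 'm) module" and N :: "('a, 'n) module"
  assumes "lmodule R M" "lmodule R N" "f \<in> Hom R M N" "bij_betw f (carrier M) (carrier N)"
  obtains g where "g \<in> Hom R N M" "\<And>y. y \<in> carrier N \<Longrightarrow> f (g y) = y"
    "\<And>x. x \<in> carrier M \<Longrightarrow> g (f x) = x"
proof (rule that[OF HomI[OF assms(2) module_hom_inv_into[OF assms(1,2) HomD[OF assms(3)] assms(4)]]])
  fix y assume "y \<in> carrier N"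
  then show "f ((\<lambda>y\<in>carrier N. inv_into (carrier M) f y) y) = y"
    using bij_betw_inv_into_right[OF assms(4)] by simp
next
  fix x assume "x \<in> carrier M"
  then show "(\<lambda>y\<in>carrier N. inv_into (carrier M) f y) (f x) = x"
    using bij_betw_inv_into_left[OF assms(4)] Hom_closed[OF assms(3)] by simp
qed

lemma hom_scale_Hom:
  fixes A :: "('k, 'a) module" and M :: "('a, 'm) module" and N :: "('a, 'n) module"
  assumes A: "k_algebra K A" and M: "lmodule A M" and N: "lmodule A N"
    and f: "f \<in> Hom A M N" and c: "c \<in> carrier K"
  shows "hom_scale A M N c f \<in> Hom A M N"
proof -
  interpret N: lmodule A N by fact
  note cA = k_algebra_scalar_closed[OF A c]
  note fD = module_homD[OF HomD[OF f]]
  show ?thesis unfolding hom_scale_def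
  proof (rule HomI[OF M], rule module_homI)
    fix a x assume a: "a \<in> carrier A" and x: "x \<in> carrier M"
    have "(c \<odot>\<^bsub>A\<^esub> \<one>\<^bsub>A\<^esub>) \<odot>\<^bsub>N\<^esub> (a \<odot>\<^bsub>N\<^esub> f x) = a \<odot>\<^bsub>N\<^esub> ((c \<odot>\<^bsub>A\<^esub> \<one>\<^bsub>A\<^esub>) \<odot>\<^bsub>N\<^esub> f x)"
      using N.smult_assoc[OF a cA fD(1)[OF x]] N.smult_assoc[OF cA a fD(1)[OF x]]
        k_algebra_scalar_mult[OF A c a] k_algebra_mult_scalar[OF A c a] by simp
    then show "(c \<odot>\<^bsub>A\<^esub> \<one>\<^bsub>A\<^esub>) \<odot>\<^bsub>N\<^esub> f (a \<odot>\<^bsub>M\<^esub> x) = a \<odot>\<^bsub>N\<^esub> ((c \<odot>\<^bsub>A\<^esub> \<one>\<^bsub>A\<^esub>) \<odot>\<^bsub>N\<^esub> f x)"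
      using fD(3)[OF a x] by simp
  qed (use cA fD in \<open>auto simp: N.smult_closed N.smult_r_distr\<close>)
qed

lemma natural_isoD:
  assumes "natural_iso A B Fo Fm Go Gm \<eta>"
  shows "lmodule A M \<Longrightarrow> \<eta> M \<in> Hom B (Fo M) (Go M)"
    and "lmodule A M \<Longrightarrow> bij_betw (\<eta> M) (carrier (Fo M)) (carrier (Go M))"
    and "lmodule A M \<Longrightarrow> lmodule A N \<Longrightarrow> f \<in> Hom A M N \<Longrightarrow> x \<in> carrier (Fo M) \<Longrightarrow>
        \<eta> N (Fm M N f x) = Gm M N f (\<eta> M x)"
proof -
  show "lmodule A M \<Longrightarrow> \<eta> M \<in> Hom B (Fo M) (Go M)"
    and "lmodule A M \<Longrightarrow> bij_betw (\<eta> M) (carrier (Fo M)) (carrier (Go M))"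
    using assms by (auto simp: natural_iso_def)
  assume "lmodule A M" "lmodule A N" "f \<in> Hom A M N" and x: "x \<in> carrier (Fo M)"
  then have "compose (carrier (Fo M)) (\<eta> N) (Fm M N f) = compose (carrier (Fo M)) (Gm M N f) (\<eta> M)"
    using assms by (auto simp: natural_iso_def)
  then show "\<eta> N (Fm M N f x) = Gm M N f (\<eta> M x)"
    using x by (metis compose_eq)
qed

text \<open>One fully faithful and essentially surjective functor is retained, so that later
  arguments involve neither an inverse functor nor natural isomorphisms. The two size conditions
  provide free modules of rank one over both algebras inside the universe.\<close>

locale module_equivalence = linear_functor K A B Fo Fm
  for K :: "('k, 'x) ring_scheme" and A :: "('k, 'a) module" and B :: "('k, 'b) module"
    and Fo :: "('a, 'u) module \<Rightarrow> ('b, 'u) module"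
    and Fm :: "('a, 'u) module \<Rightarrow> ('a, 'u) module \<Rightarrow> ('u \<Rightarrow> 'u) \<Rightarrow> 'u \<Rightarrow> 'u" +
  assumes A: "k_algebra K A" and B: "k_algebra K B"
    and small_A: "carrier A \<lesssim> (UNIV :: 'u set)" and small_B: "carrier B \<lesssim> (UNIV :: 'u set)"
    and faithful: "\<lbrakk>lmodule A M; lmodule A N; f \<in> Hom A M N; g \<in> Hom A M N; Fm M N f = Fm M N g\<rbrakk> \<Longrightarrow> f = g"
    and full: "\<lbrakk>lmodule A M; lmodule A N; h \<in> Hom B (Fo M) (Fo N)\<rbrakk> \<Longrightarrow> \<exists>f\<in>Hom A M N. Fm M N f = h"
    and ess_surj: "lmodule B (Y :: ('b, 'u) module) \<Longrightarrow> \<exists>M u. lmodule A M \<and> u \<in> Hom B Y (Fo M) \<and> bij_betw u (carrier Y) (carrier (Fo M))"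

text \<open>The functor from \<open>B\<close> to \<open>A\<close> is extracted because the final
  argument moves modules over the second algebra to the first, where \<open>Ext1\<close> is known to
  vanish.\<close>

lemma morita_equivalent_module_equivalence:
  fixes A :: "('k, 'a) module" and B :: "('k, 'b) module"
  assumes A: "k_algebra K A" and B: "k_algebra K B"
    and "large_universe TYPE('u) A" "large_universe TYPE('u) B"
    and "morita_equivalent TYPE('u) K A B"
  shows "\<exists>(Go :: ('b, 'u) module \<Rightarrow> ('a, 'u) module) Gm. module_equivalence K B A Go Gm"
proof -
  obtain Fo Fm and Go :: "('b, 'u) module \<Rightarrow> ('a, 'u) module" and Gm \<eta> \<epsilon>
    where F: "linear_functor K A B Fo Fm" and G: "linear_functor K B A Go Gm"
      and \<eta>: "natural_iso A A (\<lambda>M. M) (\<lambda>M N f. f)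
          (\<lambda>M. Go (Fo M)) (\<lambda>M N f. Gm (Fo M) (Fo N) (Fm M N f)) \<eta>"
      and \<epsilon>: "natural_iso B B (\<lambda>M. Fo (Go M)) (\<lambda>M N f. Fm (Go M) (Go N) (Gm M N f))
          (\<lambda>M. M) (\<lambda>M N f. f) \<epsilon>"
    using assms(5) by (fastforce simp: morita_equivalent_def)
  interpret F: linear_functor K A B Fo Fm by fact
  interpret G: linear_functor K B A Go Gm by fact
  note \<eta>D = natural_isoD[OF \<eta>] and \<epsilon>D = natural_isoD[OF \<epsilon>]
  \<comment> \<open>Faithfulness of \<open>F\<close> serves to prove fullness of \<open>G\<close>
    below.\<close>
  have F_faithful: "f = g" if M: "lmodule A M" and N: "lmodule A N" and f: "f \<in> Hom A M N"
    and g: "g \<in> Hom A M N" and e: "Fm M N f = Fm M N g"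
    for M N :: "('a, 'u) module" and f g
  proof (rule Hom_eqI[OF f g])
    fix x assume x: "x \<in> carrier M"
    have "\<eta> N (f x) = \<eta> N (g x)" using \<eta>D(3)[OF M N f x] \<eta>D(3)[OF M N g x] e by simp
    then show "f x = g x"
      using \<eta>D(2)[OF N] Hom_closed[OF f x] Hom_closed[OF g x] by (auto simp: bij_betw_def inj_on_eq_iff)
  qed
  have "module_equivalence K B A Go Gm"
  proof (intro module_equivalence.intro module_equivalence_axioms.intro)
    show "linear_functor K B A Go Gm" "k_algebra K A" "k_algebra K B" by fact+
    show "carrier A \<lesssim> (UNIV :: 'u set)" "carrier B \<lesssim> (UNIV :: 'u set)"
      using assms(3,4) by (simp_all add: large_universe_def)
  next
    fix M N f g
    assume M: "lmodule B M" and N: "lmodule B N" and f: "f \<in> Hom B M N" and g: "g \<in> Hom B M N"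
      and e: "Gm M N f = Gm M N g"
    show "f = g"
    proof (rule Hom_eqI[OF f g])
      fix x assume "x \<in> carrier M"
      then obtain y where y: "y \<in> carrier (Fo (Go M))" "x = \<epsilon> M y"
        using \<epsilon>D(2)[OF M] by (auto simp: bij_betw_def)
      then show "f x = g x" using \<epsilon>D(3)[OF M N f y(1)] \<epsilon>D(3)[OF M N g y(1)] e by simp
    qed
  next
    fix M N h assume M: "lmodule B M" and N: "lmodule B N" and h: "h \<in> Hom A (Go M) (Go N)"
    note GM = G.obj[OF M] and GN = G.obj[OF N]
    note FGM = F.obj[OF GM] and FGN = F.obj[OF GN]
    note Fh = F.mor[OF GM GN h]
    obtain e where e: "e \<in> Hom B M (Fo (Go M))" "\<And>x. x \<in> carrier M \<Longrightarrow> \<epsilon> M (e x) = x"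
      "\<And>y. y \<in> carrier (Fo (Go M)) \<Longrightarrow> e (\<epsilon> M y) = y"
      by (rule Hom_inverse[OF FGM M \<epsilon>D(1,2)[OF M]]) blast
    \<comment> \<open>The preimage of \<open>h\<close> under \<open>G\<close> is \<open>F h\<close>
      conjugated by \<open>\<epsilon>\<close>. Naturality gives \<open>F (G f) = F h\<close>, and
      faithfulness of \<open>F\<close> gives \<open>G f = h\<close>.\<close>
    define f where "f = compose (carrier M) (\<epsilon> N) (compose (carrier M) (Fm (Go M) (Go N) h) e)"
    have f: "f \<in> Hom B M N"
      unfolding f_def by (rule compose_Hom[OF M compose_Hom[OF M e(1) Fh] \<epsilon>D(1)[OF N]])
    note Gf = G.mor[OF M N f]
    have "Fm (Go M) (Go N) (Gm M N f) = Fm (Go M) (Go N) h"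
    proof (rule Hom_eqI[OF F.mor[OF GM GN Gf] Fh])
      fix y assume y: "y \<in> carrier (Fo (Go M))"
      have "\<epsilon> N (Fm (Go M) (Go N) (Gm M N f) y) = f (\<epsilon> M y)" by (rule \<epsilon>D(3)[OF M N f y])
      also have "\<dots> = \<epsilon> N (Fm (Go M) (Go N) h y)"
        using Hom_closed[OF \<epsilon>D(1)[OF M] y] e(3)[OF y] by (simp add: f_def compose_eq)
      finally show "Fm (Go M) (Go N) (Gm M N f) y = Fm (Go M) (Go N) h y"
        using \<epsilon>D(2)[OF N] Hom_closed[OF F.mor[OF GM GN Gf] y] Hom_closed[OF Fh y]
        by (auto simp: bij_betw_def inj_on_eq_iff)
    qed
    then have "Gm M N f = h" by (rule F_faithful[OF GM GN Gf h])
    then show "\<exists>f\<in>Hom B M N. Gm M N f = h" using f by blast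
  next
    fix N :: "('a, 'u) module" assume "lmodule A N"
    then show "\<exists>M u. lmodule B M \<and> u \<in> Hom A N (Go M) \<and> bij_betw u (carrier N) (carrier (Go M))"
      using F.obj \<eta>D(1,2) by blast
  qed
  then show ?thesis by blast
qed

section \<open>Exactness, simplicity and finiteness under an equivalence\<close>

context module_equivalence
begin

lemma Fm_comp:
  assumes "lmodule A L" "lmodule A M" "lmodule A N" "f \<in> Hom A L M" "g \<in> Hom A M N" "x \<in> carrier (Fo L)"
  shows "Fm L N (compose (carrier L) g f) x = Fm M N g (Fm L M f x)"
  using comp[OF assms(1-5)] assms(6) by (simp add: compose_eq)

text \<open>The zero map satisfies \<open>z + z = z\<close>; additivity of the functor preserves
  this equation, and in a group it has no other solution.\<close>

lemma Fm_zero: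
  assumes M: "lmodule A M" and N: "lmodule A N"
  shows "Fm M N (hom_zero M N) = hom_zero (Fo M) (Fo N)"
proof -
  interpret N: lmodule A N by fact
  interpret FN: lmodule B "Fo N" by (rule obj[OF N])
  let ?z = "Fm M N (hom_zero M N)"
  note z = mor[OF M N hom_zero_Hom[OF M N]]
  have "hom_add M N (hom_zero M N) (hom_zero M N) = hom_zero M N"
    by (auto simp: hom_add_def hom_zero_def fun_eq_iff restrict_def)
  then have e: "?z = hom_add (Fo M) (Fo N) ?z ?z"
    using add[OF M N hom_zero_Hom[OF M N] hom_zero_Hom[OF M N]] by simp
  show ?thesis
  proof (rule Hom_eqI[OF z hom_zero_Hom[OF obj[OF M] obj[OF N]]])
    fix x assume x: "x \<in> carrier (Fo M)"
    have "?z x = ?z x \<oplus>\<^bsub>Fo N\<^esub> ?z x" using fun_cong[OF e, of x] x by (simp add: hom_add_def)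
    then show "?z x = hom_zero (Fo M) (Fo N) x"
      using Hom_closed[OF z x] x by (metis FN.M.add.r_cancel_one hom_zero_def restrict_apply')
  qed
qed

text \<open>Faithfulness in elementwise form. The functor does not act on elements, so the witness
  \<open>y\<close> bears no relation to \<open>x\<close>.\<close>

lemma Fm_nonzero:
  assumes M: "lmodule A M" and N: "lmodule A N" and f: "f \<in> Hom A M N"
    and x: "x \<in> carrier M" "f x \<noteq> \<zero>\<^bsub>N\<^esub>"
  obtains y where "y \<in> carrier (Fo M)" "Fm M N f y \<noteq> \<zero>\<^bsub>Fo N\<^esub>"
proof (rule ccontr)
  assume "\<not> thesis"
  then have "\<And>y. y \<in> carrier (Fo M) \<Longrightarrow> Fm M N f y = \<zero>\<^bsub>Fo N\<^esub>" using that by blast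
  then have "Fm M N f = hom_zero (Fo M) (Fo N)"
    by (intro Hom_eqI[OF mor[OF M N f] hom_zero_Hom[OF obj[OF M] obj[OF N]]]) (simp add: hom_zero_def)
  then have "f = hom_zero M N"
    using faithful[OF M N f hom_zero_Hom[OF M N]] Fm_zero[OF M N] by simp
  then show False using x by (simp add: hom_zero_def)
qed

text \<open>The functor \<open>M \<mapsto> Fo M\<close> to sets is represented by \<open>X\<close> with universal element \<open>w\<close>.\<close>

lemma representing_object:
  obtains X w where "lmodule A X" "w \<in> carrier (Fo X)"
    and "\<And>M y. lmodule A M \<Longrightarrow> y \<in> carrier (Fo M) \<Longrightarrow> \<exists>k\<in>Hom A X M. Fm X M k w = y"
    and "\<And>M k k'. lmodule A M \<Longrightarrow> k \<in> Hom A X M \<Longrightarrow> k' \<in> Hom A X M \<Longrightarrow>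
        Fm X M k w = Fm X M k' w \<Longrightarrow> k = k'"
proof -
  obtain U :: "('b, 'u) module" and e where U: "free_lmodule_on B U e"
    using free_lmodule_on_exists[OF k_algebra_ring[OF B] small_B] by blast
  have lmU: "lmodule B U" and e: "e \<in> carrier U" using U by (auto simp: free_lmodule_on_def)
  \<comment> \<open>\<open>Fo X\<close> is a copy of the free \<open>B\<close>-module of rank one
    with basis element \<open>u e\<close>. So homomorphisms \<open>Fo X \<rightarrow> Fo M\<close>
    correspond to elements of \<open>Fo M\<close>, and by full faithfulness to homomorphisms
    \<open>X \<rightarrow> M\<close>.\<close>
  obtain X u where X: "lmodule A X" and u: "u \<in> Hom B U (Fo X)" "bij_betw u (carrier U) (carrier (Fo X))"
    using ess_surj[OF lmU] by blast
  obtain v where v: "v \<in> Hom B (Fo X) U" "\<And>y. y \<in> carrier (Fo X) \<Longrightarrow> u (v y) = y"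
    "\<And>x. x \<in> carrier U \<Longrightarrow> v (u x) = x"
    by (rule Hom_inverse[OF lmU obj[OF X] u]) blast
  have ue: "u e \<in> carrier (Fo X)" using Hom_closed[OF u(1) e] .
  show ?thesis
  proof (rule that[OF X ue])
    fix M y assume M: "lmodule A M" and y: "y \<in> carrier (Fo M)"
    obtain h where h: "h \<in> Hom B U (Fo M)" "h e = y" by (rule free_lmodule_on_hom[OF U obj[OF M] y])
    have "compose (carrier (Fo X)) h v \<in> Hom B (Fo X) (Fo M)" by (rule compose_Hom[OF obj[OF X] v(1) h(1)])
    then obtain k where "k \<in> Hom A X M" "Fm X M k = compose (carrier (Fo X)) h v"
      using full[OF X M] by blast
    moreover have "compose (carrier (Fo X)) h v (u e) = y" using ue v(3)[OF e] h(2) by (simp add: compose_eq)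
    ultimately show "\<exists>k\<in>Hom A X M. Fm X M k (u e) = y" by metis
  next
    fix M k k' assume M: "lmodule A M" and k: "k \<in> Hom A X M" "k' \<in> Hom A X M"
      and eq: "Fm X M k (u e) = Fm X M k' (u e)"
    note Fk = mor[OF X M k(1)] mor[OF X M k(2)]
    have "compose (carrier U) (Fm X M k) u = compose (carrier U) (Fm X M k') u"
      by (rule free_lmodule_on_hom_eqI[OF U compose_Hom[OF lmU u(1) Fk(1)] compose_Hom[OF lmU u(1) Fk(2)]])
        (use eq e in \<open>simp add: compose_eq\<close>)
    then have *: "Fm X M k (u x) = Fm X M k' (u x)" if "x \<in> carrier U" for x
      using that by (metis compose_eq)
    have "Fm X M k y = Fm X M k' y" if "y \<in> carrier (Fo X)" for y
      using *[OF Hom_closed[OF v(1) that]] v(2)[OF that] by simp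
    then have "Fm X M k = Fm X M k'" by (rule Hom_eqI[OF Fk])
    then show "k = k'" by (rule faithful[OF X M k])
  qed
qed

text \<open>Elements of \<open>Fo Z\<close> are maps \<open>k : X \<rightarrow> Z\<close>. If
  \<open>Fm Z Q i\<close> kills such an element, then \<open>i k = 0\<close>, hence
  \<open>k = 0\<close> as \<open>i\<close> is injective.\<close>

lemma Fm_inj:
  assumes Z: "lmodule A Z" and Q: "lmodule A Q" and i: "i \<in> Hom A Z Q" "inj_on i (carrier Z)"
  shows "inj_on (Fm Z Q i) (carrier (Fo Z))"
proof (rule inj_on_module_homI[OF obj[OF Z] obj[OF Q] HomD[OF mor[OF Z Q i(1)]]])
  fix y assume y: "y \<in> carrier (Fo Z)" "Fm Z Q i y = \<zero>\<^bsub>Fo Q\<^esub>"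
  obtain X w where X: "lmodule A X" "w \<in> carrier (Fo X)"
    and ex: "\<And>M y. lmodule A M \<Longrightarrow> y \<in> carrier (Fo M) \<Longrightarrow> \<exists>k\<in>Hom A X M. Fm X M k w = y"
    and uniq: "\<And>M k k'. lmodule A M \<Longrightarrow> k \<in> Hom A X M \<Longrightarrow> k' \<in> Hom A X M \<Longrightarrow>
        Fm X M k w = Fm X M k' w \<Longrightarrow> k = k'"
    by (rule representing_object) blast
  obtain k where k: "k \<in> Hom A X Z" "Fm X Z k w = y" using ex[OF Z y(1)] by blast
  have "compose (carrier X) i k = hom_zero X Q"
    by (rule uniq[OF Q compose_Hom[OF X(1) k(1) i(1)] hom_zero_Hom[OF X(1) Q]])
      (use Fm_comp[OF X(1) Z Q k(1) i(1) X(2)] k y Fm_zero[OF X(1) Q] X(2) in \<open>simp add: hom_zero_def\<close>)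
  then have "i (k x) = \<zero>\<^bsub>Q\<^esub>" if "x \<in> carrier X" for x
    using that by (metis compose_eq hom_zero_def restrict_apply')
  moreover interpret Z: lmodule A Z by (rule Z)
  have "i \<zero>\<^bsub>Z\<^esub> = \<zero>\<^bsub>Q\<^esub>" by (rule Hom_zero[OF Z Q i(1)])
  ultimately have "k x = \<zero>\<^bsub>Z\<^esub>" if "x \<in> carrier X" for x
    using that i(2) Hom_closed[OF k(1) that] Z.M.zero_closed by (metis inj_onD)
  then have "k = hom_zero X Z"
    by (intro Hom_eqI[OF k(1) hom_zero_Hom[OF X(1) Z]]) (simp add: hom_zero_def)
  then show "y = \<zero>\<^bsub>Fo Z\<^esub>" using k(2) Fm_zero[OF X(1) Z] X(2) by (simp add: hom_zero_def)
qed

text \<open>Left exactness of \<open>Hom(X, -)\<close>: an element of \<open>Fo Q\<close> killed by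
  \<open>Fm Q S q\<close> is a map \<open>k : X \<rightarrow> Q\<close> with \<open>q k = 0\<close>,
  which factors through the injection \<open>i\<close>.\<close>

lemma Fm_exact:
  assumes Z: "lmodule A Z" and Q: "lmodule A Q" and S: "lmodule A S"
    and i: "i \<in> Hom A Z Q" "inj_on i (carrier Z)" and q: "q \<in> Hom A Q S"
    and ex: "i ` carrier Z = {y \<in> carrier Q. q y = \<zero>\<^bsub>S\<^esub>}"
  shows "Fm Z Q i ` carrier (Fo Z) = {y \<in> carrier (Fo Q). Fm Q S q y = \<zero>\<^bsub>Fo S\<^esub>}"
proof (intro equalityI subsetI)
  fix y assume "y \<in> Fm Z Q i ` carrier (Fo Z)"
  then obtain z where z: "z \<in> carrier (Fo Z)" "y = Fm Z Q i z" by blast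
  have "compose (carrier Z) q i = hom_zero Z S"
    by (rule Hom_eqI[OF compose_Hom[OF Z i(1) q] hom_zero_Hom[OF Z S]])
      (use ex in \<open>auto simp: compose_eq hom_zero_def\<close>)
  then have "Fm Q S q y = \<zero>\<^bsub>Fo S\<^esub>"
    using Fm_comp[OF Z Q S i(1) q z(1)] Fm_zero[OF Z S] z by (simp add: hom_zero_def)
  then show "y \<in> {y \<in> carrier (Fo Q). Fm Q S q y = \<zero>\<^bsub>Fo S\<^esub>}"
    using z Hom_closed[OF mor[OF Z Q i(1)]] by simp
next
  fix y assume "y \<in> {y \<in> carrier (Fo Q). Fm Q S q y = \<zero>\<^bsub>Fo S\<^esub>}"
  then have y: "y \<in> carrier (Fo Q)" "Fm Q S q y = \<zero>\<^bsub>Fo S\<^esub>" by auto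
  obtain X w where X: "lmodule A X" "w \<in> carrier (Fo X)"
    and exk: "\<And>M y. lmodule A M \<Longrightarrow> y \<in> carrier (Fo M) \<Longrightarrow> \<exists>k\<in>Hom A X M. Fm X M k w = y"
    and uniq: "\<And>M k k'. lmodule A M \<Longrightarrow> k \<in> Hom A X M \<Longrightarrow> k' \<in> Hom A X M \<Longrightarrow>
        Fm X M k w = Fm X M k' w \<Longrightarrow> k = k'"
    by (rule representing_object) blast
  obtain k where k: "k \<in> Hom A X Q" "Fm X Q k w = y" using exk[OF Q y(1)] by blast
  have "compose (carrier X) q k = hom_zero X S"
    by (rule uniq[OF S compose_Hom[OF X(1) k(1) q] hom_zero_Hom[OF X(1) S]])
      (use Fm_comp[OF X(1) Q S k(1) q X(2)] k y Fm_zero[OF X(1) S] X(2) in \<open>simp add: hom_zero_def\<close>)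
  then have "q (k x) = \<zero>\<^bsub>S\<^esub>" if "x \<in> carrier X" for x
    using that by (metis compose_eq hom_zero_def restrict_apply')
  then have k': "k x \<in> i ` carrier Z" if "x \<in> carrier X" for x
    using that ex Hom_closed[OF k(1)] by simp
  let ?K = "Q\<lparr>carrier := {y \<in> carrier Q. q y = \<zero>\<^bsub>S\<^esub>}\<rparr>"
  have K: "lmodule A ?K" by (rule submodule_lmodule[OF Q module_hom_kernel_submodule[OF Q S HomD[OF q]]])
  have iK: "i \<in> module_hom A Z ?K"
    using module_homD[OF HomD[OF i(1)]] ex by (auto intro!: module_homI)
  have bij: "bij_betw i (carrier Z) (carrier ?K)" using i(2) ex by (simp add: bij_betw_def)
  have kK: "k \<in> module_hom A X ?K"
    using module_homD[OF HomD[OF k(1)]] k' ex by (auto intro!: module_homI)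
  let ?k = "\<lambda>x\<in>carrier X. inv_into (carrier Z) i (k x)"
  have kZ: "?k \<in> Hom A X Z"
    by (rule HomI[OF X(1) module_hom_comp[OF kK module_hom_inv_into[OF Z K iK bij]]])
  have "compose (carrier X) i ?k = k"
    by (rule Hom_eqI[OF compose_Hom[OF X(1) kZ i(1)] k(1)])
      (use k' in \<open>simp add: compose_eq f_inv_into_f\<close>)
  then have "y = Fm Z Q i (Fm X Z ?k w)" using Fm_comp[OF X(1) Z Q kZ i(1) X(2)] k(2) by simp
  then show "y \<in> Fm Z Q i ` carrier (Fo Z)" using Hom_closed[OF mor[OF X(1) Z kZ] X(2)] by blast
qed

text \<open>An element \<open>x\<close> of the kernel of \<open>f\<close> is a map \<open>h\<close>
  from the free module of rank one with \<open>f h = 0\<close>. If \<open>x\<close> is nonzero, then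
  so is \<open>Fm U M h\<close>, and its values lie in the kernel of
  \<open>Fm M N f\<close>.\<close>

lemma Fm_reflects_inj:
  assumes M: "lmodule A M" and N: "lmodule A N" and f: "f \<in> Hom A M N"
    and inj: "inj_on (Fm M N f) (carrier (Fo M))"
  shows "inj_on f (carrier M)"
proof (rule inj_on_module_homI[OF M N HomD[OF f]], rule ccontr)
  fix x assume x: "x \<in> carrier M" "f x = \<zero>\<^bsub>N\<^esub>" "x \<noteq> \<zero>\<^bsub>M\<^esub>"
  obtain U :: "('a, 'u) module" and e where U: "free_lmodule_on A U e"
    using free_lmodule_on_exists[OF k_algebra_ring[OF A] small_A] by blast
  have lmU: "lmodule A U" and e: "e \<in> carrier U" using U by (auto simp: free_lmodule_on_def)
  obtain h where h: "h \<in> Hom A U M" "h e = x" by (rule free_lmodule_on_hom[OF U M x(1)])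
  have "compose (carrier U) f h = hom_zero U N"
    by (rule free_lmodule_on_hom_eqI[OF U compose_Hom[OF lmU h(1) f] hom_zero_Hom[OF lmU N]])
      (use h x e in \<open>simp add: compose_eq hom_zero_def\<close>)
  then have *: "Fm M N f (Fm U M h y) = \<zero>\<^bsub>Fo N\<^esub>" if "y \<in> carrier (Fo U)" for y
    using Fm_comp[OF lmU M N h(1) f that] Fm_zero[OF lmU N] that by (simp add: hom_zero_def)
  have "h e \<noteq> \<zero>\<^bsub>M\<^esub>" using h x by simp
  then obtain y where y: "y \<in> carrier (Fo U)" "Fm U M h y \<noteq> \<zero>\<^bsub>Fo M\<^esub>" by (rule Fm_nonzero[OF lmU M h(1) e])
  interpret FM: lmodule B "Fo M" by (rule obj[OF M])
  have "Fm M N f \<zero>\<^bsub>Fo M\<^esub> = \<zero>\<^bsub>Fo N\<^esub>" by (rule Hom_zero[OF obj[OF M] obj[OF N] mor[OF M N f]])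
  then show False
    using *[OF y(1)] y(2) inj Hom_closed[OF mor[OF lmU M h(1)] y(1)] FM.M.zero_closed by (metis inj_onD)
qed

lemma Fm_surj_of_bij:
  assumes M: "lmodule A M" and N: "lmodule A N" and f: "f \<in> Hom A M N" "bij_betw f (carrier M) (carrier N)"
  shows "Fm M N f ` carrier (Fo M) = carrier (Fo N)"
proof
  show "Fm M N f ` carrier (Fo M) \<subseteq> carrier (Fo N)" using Hom_closed[OF mor[OF M N f(1)]] by blast
  obtain g where g: "g \<in> Hom A N M" "\<And>y. y \<in> carrier N \<Longrightarrow> f (g y) = y"
    by (rule Hom_inverse[OF M N f]) blast
  have "compose (carrier N) f g = (\<lambda>y\<in>carrier N. y)"
    by (rule Hom_eqI[OF compose_Hom[OF N g(1) f(1)] Hom_id[OF N]]) (simp add: compose_eq g(2))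
  then have "Fm M N f (Fm N M g y) = y" if "y \<in> carrier (Fo N)" for y
    using Fm_comp[OF N M N g(1) f(1) that] ident[OF N] that by simp
  then show "carrier (Fo N) \<subseteq> Fm M N f ` carrier (Fo M)"
    using Hom_closed[OF mor[OF N M g(1)]] by (metis imageI subsetI)
qed

text \<open>The inclusion of a nonzero submodule \<open>N\<close> into \<open>Fo S\<close> comes, up
  to isomorphism, from a map \<open>f : M \<rightarrow> S\<close>. This is injective because the
  functor reflects injectivity, and onto because \<open>S\<close> is simple; hence \<open>N\<close>
  is everything.\<close>

lemma Fo_simple:
  assumes S: "simple_lmodule A S"
  shows "simple_lmodule B (Fo S)"
proof -
  have lmS: "lmodule A S" using S by (rule simple_lmoduleD)
  interpret S: lmodule A S by fact
  note FS = obj[OF lmS]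
  interpret FS: lmodule B "Fo S" by (rule FS)
  obtain x where x: "x \<in> carrier S" "x \<noteq> \<zero>\<^bsub>S\<^esub>" using S by (rule simple_lmodule_nonzero)
  then have "(\<lambda>x\<in>carrier S. x) x \<noteq> \<zero>\<^bsub>S\<^esub>" by simp
  then obtain y where "y \<in> carrier (Fo S)" "Fm S S (\<lambda>x\<in>carrier S. x) y \<noteq> \<zero>\<^bsub>Fo S\<^esub>"
    by (rule Fm_nonzero[OF lmS lmS Hom_id[OF lmS] x(1)])
  then have "carrier (Fo S) \<noteq> {\<zero>\<^bsub>Fo S\<^esub>}" using ident[OF lmS] by auto
  moreover have "N = carrier (Fo S)" if N: "Module.submodule N B (Fo S)" and ne: "N \<noteq> {\<zero>\<^bsub>Fo S\<^esub>}" for N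
  proof -
    let ?N = "(Fo S)\<lparr>carrier := N\<rparr>"
    note ND = submoduleD[OF N]
    have lmN: "lmodule B ?N" by (rule submodule_lmodule[OF FS N])
    obtain M u where M: "lmodule A M" and u: "u \<in> Hom B ?N (Fo M)" "bij_betw u (carrier ?N) (carrier (Fo M))"
      using ess_surj[OF lmN] by blast
    obtain v where v: "v \<in> Hom B (Fo M) ?N" "\<And>y. y \<in> carrier (Fo M) \<Longrightarrow> u (v y) = y"
      "\<And>x. x \<in> carrier ?N \<Longrightarrow> v (u x) = x"
      by (rule Hom_inverse[OF lmN obj[OF M] u]) blast
    have "v \<in> Hom B (Fo M) (Fo S)"
      using v(1) ND(1) by (auto simp: Hom_def module_hom_def)
    then obtain f where f: "f \<in> Hom A M S" "Fm M S f = v" using full[OF M lmS] by blast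
    have "inj_on v (carrier (Fo M))" using v(2) by (metis inj_onI)
    then have inj: "inj_on f (carrier M)" using Fm_reflects_inj[OF M lmS f(1)] f(2) by simp
    have "\<exists>x\<in>carrier M. f x \<noteq> \<zero>\<^bsub>S\<^esub>"
    proof (rule ccontr)
      assume "\<not> (\<exists>x\<in>carrier M. f x \<noteq> \<zero>\<^bsub>S\<^esub>)"
      then have "f = hom_zero M S"
        by (intro Hom_eqI[OF f(1) hom_zero_Hom[OF M lmS]]) (simp add: hom_zero_def)
      then have v0: "v = hom_zero (Fo M) (Fo S)" using f(2) Fm_zero[OF M lmS] by simp
      have "n = \<zero>\<^bsub>Fo S\<^esub>" if "n \<in> N" for n
        using v(3)[of n] that Hom_closed[OF u(1), of n] by (simp add: v0 hom_zero_def)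
      then show False using ne ND(2) by blast
    qed
    then obtain x where x: "x \<in> carrier M" "f x \<noteq> \<zero>\<^bsub>S\<^esub>" by blast
    have "bij_betw f (carrier M) (carrier S)"
      using inj simple_lmodule_hom_surj[OF S M HomD[OF f(1)] submodule_self[OF M] x]
      by (simp add: bij_betw_def)
    then have "v ` carrier (Fo M) = carrier (Fo S)" using Fm_surj_of_bij[OF M lmS f(1)] f(2) by simp
    moreover have "v ` carrier (Fo M) \<subseteq> N" using Hom_closed[OF v(1)] by auto
    ultimately show ?thesis using ND(1) by blast
  qed
  ultimately show ?thesis using FS by (auto simp: simple_lmodule_def)
qed

text \<open>
  The copy \<open>U\<close> of \<open>A\<close> is a generator, so the trace of \<open>Fo U\<close> in \<open>Fo X\<close>, a free module of rank one,
  contains the universal element; hence finitely many maps \<open>k : U \<rightarrow> X\<close> detect zero maps out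
  of \<open>X\<close>, and \<open>Fo S = Hom(X, S)\<close> embeds into a finite power of \<open>S = Hom(U, S)\<close>.
\<close>

lemma Fo_noetherian:
  assumes S: "lmodule A S" and fin: "noetherian_lmodule K (base_space A S)"
  shows "noetherian_lmodule K (base_space B (Fo S))"
proof -
  interpret S: lmodule A S by fact
  interpret FS: lmodule B "Fo S" by (rule obj[OF S])
  obtain U :: "('a, 'u) module" and e where U: "free_lmodule_on A U e"
    using free_lmodule_on_exists[OF k_algebra_ring[OF A] small_A] by blast
  have lmU: "lmodule A U" and e: "e \<in> carrier U" using U by (auto simp: free_lmodule_on_def)
  obtain X w where X: "lmodule A X" and w: "w \<in> carrier (Fo X)"
    and exk: "\<And>M y. lmodule A M \<Longrightarrow> y \<in> carrier (Fo M) \<Longrightarrow> \<exists>k\<in>Hom A X M. Fm X M k w = y"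
    and uniq: "\<And>M k k'. lmodule A M \<Longrightarrow> k \<in> Hom A X M \<Longrightarrow> k' \<in> Hom A X M \<Longrightarrow>
        Fm X M k w = Fm X M k' w \<Longrightarrow> k = k'"
    by (rule representing_object) blast
  interpret FX: lmodule B "Fo X" by (rule obj[OF X])
  \<comment> \<open>A finite set \<open>H\<close> of maps \<open>U \<rightarrow> X\<close> amounts
    to finitely many elements \<open>k e\<close> of \<open>X\<close>. The aim is a finite
    \<open>H\<close> detecting \<open>w\<close>, because \<open>Fm X S h w\<close> determines
    \<open>h\<close>.\<close>
  define detects where "detects H t \<longleftrightarrow>
    (\<forall>h\<in>Hom A X S. (\<forall>k\<in>H. h (k e) = \<zero>\<^bsub>S\<^esub>) \<longrightarrow> Fm X S h t = \<zero>\<^bsub>Fo S\<^esub>)" for H t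
  define I where "I = {t \<in> carrier (Fo X). \<exists>H. finite H \<and> H \<subseteq> Hom A U X \<and> detects H t}"
  have FhD: "Fm X S h (x \<oplus>\<^bsub>Fo X\<^esub> y) = Fm X S h x \<oplus>\<^bsub>Fo S\<^esub> Fm X S h y"
    "Fm X S h (b \<odot>\<^bsub>Fo X\<^esub> x) = b \<odot>\<^bsub>Fo S\<^esub> Fm X S h x"
    if "h \<in> Hom A X S" "x \<in> carrier (Fo X)" "y \<in> carrier (Fo X)" "b \<in> carrier B" for h x y b
    using module_homD[OF HomD[OF mor[OF X S that(1)]]] that(2-4) by auto
  \<comment> \<open>Finite sets of maps can be united, so the detected elements form a
    submodule.\<close>
  have I: "Module.submodule I B (Fo X)"
  proof (rule FX.submoduleI)
    have "detects {} \<zero>\<^bsub>Fo X\<^esub>"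
      unfolding detects_def using Hom_zero[OF obj[OF X] obj[OF S] mor[OF X S]] by blast
    then show "\<zero>\<^bsub>Fo X\<^esub> \<in> I" unfolding I_def by blast
  next
    fix x y assume "x \<in> I" "y \<in> I"
    then obtain H H' where x: "x \<in> carrier (Fo X)" "finite H" "H \<subseteq> Hom A U X" "detects H x"
      and y: "y \<in> carrier (Fo X)" "finite H'" "H' \<subseteq> Hom A U X" "detects H' y"
      unfolding I_def by blast
    have "detects (H \<union> H') (x \<oplus>\<^bsub>Fo X\<^esub> y)"
      unfolding detects_def
    proof (intro ballI impI)
      fix h assume h: "h \<in> Hom A X S" "\<forall>k\<in>H \<union> H'. h (k e) = \<zero>\<^bsub>S\<^esub>"
      then have "Fm X S h x = \<zero>\<^bsub>Fo S\<^esub>" "Fm X S h y = \<zero>\<^bsub>Fo S\<^esub>"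
        using x(4) y(4) unfolding detects_def by auto
      then show "Fm X S h (x \<oplus>\<^bsub>Fo X\<^esub> y) = \<zero>\<^bsub>Fo S\<^esub>"
        using FhD(1)[OF h(1) x(1) y(1), of "\<zero>\<^bsub>B\<^esub>"] by simp
    qed
    moreover have "finite (H \<union> H')" "H \<union> H' \<subseteq> Hom A U X" using x y by auto
    ultimately show "x \<oplus>\<^bsub>Fo X\<^esub> y \<in> I" unfolding I_def using x(1) y(1) by blast
  next
    fix b x assume b: "b \<in> carrier B" and "x \<in> I"
    then obtain H where x: "x \<in> carrier (Fo X)" "finite H" "H \<subseteq> Hom A U X" "detects H x"
      unfolding I_def by blast
    have "detects H (b \<odot>\<^bsub>Fo X\<^esub> x)"
      using x(4) FhD(2)[OF _ x(1) x(1) b] b unfolding detects_def by simp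
    then show "b \<odot>\<^bsub>Fo X\<^esub> x \<in> I" unfolding I_def using x b by (auto intro!: FX.smult_closed)
  qed (auto simp: I_def)
  \<comment> \<open>A value of \<open>Fm U X k\<close> is detected by \<open>k\<close> alone:
    \<open>h (k e) = 0\<close> forces \<open>h k = 0\<close>.\<close>
  have trace: "Fm U X k y \<in> I" if k: "k \<in> Hom A U X" and y: "y \<in> carrier (Fo U)" for k y
  proof -
    have "detects {k} (Fm U X k y)" unfolding detects_def
    proof (intro ballI impI)
      fix h assume h: "h \<in> Hom A X S" "\<forall>k\<in>{k}. h (k e) = \<zero>\<^bsub>S\<^esub>"
      have "compose (carrier U) h k = hom_zero U S"
        by (rule free_lmodule_on_hom_eqI[OF U compose_Hom[OF lmU k h(1)] hom_zero_Hom[OF lmU S]])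
          (use h(2) e in \<open>simp add: compose_eq hom_zero_def\<close>)
      then show "Fm X S h (Fm U X k y) = \<zero>\<^bsub>Fo S\<^esub>"
        using Fm_comp[OF lmU X S k h(1) y] Fm_zero[OF lmU S] y by (simp add: hom_zero_def)
    qed
    then show ?thesis unfolding I_def using Hom_closed[OF mor[OF lmU X k] y] k by blast
  qed
  have "w \<in> I"
  proof (rule ccontr)
    assume wI: "w \<notin> I"
    \<comment> \<open>If \<open>w\<close> were not in \<open>I\<close>, the nonzero quotient map
      from \<open>Fo X\<close> to \<open>Fo X / I\<close> would come from a nonzero
      \<open>f : X \<rightarrow> M\<close>. Some \<open>k : U \<rightarrow> X\<close> has
      \<open>f k \<noteq> 0\<close>, but the values of \<open>Fm U X k\<close> lie in
      \<open>I\<close>, where the quotient map vanishes.\<close>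
    obtain C :: "('b, 'u) module" and r where C: "lmodule B C" and r: "r \<in> module_hom B (Fo X) C"
      and ker: "\<And>x. x \<in> carrier (Fo X) \<Longrightarrow> r x = \<zero>\<^bsub>C\<^esub> \<longleftrightarrow> x \<in> I"
      by (rule lmodule_quotient[OF obj[OF X] I]) blast
    obtain M u where M: "lmodule A M" and u: "u \<in> Hom B C (Fo M)" "bij_betw u (carrier C) (carrier (Fo M))"
      using ess_surj[OF C] by blast
    interpret C: lmodule B C by (rule C)
    let ?g = "\<lambda>x\<in>carrier (Fo X). u (r x)"
    have "?g \<in> Hom B (Fo X) (Fo M)" by (rule HomI[OF obj[OF X] module_hom_comp[OF r HomD[OF u(1)]]])
    then obtain f where f: "f \<in> Hom A X M" "Fm X M f = ?g" using full[OF X M] by blast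
    have u0: "u c = \<zero>\<^bsub>Fo M\<^esub> \<longleftrightarrow> c = \<zero>\<^bsub>C\<^esub>" if "c \<in> carrier C" for c
      using that u(2) Hom_zero[OF C obj[OF M] u(1)] C.M.zero_closed
      by (metis bij_betw_imp_inj_on inj_onD)
    have g0: "?g x = \<zero>\<^bsub>Fo M\<^esub> \<longleftrightarrow> x \<in> I" if "x \<in> carrier (Fo X)" for x
      using that u0[OF module_homD(1)[OF r that]] ker[OF that] by simp
    have "\<exists>x\<in>carrier X. f x \<noteq> \<zero>\<^bsub>M\<^esub>"
    proof (rule ccontr)
      assume "\<not> (\<exists>x\<in>carrier X. f x \<noteq> \<zero>\<^bsub>M\<^esub>)"
      then have "f = hom_zero X M"
        by (intro Hom_eqI[OF f(1) hom_zero_Hom[OF X M]]) (simp add: hom_zero_def)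
      then have "?g w = \<zero>\<^bsub>Fo M\<^esub>" using f(2) Fm_zero[OF X M] w by (metis hom_zero_def restrict_apply')
      then show False using g0[OF w] wI by simp
    qed
    then obtain x where x: "x \<in> carrier X" "f x \<noteq> \<zero>\<^bsub>M\<^esub>" by blast
    obtain k where k: "k \<in> Hom A U X" "k e = x" by (rule free_lmodule_on_hom[OF U X x(1)])
    have "compose (carrier U) f k e \<noteq> \<zero>\<^bsub>M\<^esub>" using e k x by (simp add: compose_eq)
    then obtain y where y: "y \<in> carrier (Fo U)" "Fm U M (compose (carrier U) f k) y \<noteq> \<zero>\<^bsub>Fo M\<^esub>"
      by (rule Fm_nonzero[OF lmU M compose_Hom[OF lmU k(1) f(1)] e])
    then have "?g (Fm U X k y) \<noteq> \<zero>\<^bsub>Fo M\<^esub>" using Fm_comp[OF lmU X M k(1) f(1) y(1)] f(2) by simp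
    then show False using g0[OF Hom_closed[OF mor[OF lmU X k(1)] y(1)]] trace[OF k(1) y(1)] by simp
  qed
  then obtain H where H: "finite H" "H \<subseteq> Hom A U X" "detects H w" unfolding I_def by blast
  \<comment> \<open>\<open>h\<close> inverts evaluation at \<open>w\<close>. Uniqueness of
    representing maps makes it additive and, as the functor respects scalars,
    \<open>K\<close>-linear.\<close>
  obtain h where h: "\<And>y. y \<in> carrier (Fo S) \<Longrightarrow> h y \<in> Hom A X S \<and> Fm X S (h y) w = y"
    using exk[OF S] by metis
  have h_add: "h (y \<oplus>\<^bsub>Fo S\<^esub> z) = hom_add X S (h y) (h z)" if y: "y \<in> carrier (Fo S)" and z: "z \<in> carrier (Fo S)" for y z
  proof (rule uniq[OF S])
    show "h (y \<oplus>\<^bsub>Fo S\<^esub> z) \<in> Hom A X S" using h y z by simp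
    show "hom_add X S (h y) (h z) \<in> Hom A X S" using hom_add_Hom[OF X S] h y z by blast
    show "Fm X S (h (y \<oplus>\<^bsub>Fo S\<^esub> z)) w = Fm X S (hom_add X S (h y) (h z)) w"
      using add[OF X S, of "h y" "h z"] h y z w by (simp add: hom_add_def)
  qed
  have h_scale: "h ((c \<odot>\<^bsub>B\<^esub> \<one>\<^bsub>B\<^esub>) \<odot>\<^bsub>Fo S\<^esub> y) = hom_scale A X S c (h y)"
    if c: "c \<in> carrier K" and y: "y \<in> carrier (Fo S)" for c y
  proof (rule uniq[OF S])
    have cy: "(c \<odot>\<^bsub>B\<^esub> \<one>\<^bsub>B\<^esub>) \<odot>\<^bsub>Fo S\<^esub> y \<in> carrier (Fo S)"
      using k_algebra_scalar_closed[OF B c] y by (rule FS.smult_closed)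
    then show "h ((c \<odot>\<^bsub>B\<^esub> \<one>\<^bsub>B\<^esub>) \<odot>\<^bsub>Fo S\<^esub> y) \<in> Hom A X S" using h by blast
    show "hom_scale A X S c (h y) \<in> Hom A X S" using hom_scale_Hom[OF A X S _ c] h y by blast
    show "Fm X S (h ((c \<odot>\<^bsub>B\<^esub> \<one>\<^bsub>B\<^esub>) \<odot>\<^bsub>Fo S\<^esub> y)) w = Fm X S (hom_scale A X S c (h y)) w"
      using scale[OF X S _ c, of "h y"] h[OF cy] h[OF y] w by (simp add: hom_scale_def)
  qed
  show ?thesis
  proof (rule noetherian_joint_inj[OF base_space_lmodule[OF B obj[OF S]] base_space_lmodule[OF A S] fin])
    \<comment> \<open>For \<open>k\<close> in \<open>H\<close> these are the evaluations at
      \<open>k e\<close>; they are jointly injective because \<open>H\<close> detects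
      \<open>w\<close>.\<close>
    let ?L = "\<lambda>k y. h y (k e)"
    show "finite (?L ` H)" using H(1) by simp
    show "?L ` H \<subseteq> module_hom K (base_space B (Fo S)) (base_space A S)"
    proof
      fix l assume "l \<in> ?L ` H"
      then obtain k where k: "k \<in> Hom A U X" "l = ?L k" using H(2) by blast
      have ke: "k e \<in> carrier X" using Hom_closed[OF k(1) e] .
      show "l \<in> module_hom K (base_space B (Fo S)) (base_space A S)"
        unfolding k(2)
        by (rule module_homI)
          (use ke h in \<open>auto simp: h_add h_scale hom_add_def hom_scale_def intro: Hom_closed\<close>)
    qed
    fix y assume y: "y \<in> carrier (base_space B (Fo S))" "\<forall>l\<in>?L ` H. l y = \<zero>\<^bsub>base_space A S\<^esub>"
    then have "Fm X S (h y) w = \<zero>\<^bsub>Fo S\<^esub>" using H(3) h unfolding detects_def by simp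
    then show "y = \<zero>\<^bsub>base_space B (Fo S)\<^esub>" using h y(1) by simp
  qed
qed

text \<open>\<open>S'\<close> and \<open>T'\<close> stand for \<open>Fo S\<close> and
  \<open>Fo T\<close> in the element types for which \<open>Ext1\<close> is known to vanish. The map
  \<open>\<phi>\<close> is carried to the kernel of \<open>Fo Q \<rightarrow> S'\<close>, extended
  there and brought back by fullness. That \<open>Fo Q \<rightarrow> S'\<close> is onto comes from
  its being nonzero and \<open>S'\<close> simple.\<close>

lemma extension_reflect:
  fixes Q S T :: "('a, 'u) module" and S' :: "('b, 's) module" and T' :: "('b, 't) module"
  assumes Q: "lmodule A Q" and S: "lmodule A S" and T: "lmodule A T"
    and S': "simple_lmodule B S'" and T': "lmodule B T'"
    and a: "a \<in> module_hom B (Fo S) S'" "bij_betw a (carrier (Fo S)) (carrier S')"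
    and b: "b \<in> module_hom B (Fo T) T'" "bij_betw b (carrier (Fo T)) (carrier T')"
    and triv: "carrier (Ext1 B S' T') = {\<one>\<^bsub>Ext1 B S' T'\<^esub>}"
    and q: "q \<in> Hom A Q S" and x: "x \<in> carrier Q" "q x \<noteq> \<zero>\<^bsub>S\<^esub>"
    and \<phi>: "\<phi> \<in> module_hom A (Q\<lparr>carrier := {y \<in> carrier Q. q y = \<zero>\<^bsub>S\<^esub>}\<rparr>) T"
  shows "\<exists>\<psi>\<in>module_hom A Q T. \<forall>y\<in>carrier Q. q y = \<zero>\<^bsub>S\<^esub> \<longrightarrow> \<psi> y = \<phi> y"
proof -
  let ?Z = "Q\<lparr>carrier := {y \<in> carrier Q. q y = \<zero>\<^bsub>S\<^esub>}\<rparr>"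
  have Z: "lmodule A ?Z" by (rule submodule_lmodule[OF Q module_hom_kernel_submodule[OF Q S HomD[OF q]]])
  let ?i = "\<lambda>y\<in>carrier ?Z. y" and ?\<phi> = "\<lambda>y\<in>carrier ?Z. \<phi> y"
  have i: "?i \<in> Hom A ?Z Q" by (rule HomI[OF Z]) (auto simp: module_hom_def)
  have \<phi>': "?\<phi> \<in> Hom A ?Z T" by (rule HomI[OF Z \<phi>])
  have inj: "inj_on ?i (carrier ?Z)" by (auto simp: inj_on_def)
  note lm = obj[OF Z] obj[OF Q] obj[OF S] obj[OF T] simple_lmoduleD(1)[OF S']
  interpret FS: lmodule B "Fo S" by (rule lm)
  interpret S': lmodule B S' by (rule lm)
  let ?Fi = "Fm ?Z Q ?i" and ?Fq = "Fm Q S q" and ?F\<phi> = "Fm ?Z T ?\<phi>"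
  note Fi = mor[OF Z Q i] and Fq = mor[OF Q S q] and F\<phi> = mor[OF Z T \<phi>']
  have Fi_inj: "inj_on ?Fi (carrier (Fo ?Z))" by (rule Fm_inj[OF Z Q i inj])
  have exact: "?Fi ` carrier (Fo ?Z) = {y \<in> carrier (Fo Q). ?Fq y = \<zero>\<^bsub>Fo S\<^esub>}"
    by (rule Fm_exact[OF Z Q S i inj q]) auto
  let ?q = "\<lambda>y. a (?Fq y)"
  have q': "?q \<in> module_hom B (Fo Q) S'" by (rule module_hom_comp[OF HomD[OF Fq] a(1)])
  have a0: "a s = \<zero>\<^bsub>S'\<^esub> \<longleftrightarrow> s = \<zero>\<^bsub>Fo S\<^esub>" if "s \<in> carrier (Fo S)" for s
    using that a(2) lmodule_hom_zero[OF lm(3,5) a(1)] FS.M.zero_closed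
    by (metis bij_betw_imp_inj_on inj_onD)
  have ker: "{y \<in> carrier (Fo Q). ?q y = \<zero>\<^bsub>S'\<^esub>} = {y \<in> carrier (Fo Q). ?Fq y = \<zero>\<^bsub>Fo S\<^esub>}"
    using a0 Hom_closed[OF Fq] by auto
  obtain y where y: "y \<in> carrier (Fo Q)" "?Fq y \<noteq> \<zero>\<^bsub>Fo S\<^esub>" by (rule Fm_nonzero[OF Q S q x])
  have "?q y \<noteq> \<zero>\<^bsub>S'\<^esub>" using a0[OF Hom_closed[OF Fq y(1)]] y(2) by simp
  then have surj: "?q ` carrier (Fo Q) = carrier S'"
    by (rule simple_lmodule_hom_surj[OF S' lm(2) q' submodule_self[OF lm(2)] y(1)])
  let ?K = "(Fo Q)\<lparr>carrier := {y \<in> carrier (Fo Q). ?q y = \<zero>\<^bsub>S'\<^esub>}\<rparr>"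
  have K: "lmodule B ?K" by (rule submodule_lmodule[OF lm(2) module_hom_kernel_submodule[OF lm(2,5) q']])
  have FiK: "?Fi \<in> module_hom B (Fo ?Z) ?K"
    using module_homD[OF HomD[OF Fi]] exact unfolding ker by (auto intro!: module_homI)
  have FiK_surj: "?Fi ` carrier (Fo ?Z) = carrier ?K" using exact unfolding ker by simp
  \<comment> \<open>By exactness the kernel is the injective image of \<open>Fo ?Z\<close>, so the
    transported \<open>\<phi>\<close> becomes a map \<open>g\<close> on the kernel itself.\<close>
  obtain g where g: "g \<in> module_hom B ?K T'" "\<And>z. z \<in> carrier (Fo ?Z) \<Longrightarrow> g (?Fi z) = b (?F\<phi> z)"
  proof (rule module_hom_factor[OF lm(1) K T' FiK FiK_surj module_hom_comp[OF HomD[OF F\<phi>] b(1)]])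
    fix z assume z: "z \<in> carrier (Fo ?Z)" "?Fi z = \<zero>\<^bsub>?K\<^esub>"
    interpret FZ: lmodule B "Fo ?Z" by (rule lm)
    have "?Fi z = ?Fi \<zero>\<^bsub>Fo ?Z\<^esub>" using z Hom_zero[OF lm(1,2) Fi] by simp
    then have "z = \<zero>\<^bsub>Fo ?Z\<^esub>" by (rule inj_onD[OF Fi_inj _ z(1) FZ.M.zero_closed])
    then show "b (?F\<phi> z) = \<zero>\<^bsub>T'\<^esub>"
      using Hom_zero[OF lm(1,4) F\<phi>] lmodule_hom_zero[OF lm(4) T' b(1)] by simp
  qed blast
  obtain \<theta> where \<theta>: "\<theta> \<in> module_hom B (Fo Q) T'"
    "\<And>y. y \<in> carrier (Fo Q) \<Longrightarrow> ?q y = \<zero>\<^bsub>S'\<^esub> \<Longrightarrow> \<theta> y = g y"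
    using Ext1_trivial_extends[OF lm(5) T' triv lm(2) q' surj g(1)] by blast
  let ?c = "\<lambda>y\<in>carrier (Fo Q). inv_into (carrier (Fo T)) b (\<theta> y)"
  have "?c \<in> Hom B (Fo Q) (Fo T)"
    by (rule HomI[OF lm(2) module_hom_comp[OF \<theta>(1) module_hom_inv_into[OF lm(4) T' b]]])
  then obtain \<psi> where \<psi>: "\<psi> \<in> Hom A Q T" "Fm Q T \<psi> = ?c" using full[OF Q T] by blast
  \<comment> \<open>The restriction of \<open>\<psi>\<close> and the map \<open>\<phi>\<close> have
    the same image under the functor, so faithfulness identifies them.\<close>
  have eq: "compose (carrier ?Z) \<psi> ?i = ?\<phi>"
  proof (rule faithful[OF Z T compose_Hom[OF Z i \<psi>(1)] \<phi>'],
      rule Hom_eqI[OF mor[OF Z T compose_Hom[OF Z i \<psi>(1)]] F\<phi>])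
    fix z assume z: "z \<in> carrier (Fo ?Z)"
    have Fz: "?Fi z \<in> carrier (Fo Q)" "?q (?Fi z) = \<zero>\<^bsub>S'\<^esub>" using FiK_surj z by auto
    have "Fm ?Z T (compose (carrier ?Z) \<psi> ?i) z = ?c (?Fi z)"
      using Fm_comp[OF Z Q T i \<psi>(1) z] \<psi>(2) by simp
    also have "\<dots> = inv_into (carrier (Fo T)) b (b (?F\<phi> z))" using Fz \<theta>(2)[OF Fz] g(2)[OF z] by simp
    also have "\<dots> = ?F\<phi> z" by (rule bij_betw_inv_into_left[OF b(2) Hom_closed[OF F\<phi> z]])
    finally show "Fm ?Z T (compose (carrier ?Z) \<psi> ?i) z = ?F\<phi> z" .
  qed
  have "\<psi> y = \<phi> y" if "y \<in> carrier Q" "q y = \<zero>\<^bsub>S\<^esub>" for y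
    using fun_cong[OF eq, of y] that by (simp add: compose_eq)
  then show ?thesis using HomD[OF \<psi>(1)] by blast
qed

end

text \<open>Any nonzero element generates \<open>S\<close>, so \<open>S\<close> is an image of the
  ring; hence it has a copy in every universe into which the ring injects.\<close>

lemma simple_lmodule_lepoll:
  assumes S: "simple_lmodule R S"
  shows "carrier S \<lesssim> carrier R"
proof -
  have lm: "lmodule R S" using S by (rule simple_lmoduleD)
  interpret lmodule R S by (rule lm)
  note reg = regular_lmodule[OF R.ring_axioms]
  obtain x where x: "x \<in> carrier S" "x \<noteq> \<zero>\<^bsub>S\<^esub>" using S by (rule simple_lmodule_nonzero)
  have "(\<lambda>a. a \<odot>\<^bsub>S\<^esub> x) ` carrier R = carrier S"
    by (rule simple_lmodule_hom_surj[OF S reg module_hom_eval[OF lm x(1)], of _ "\<one>\<^bsub>R\<^esub>"])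
      (use submodule_self[OF reg] x smult_one in auto)
  then show ?thesis by (metis image_lepoll)
qed

theorem theorem3p14:
  fixes K :: "('k, 'x) ring_scheme"
    and \<Lambda> :: "('k, 'a) module"
    and \<Gamma> :: "('k, 'b) module"
  assumes "k_algebra K \<Lambda>" and "k_algebra K \<Gamma>"
    and "large_universe TYPE('u) \<Lambda>" and "large_universe TYPE('u) \<Gamma>"
    and "morita_equivalent TYPE('u) K \<Lambda> \<Gamma>"
    and "quasicommutative K \<Lambda>"
  shows "quasicommutative K \<Gamma>"
  unfolding quasicommutative_def
proof (intro ballI impI)
  obtain Go :: "('b, 'u) module \<Rightarrow> ('a, 'u) module" and Gm where "module_equivalence K \<Gamma> \<Lambda> Go Gm"
    using morita_equivalent_module_equivalence[OF assms(1-5)] by blast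
  then interpret G: module_equivalence K \<Gamma> \<Lambda> Go Gm .
  \<comment> \<open>Each simple module is replaced by a copy \<open>S\<close> in the universe; its
    image is simple and finite dimensional, hence isomorphic to the simple module at its own
    annihilator. The isomorphisms are recorded for \<open>extension_reflect\<close>, and
    \<open>finitely_faithful\<close> for the comparison of two images.\<close>
  have copy: "\<exists>(S :: ('b, 'u) module) s f. simple_lmodule \<Gamma> S \<and>
      s \<in> module_hom \<Gamma> (simple_at \<Gamma> I) S \<and> bij_betw s (carrier (simple_at \<Gamma> I)) (carrier S) \<and>
      annihilator \<Gamma> S = I \<and> annihilator \<Lambda> (Go S) \<in> cfs K \<Lambda> \<and> finitely_faithful \<Lambda> (Go S) \<and>
      f \<in> module_hom \<Lambda> (Go S) (simple_at \<Lambda> (annihilator \<Lambda> (Go S))) \<and>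
      bij_betw f (carrier (Go S)) (carrier (simple_at \<Lambda> (annihilator \<Lambda> (Go S))))"
    if I: "I \<in> cfs K \<Gamma>" for I
  proof -
    let ?S = "simple_at \<Gamma> I"
    have max: "maximalideal I \<Gamma>" using I by (simp add: cfs_def)
    note simple = simple_at_simple[OF max]
    note lm = simple_lmoduleD(1)[OF simple]
    obtain S :: "('b, 'u) module" and s where S: "lmodule \<Gamma> S"
      and s: "s \<in> module_hom \<Gamma> ?S S" "bij_betw s (carrier ?S) (carrier S)"
      using lmodule_copy[OF lm lepoll_trans[OF simple_lmodule_lepoll[OF simple] G.small_A]] by blast
    have S_simple: "simple_lmodule \<Gamma> S" by (rule simple_lmodule_transfer[OF simple S s])
    have ann: "annihilator \<Gamma> S = I"
      using annihilator_transfer[OF lm S s] simple_at_annihilator[OF max] by simp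
    have "noetherian_lmodule K (base_space \<Gamma> S)"
      by (rule noetherian_surj[OF base_space_lmodule[OF assms(2) lm] cfs_simple_at_noetherian[OF assms(2) I]
            base_space_lmodule[OF assms(2) S] module_hom_base_space[OF assms(2) s(1)]])
        (use s(2) in \<open>simp add: bij_betw_def\<close>)
    then have noeth: "noetherian_lmodule K (base_space \<Lambda> (Go S))" by (rule G.Fo_noetherian[OF S])
    have GS: "simple_lmodule \<Lambda> (Go S)" by (rule G.Fo_simple[OF S_simple])
    let ?I = "annihilator \<Lambda> (Go S)"
    have cfs: "?I \<in> cfs K \<Lambda>" by (rule annihilator_cfs[OF assms(1) GS noeth])
    then have max': "maximalideal ?I \<Lambda>" by (simp add: cfs_def)
    have ff: "finitely_faithful \<Lambda> (Go S)"
      by (rule noetherian_finitely_faithful[OF assms(1) simple_lmoduleD(1)[OF GS] noeth])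
    obtain f where "f \<in> module_hom \<Lambda> (Go S) (simple_at \<Lambda> ?I)"
      "bij_betw f (carrier (Go S)) (carrier (simple_at \<Lambda> ?I))"
      by (rule simple_lmodules_isomorphic[OF GS simple_at_simple[OF max'] ff])
        (simp add: simple_at_annihilator[OF max'])
    then show ?thesis using S_simple s ann cfs ff by blast
  qed
  fix I J assume I: "I \<in> cfs K \<Gamma>" and J: "J \<in> cfs K \<Gamma>" and ne: "I \<noteq> J"
  let ?S = "simple_at \<Gamma> I" and ?T = "simple_at \<Gamma> J"
  obtain S :: "('b, 'u) module" and s f where S: "simple_lmodule \<Gamma> S"
    and s: "s \<in> module_hom \<Gamma> ?S S" "bij_betw s (carrier ?S) (carrier S)"
    and annS: "annihilator \<Gamma> S = I" and I': "annihilator \<Lambda> (Go S) \<in> cfs K \<Lambda>"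
    and ff: "finitely_faithful \<Lambda> (Go S)"
    and f: "f \<in> module_hom \<Lambda> (Go S) (simple_at \<Lambda> (annihilator \<Lambda> (Go S)))"
      "bij_betw f (carrier (Go S)) (carrier (simple_at \<Lambda> (annihilator \<Lambda> (Go S))))"
    using copy[OF I] by blast
  obtain T :: "('b, 'u) module" and t g where T: "simple_lmodule \<Gamma> T"
    and t: "t \<in> module_hom \<Gamma> ?T T" "bij_betw t (carrier ?T) (carrier T)"
    and annT: "annihilator \<Gamma> T = J" and J': "annihilator \<Lambda> (Go T) \<in> cfs K \<Lambda>"
    and g: "g \<in> module_hom \<Lambda> (Go T) (simple_at \<Lambda> (annihilator \<Lambda> (Go T)))"
      "bij_betw g (carrier (Go T)) (carrier (simple_at \<Lambda> (annihilator \<Lambda> (Go T))))"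
    using copy[OF J] by blast
  let ?I = "annihilator \<Lambda> (Go S)" and ?J = "annihilator \<Lambda> (Go T)"
  note lmS = simple_lmoduleD(1)[OF S] and lmT = simple_lmoduleD(1)[OF T]
  note GS = G.Fo_simple[OF S] and GT = G.Fo_simple[OF T]
  have maxI: "maximalideal I \<Gamma>" and maxJ: "maximalideal J \<Gamma>"
    and maxI': "maximalideal ?I \<Lambda>" and maxJ': "maximalideal ?J \<Lambda>"
    using I J I' J' by (simp_all add: cfs_def)
  \<comment> \<open>Simple modules with equal annihilators are isomorphic here, and by fullness the
    isomorphism would come from a nonzero map \<open>S \<rightarrow> T\<close>. That map is
    bijective, whence \<open>I = J\<close>.\<close>
  have ne': "?I \<noteq> ?J"
  proof
    assume "?I = ?J"
    then obtain h where h: "h \<in> module_hom \<Lambda> (Go S) (Go T)" "bij_betw h (carrier (Go S)) (carrier (Go T))"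
      using simple_lmodules_isomorphic[OF GS GT ff] by blast
    let ?h = "\<lambda>x\<in>carrier (Go S). h x"
    obtain k where k: "k \<in> Hom \<Gamma> S T" "Gm S T k = ?h"
      using G.full[OF lmS lmT HomI[OF G.obj[OF lmS] h(1)]] by blast
    have "\<exists>x\<in>carrier S. k x \<noteq> \<zero>\<^bsub>T\<^esub>"
    proof (rule ccontr)
      assume "\<not> (\<exists>x\<in>carrier S. k x \<noteq> \<zero>\<^bsub>T\<^esub>)"
      then have "k = hom_zero S T"
        by (intro Hom_eqI[OF k(1) hom_zero_Hom[OF lmS lmT]]) (simp add: hom_zero_def)
      then have h0: "?h = hom_zero (Go S) (Go T)" using k(2) G.Fm_zero[OF lmS lmT] by simp
      obtain y where y: "y \<in> carrier (Go T)" "y \<noteq> \<zero>\<^bsub>Go T\<^esub>" using GT by (rule simple_lmodule_nonzero)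
      then obtain x where "x \<in> carrier (Go S)" "y = h x" using h(2) by (auto simp: bij_betw_def)
      then show False using fun_cong[OF h0, of x] y(2) by (simp add: hom_zero_def)
    qed
    then have "bij_betw k (carrier S) (carrier T)"
      using simple_lmodule_hom_bij[OF S T HomD[OF k(1)]] by blast
    then have "I = J" using annihilator_transfer[OF lmS lmT HomD[OF k(1)]] annS annT by simp
    then show False using ne by simp
  qed
  have triv: "carrier (Ext1 \<Lambda> (simple_at \<Lambda> ?I) (simple_at \<Lambda> ?J)) = {\<one>\<^bsub>Ext1 \<Lambda> (simple_at \<Lambda> ?I) (simple_at \<Lambda> ?J)\<^esub>}"
    using assms(6) I' J' ne' by (simp add: quasicommutative_def)
  note simple = simple_at_simple[OF maxI] and simpleT = simple_at_simple[OF maxJ]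
  note lmS0 = simple_lmoduleD(1)[OF simple] and lmT0 = simple_lmoduleD(1)[OF simpleT]
  obtain U :: "('b, 'u) module" and e where U: "free_lmodule_on \<Gamma> U e"
    using free_lmodule_on_exists[OF k_algebra_ring[OF assms(2)] G.small_A] by blast
  have lmU: "lmodule \<Gamma> U" and e: "e \<in> carrier U" using U by (auto simp: free_lmodule_on_def)
  obtain x where x: "x \<in> carrier ?S" "x \<noteq> \<zero>\<^bsub>?S\<^esub>" using simple by (rule simple_lmodule_nonzero)
  obtain p where p: "p \<in> Hom \<Gamma> U ?S" "p e = x" by (rule free_lmodule_on_hom[OF U lmS0 x(1)])
  have surj: "p ` carrier U = carrier ?S"
    by (rule simple_lmodule_hom_surj[OF simple lmU HomD[OF p(1)] submodule_self[OF lmU] e])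
      (use p x in simp)
  \<comment> \<open>The functor needs a target in the universe, while the goal concerns
    \<open>?S\<close>; composing with the isomorphism \<open>s\<close> does not change the
    kernel.\<close>
  let ?q = "\<lambda>y\<in>carrier U. s (p y)"
  have q: "?q \<in> Hom \<Gamma> U S" by (rule HomI[OF lmU module_hom_comp[OF HomD[OF p(1)] s(1)]])
  interpret S0: lmodule \<Gamma> ?S by (rule lmS0)
  have q0: "?q y = \<zero>\<^bsub>S\<^esub> \<longleftrightarrow> p y = \<zero>\<^bsub>?S\<^esub>" if "y \<in> carrier U" for y
    using that Hom_closed[OF p(1) that] s(2) lmodule_hom_zero[OF lmS0 lmS s(1)] S0.M.zero_closed
    by (metis bij_betw_imp_inj_on inj_onD restrict_apply')
  have qe: "?q e \<noteq> \<zero>\<^bsub>S\<^esub>" using q0[OF e] p(2) x(2) by simp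
  show "carrier (Ext1 \<Gamma> ?S ?T) = {\<one>\<^bsub>Ext1 \<Gamma> ?S ?T\<^esub>}"
  proof (rule Ext1_trivialI[OF lmS0 lmT0 U HomD[OF p(1)] surj])
    fix \<phi> assume \<phi>: "\<phi> \<in> module_hom \<Gamma> (U\<lparr>carrier := {x \<in> carrier U. p x = \<zero>\<^bsub>?S\<^esub>}\<rparr>) ?T"
    have ker: "{y \<in> carrier U. p y = \<zero>\<^bsub>?S\<^esub>} = {y \<in> carrier U. ?q y = \<zero>\<^bsub>S\<^esub>}" using q0 by blast
    \<comment> \<open>Likewise \<open>t\<close> moves the target of \<open>\<phi>\<close> into the
      universe, and its inverse brings the extension back.\<close>
    have "(\<lambda>y. t (\<phi> y)) \<in> module_hom \<Gamma> (U\<lparr>carrier := {y \<in> carrier U. ?q y = \<zero>\<^bsub>S\<^esub>}\<rparr>) T"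
      using module_hom_comp[OF \<phi> t(1)] unfolding ker .
    from G.extension_reflect[OF lmU lmS lmT simple_at_simple[OF maxI']
        simple_lmoduleD(1)[OF simple_at_simple[OF maxJ']] f g triv q e qe this]
    obtain \<psi> where \<psi>: "\<psi> \<in> module_hom \<Gamma> U T"
      "\<forall>y\<in>carrier U. ?q y = \<zero>\<^bsub>S\<^esub> \<longrightarrow> \<psi> y = t (\<phi> y)"
      by (elim bexE)
    have hom: "(\<lambda>y. inv_into (carrier ?T) t (\<psi> y)) \<in> module_hom \<Gamma> U ?T"
      by (rule module_hom_comp[OF \<psi>(1) module_hom_inv_into[OF lmT0 lmT t]])
    have "inv_into (carrier ?T) t (\<psi> y) = \<phi> y" if "y \<in> carrier U" "p y = \<zero>\<^bsub>?S\<^esub>" for y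
    proof -
      have "\<phi> y \<in> carrier ?T" using module_homD(1)[OF \<phi>, of y] that by simp
      moreover have "\<psi> y = t (\<phi> y)" using \<psi>(2) q0 that by blast
      ultimately show ?thesis using bij_betw_inv_into_left[OF t(2)] by simp
    qed
    then show "\<exists>\<psi>\<in>module_hom \<Gamma> U ?T. \<forall>x\<in>carrier U. p x = \<zero>\<^bsub>?S\<^esub> \<longrightarrow> \<psi> x = \<phi> x"
      by (intro bexI[OF _ hom]) simp
  qed
qed

end
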